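(* Let $d=2m$, where $m\ge 1$ is an integer. For every $R\in(0,\pi]$ there is a function $\varphi\colon[0,\infty)\to\mathbb R$ with the following properties: (1) the radial extension $\mathbf{x}\mapsto\varphi(\|\mathbf{x}\|_2)$ belongs to $C_c^\infty(\mathbb R^d)$, and the support radius of $\varphi$ is exactly $R$; (2) the kernel $(\mathbf{x},\mathbf{y})\mapsto\varphi(\|\mathbf{x}-\mathbf{y}\|_2)$ is strictly positive definite on $\mathbb R^d$; (3) the kernel $(\mathbf{x},\mathbf{y})\mapsto\varphi(\rho(\mathbf{x},\mathbf{y}))$ is not positive definite on $\mathbb S^d$. Moreover, $\varphi$ may be taken (with properties (1)--(3) all holding) of the form $\varphi(r)=(q*q)(r\mathbf{e}_1)$ for $r\ge 0$, where $\mathbf{e}_1=(1,0,\ldots,0)^T\in\mathbb R^d$ and $q\in C_c^\infty(\mathbb R^d)$ is a nonzero real-valued radial function with $\operatorname{supp} q=\overline B_{R/2}$, and such that the degree-two Gegenbauer coefficient of $\varphi$ is strictly negative: $B_{2,d}(\varphi)<0$.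
   Context: $\|\cdot\|_2$ is the Euclidean norm; $B_r=\{\mathbf{x}\in\mathbb R^d:\|\mathbf{x}\|_2<r\}$ and $\overline B_r$ is its closure. $\mathbb S^d=\{\mathbf{x}\in\mathbb R^{d+1}:\|\mathbf{x}\|_2=1\}$ with geodesic distance $\rho(\mathbf{x},\mathbf{y})=\arccos(\mathbf{x}\cdot\mathbf{y})\in[0,\pi]$. A real symmetric kernel $K$ on a set $X$ is positive definite if $\sum_{j,k=1}^n c_j\overline{c_k}K(\mathbf{x}_j,\mathbf{x}_k)\ge 0$ for all $n\ge 1$, all points $\mathbf{x}_1,\dots,\mathbf{x}_n\in X$ and all scalars $c_1,\dots,c_n$; it is strictly positive definite if this sum is $>0$ whenever the points are distinct and the $c_j$ are not all zero. For a nonzero compactly supported function $\varphi$ on $[0,\infty)$, its support radius is $\max\operatorname{supp}\varphi$. Convolution is $(g*h)(\mathbf{x})=\int_{\mathbb R^d}g(\mathbf{x}-\mathbf{y})h(\mathbf{y})\,d\mathbf{y}$. With $\lambda=\frac{d-1}{2}$, $C_\ell^\lambda$ is the Gegenbauer polynomial of degree $\ell$ with parameter $\lambda$ (so $C_2^\lambda(x)=-\lambda+2\lambda(\lambda+1)x^2$), and the (unnormalized) degree-$\ell$ Gegenbauer coefficient of $\psi$ is $B_{\ell,d}(\psi)=\int_0^\pi\psi(r)\,C_\ell^\lambda(\cos r)(\sin r)^{d-1}\,dr$. *)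

theory Defs
  imports "HOL-Analysis.Analysis"
begin

text \<open>
  Functions of class $C^k$ on the whole space: $C^{k+1}$ means (Frechet) differentiable
  everywhere with all directional derivatives of class $C^k$.
\<close>

fun C_k :: "nat \<Rightarrow> ('a::euclidean_space \<Rightarrow> real) \<Rightarrow> bool" where
  "C_k 0 f \<longleftrightarrow> continuous_on UNIV f"
| "C_k (Suc k) f \<longleftrightarrow> (\<forall>x. f differentiable (at x)) \<and>
     (\<forall>v. C_k k (\<lambda>x. frechet_derivative f (at x) v))"

definition supp :: "('a::euclidean_space \<Rightarrow> real) \<Rightarrow> 'a set" where
  "supp f = closure (support_on UNIV f)"

definition C_c_infinity :: "('a::euclidean_space \<Rightarrow> real) \<Rightarrow> bool" where
  "C_c_infinity f \<longleftrightarrow> (\<forall>k. C_k k f) \<and> compact (supp f)"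

text \<open>
  A function on $[0,\infty)$ is represented by a total function on the reals whose values at
  negative arguments are ignored.  The support radius is the maximum of the support; as a relation
  it holds only if that maximum is attained, so in particular the function is nonzero.
\<close>

definition has_support_radius :: "(real \<Rightarrow> real) \<Rightarrow> real \<Rightarrow> bool" where
  "has_support_radius \<phi> R \<longleftrightarrow>
     R \<in> closure (support_on {0..} \<phi>) \<and> (\<forall>r \<in> closure (support_on {0..} \<phi>). r \<le> R)"

definition radial :: "('a::euclidean_space \<Rightarrow> real) \<Rightarrow> bool" where
  "radial f \<longleftrightarrow> (\<forall>x y. norm x = norm y \<longrightarrow> f x = f y)"

text \<open>
  The scalars are complex; the order on the complex numbers is that of
  \<^theory>\<open>HOL-Library.Complex_Order\<close>, so \<open>0 \<le> z\<close> says that \<open>z\<close> is real and nonnegative.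
  These notions are meant for symmetric kernels.
\<close>

definition kernel_form :: "('x \<Rightarrow> 'x \<Rightarrow> real) \<Rightarrow> nat \<Rightarrow> (nat \<Rightarrow> 'x) \<Rightarrow> (nat \<Rightarrow> complex) \<Rightarrow> complex" where
  "kernel_form K n x c = (\<Sum>j<n. \<Sum>k<n. c j * cnj (c k) * of_real (K (x j) (x k)))"

definition positive_definite_on :: "'x set \<Rightarrow> ('x \<Rightarrow> 'x \<Rightarrow> real) \<Rightarrow> bool" where
  "positive_definite_on X K \<longleftrightarrow>
     (\<forall>n\<ge>1. \<forall>x c. x ` {..<n} \<subseteq> X \<longrightarrow> 0 \<le> kernel_form K n x c)"

definition strictly_positive_definite_on :: "'x set \<Rightarrow> ('x \<Rightarrow> 'x \<Rightarrow> real) \<Rightarrow> bool" where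
  "strictly_positive_definite_on X K \<longleftrightarrow>
     (\<forall>n\<ge>1. \<forall>x c. x ` {..<n} \<subseteq> X \<longrightarrow> inj_on x {..<n} \<longrightarrow> (\<exists>j<n. c j \<noteq> 0) \<longrightarrow>
        0 < kernel_form K n x c)"

definition geodesic_dist :: "'a::euclidean_space \<Rightarrow> 'a \<Rightarrow> real" where
  "geodesic_dist x y = arccos (x \<bullet> y)"

definition convolution ::
  "('a::euclidean_space \<Rightarrow> real) \<Rightarrow> ('a \<Rightarrow> real) \<Rightarrow> 'a \<Rightarrow> real" where
  "convolution g h x = (LINT y|lborel. g (x - y) * h y)"

definition gegenbauer :: "nat \<Rightarrow> real \<Rightarrow> real \<Rightarrow> real" where
  "gegenbauer l a x = (\<Sum>k\<le>l div 2.
     (-1) ^ k * pochhammer a (l - k) / (fact k * fact (l - 2 * k)) * (2 * x) ^ (l - 2 * k))"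

lemma gegenbauer_2: "gegenbauer 2 a x = - a + 2 * a * (a + 1) * x\<^sup>2"
  by (simp add: gegenbauer_def numeral_2_eq_2 pochhammer_Suc power2_eq_square algebra_simps)

definition gegenbauer_coeff :: "nat \<Rightarrow> nat \<Rightarrow> (real \<Rightarrow> real) \<Rightarrow> real" where
  "gegenbauer_coeff l d \<psi> =
     (LBINT r:{0..pi}. \<psi> r * gegenbauer l ((real d - 1) / 2) (cos r) * sin r ^ (d - 1))"

end

theory Submission
  imports "HOL-Probability.Sinc_Integral" "HOL-Real_Asymp.Real_Asymp" Defs
begin

text \<open>
  Let \<open>d = 2 m\<close>, \<open>D = d + 1\<close>, and let \<open>C\<close> be the Gegenbauer polynomial of degree two.  For a radial \<open>q\<close>
  supported in the ball of radius \<open>R / 2\<close>, the profile \<open>\<phi>\<close> of the convolution square \<open>q * q\<close> always gives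
  a positive definite kernel on \<open>R^d\<close>: its quadratic form is the square integral of a combination of
  translates of \<open>q\<close>.  It is strictly positive definite because a translate to an extreme one of the
  given points sticks out of all the others.  Since \<open>R \<le> pi\<close>, integration in polar coordinates gives
  \<open>c B_2(\<phi>) = Q(q)\<close> with \<open>c > 0\<close>, where \<open>Q(q)\<close> is the integral of \<open>(q * q)(z) W(|z|)\<close> and
  \<open>W(r) = C(cos r) (sin r / r)^(d-1)\<close>.  So everything depends on finding a \<open>q\<close> with \<open>Q(q) < 0\<close> whose
  support is exactly the prescribed, possibly very small, ball.

  \<^emph>\<open>A wide Gaussian makes the form negative\<close> (\<open>gaussian_gegenbauer_negative\<close>).  For a Gaussian \<open>q\<close>, \<open>Q(q)\<close> is a
  positive multiple of the integral of \<open>C(cos r) sin^(d-1) r exp(-a r^2)\<close> over the half line, and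
  \<open>C(cos r) sin^(d-1) r\<close> is a positive multiple of the second derivative of \<open>sin^D r\<close>.  As \<open>d\<close> is even, \<open>D\<close>
  is odd, so \<open>sin^D\<close> has mean zero and a bounded second antiderivative \<open>U\<close>, with \<open>U'(0) < 0\<close>.  Four
  integrations by parts leave \<open>2 a U'(0) + O(a^(3/2))\<close>, which is negative for small \<open>a\<close>.

  \<^emph>\<open>From the Gaussian to small supports\<close> (\<open>negative_test_function\<close>).  \<open>W\<close> is an even entire function, so
  \<open>Q(q)\<close> depends only on the even moments of \<open>q\<close> along an axis, through a quadratic form that is continuous
  for a weighted \<open>l^1\<close> norm (\<open>convolution_expansion\<close>, \<open>moment_form_negative_open\<close>).  Every
  sequence of finite norm is a limit of moment sequences of smooth radial functions with arbitrarily small support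
  (\<open>approximable_wsummable\<close>): the dilate of a bump to radius \<open>\<sigma>\<close> has moments proportional to
  \<open>a_i \<sigma>^(2 i)\<close> with \<open>a_i > 0\<close>, and letting \<open>\<sigma>\<close> tend to zero isolates one moment after the other.
  Approximating the moments of the Gaussian gives a test function \<open>q0\<close> in the ball of radius \<open>R / 4\<close>
  with \<open>Q(q0) < 0\<close>.  A small multiple \<open>\<delta>\<close> of a bump of radius \<open>R / 2\<close> is added; for all but countably
  many \<open>\<delta>\<close> the sum has the whole closed ball as its support.

  \<^emph>\<open>The sphere\<close> (\<open>not_positive_definite_on_sphere\<close>).  By the addition theorem, positive definiteness on the sphere
  forces all double sums of \<open>L(x_j . x_k)\<close> to be nonnegative, where \<open>L(t) = \<phi>(arccos t) C(t)\<close>.  But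
  \<open>B_2(\<phi>) < 0\<close> says that \<open>L(x . y)\<close> has negative mean over \<open>y\<close>.  So points can be chosen one after the
  other such that the \<open>n\<close>-th contributes at most \<open>- 2 \<beta> n\<close> outside the diagonal, which
  makes the double sum negative in the end.
\<close>

section \<open>Functions of class $C^k$ and a smooth bump\<close>

lemma C_k_add: "C_k k f \<Longrightarrow> C_k k g \<Longrightarrow> C_k k (\<lambda>x. f x + g x)"
proof (induction k arbitrary: f g)
  case 0
  then show ?case by (auto intro!: continuous_on_add continuous_on_mult continuous_on_const)
next
  case (Suc k)
  then have D: "((\<lambda>x. f x + g x) has_derivative
      (\<lambda>v. frechet_derivative f (at x) v + frechet_derivative g (at x) v)) (at x)" for x
    using frechet_derivative_works[of f "at x"] frechet_derivative_works[of g "at x"]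
    by (auto intro!: has_derivative_add)
  then have "\<And>x v. frechet_derivative (\<lambda>x. f x + g x) (at x) v
      = frechet_derivative f (at x) v + frechet_derivative g (at x) v"
    by (simp add: frechet_derivative_at[OF D, symmetric])
  with D Suc show ?case by (auto simp: differentiable_def)
qed

lemma C_k_cmult: "C_k k f \<Longrightarrow> C_k k (\<lambda>x. c * f x)"
proof (induction k arbitrary: f)
  case 0
  then show ?case by (auto intro!: continuous_on_add continuous_on_mult continuous_on_const)
next
  case (Suc k)
  have D: "((\<lambda>x. c * f x) has_derivative (\<lambda>v. c * frechet_derivative f (at x) v)) (at x)" for x
    using Suc.prems frechet_derivative_works[of f "at x"] by (auto intro!: has_derivative_mult_right)
  then have "\<And>x v. frechet_derivative (\<lambda>x. c * f x) (at x) v = c * frechet_derivative f (at x) v"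
    by (simp add: frechet_derivative_at[OF D, symmetric])
  with D Suc show ?case by (auto simp: differentiable_def)
qed

lemma C_k_continuous: "C_k k f \<Longrightarrow> continuous_on UNIV f"
  by (cases k) (auto intro!: continuous_at_imp_continuous_on differentiable_imp_continuous_within)

text \<open>
  The derivatives of \<open>exp (- 1 / t)\<close>, extended by zero, are combinations of these functions.
\<close>

definition flat :: "nat \<Rightarrow> real \<Rightarrow> real" where
  "flat n t = (if t \<le> 0 then 0 else inverse t ^ n * exp (- inverse t))"

lemma flat_pos_iff [simp]: "0 < flat n t \<longleftrightarrow> 0 < t"
  by (auto simp: flat_def)

lemma flat_eq_0 [simp]: "t \<le> 0 \<Longrightarrow> flat n t = 0"
  by (simp add: flat_def)

lemma flat_nonneg [simp]: "0 \<le> flat n t"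
  by (auto simp: flat_def)

text \<open>
  The exponential beats every power of \<open>1 / t\<close>; this is what makes the extension by zero smooth.
\<close>

lemma flat_tendsto_0: "((\<lambda>t. flat n t) \<longlongrightarrow> 0) (at 0)"
proof -
  have "((\<lambda>t::real. inverse t ^ n / exp (inverse t)) \<longlongrightarrow> 0) (at_right 0)"
    by (rule filterlim_compose[OF tendsto_power_div_exp_0 filterlim_inverse_at_top_right])
  then have "(flat n \<longlongrightarrow> 0) (at_right 0)"
    by (rule Lim_transform_eventually)
      (auto simp: eventually_at_filter flat_def exp_minus divide_inverse)
  moreover have "(flat n \<longlongrightarrow> 0) (at_left 0)"
    by (rule tendsto_eventually) (auto simp: eventually_at_filter)
  ultimately show ?thesis by (simp add: filterlim_at_split)
qed

lemma flat_has_derivative: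
  "(flat n has_real_derivative (flat (n + 2) t - n * flat (n + 1) t)) (at t)"
proof -
  consider "t < 0" | "t = 0" | "t > 0" by linarith
  then show ?thesis
  proof cases
    case 1
    have "((\<lambda>_. 0) has_real_derivative 0) (at t)" by simp
    then have "(flat n has_real_derivative 0) (at t)"
      by (rule has_field_derivative_transform_within_open[where S="{..<0}"]) (use 1 in auto)
    with 1 show ?thesis by simp
  next
    case 2
    have "((\<lambda>h. flat n h / h) \<longlongrightarrow> 0) (at 0)"
    proof (rule Lim_transform_eventually[OF flat_tendsto_0[of "n + 1"]])
      show "\<forall>\<^sub>F t in at 0. flat (n + 1) t = flat n t / t"
        by (auto simp: eventually_at_filter flat_def field_simps)
    qed
    with 2 show ?thesis by (simp add: DERIV_def)
  next
    case 3
    have "((\<lambda>t. inverse t ^ n) has_real_derivative - (real n * inverse t ^ (n + 1))) (at t)"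
      using DERIV_power[OF DERIV_inverse, of t n UNIV] 3
      by (cases n) (simp_all add: numeral_2_eq_2 algebra_simps)
    moreover have "((\<lambda>t. exp (- inverse t)) has_real_derivative
        exp (- inverse t) * (inverse t * inverse t)) (at t)"
      using 3 by (auto intro!: derivative_eq_intros simp: numeral_2_eq_2)
    ultimately have "((\<lambda>t. inverse t ^ n * exp (- inverse t)) has_real_derivative
        - (real n * inverse t ^ (n + 1)) * exp (- inverse t)
        + exp (- inverse t) * (inverse t * inverse t) * inverse t ^ n) (at t)"
      by (rule DERIV_mult)
    also have "- (real n * inverse t ^ (n + 1)) * exp (- inverse t)
        + exp (- inverse t) * (inverse t * inverse t) * inverse t ^ n
        = flat (n + 2) t - n * flat (n + 1) t"
      using 3 by (simp add: flat_def mult_ac)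
    finally have "((\<lambda>t. inverse t ^ n * exp (- inverse t)) has_real_derivative
        (flat (n + 2) t - n * flat (n + 1) t)) (at t)" .
    then show ?thesis
      by (rule has_field_derivative_transform_within_open[where S="{0<..}"])
        (use 3 in \<open>auto simp: flat_def\<close>)
  qed
qed

text \<open>
  An algebra of functions that contains the bumps and is closed under directional derivatives, so that
  smoothness follows by induction on the order without computing a higher derivative.
\<close>

inductive bump_algebra :: "('a::euclidean_space \<Rightarrow> real) \<Rightarrow> bool" where
  const: "bump_algebra (\<lambda>x. c)"
| coord: "bump_algebra (\<lambda>x. x \<bullet> v)"
| flat: "bump_algebra (\<lambda>x. flat n (1 - \<kappa> * (x \<bullet> x)))"
| add: "bump_algebra f \<Longrightarrow> bump_algebra g \<Longrightarrow> bump_algebra (\<lambda>x. f x + g x)"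
| mult: "bump_algebra f \<Longrightarrow> bump_algebra g \<Longrightarrow> bump_algebra (\<lambda>x. f x * g x)"

lemma bump_algebra_derivative:
  "bump_algebra f \<Longrightarrow>
    \<exists>f'. (\<forall>x. (f has_derivative f' x) (at x)) \<and> (\<forall>v. bump_algebra (\<lambda>x. f' x v))"
proof (induction rule: bump_algebra.induct)
  case (const c)
  show ?case
    by (rule exI[of _ "\<lambda>x v. 0"]) (auto intro: bump_algebra.const)
next
  case (coord w)
  show ?case
    by (rule exI[of _ "\<lambda>x v. v \<bullet> w"])
      (auto intro: bump_algebra.const derivative_eq_intros)
next
  case (flat n \<kappa>)
  let ?D = "\<lambda>n x. flat n (1 - \<kappa> * (x \<bullet> x))"
  show ?case
  proof (rule exI[of _ "\<lambda>x v. (?D (n + 2) x + (- real n) * ?D (n + 1) x) * ((-2 * \<kappa>) * (x \<bullet> v))"],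
      intro conjI allI)
    fix x :: 'a
    have "((\<lambda>x. 1 - \<kappa> * (x \<bullet> x)) has_derivative (\<lambda>v. (-2 * \<kappa>) * (x \<bullet> v))) (at x)"
      by (auto intro!: derivative_eq_intros simp: inner_commute)
    from has_derivative_compose[OF this flat_has_derivative[unfolded has_field_derivative_def]]
    show "(?D n has_derivative (\<lambda>v. (?D (n + 2) x + (- real n) * ?D (n + 1) x) * ((-2 * \<kappa>) * (x \<bullet> v)))) (at x)"
      by (simp add: o_def algebra_simps)
  next
    fix v :: 'a
    show "bump_algebra (\<lambda>x. (?D (n + 2) x + (- real n) * ?D (n + 1) x) * ((-2 * \<kappa>) * (x \<bullet> v)))"
      by (intro bump_algebra.mult bump_algebra.add bump_algebra.const bump_algebra.coord
          bump_algebra.flat)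
  qed
next
  case (add f g)
  then obtain f' g' where *: "\<forall>x. (f has_derivative f' x) (at x)" "\<forall>v. bump_algebra (\<lambda>x. f' x v)"
    "\<forall>x. (g has_derivative g' x) (at x)" "\<forall>v. bump_algebra (\<lambda>x. g' x v)" by blast
  then show ?case
    by (intro exI[of _ "\<lambda>x v. f' x v + g' x v"])
      (auto intro: bump_algebra.add has_derivative_add)
next
  case (mult f g)
  then obtain f' g' where *: "\<forall>x. (f has_derivative f' x) (at x)" "\<forall>v. bump_algebra (\<lambda>x. f' x v)"
    "\<forall>x. (g has_derivative g' x) (at x)" "\<forall>v. bump_algebra (\<lambda>x. g' x v)" by blast
  show ?case
  proof (rule exI[of _ "\<lambda>x v. f x * g' x v + f' x v * g x"], intro conjI allI)
    show "((\<lambda>x. f x * g x) has_derivative (\<lambda>v. f x * g' x v + f' x v * g x)) (at x)" for x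
      using * by (auto intro: has_derivative_mult)
    show "bump_algebra (\<lambda>x. f x * g' x v + f' x v * g x)" for v
      using * mult.hyps
      by (intro bump_algebra.add bump_algebra.mult[of f] bump_algebra.mult[of _ g]) auto
  qed
qed

lemma bump_algebra_C_k: "bump_algebra f \<Longrightarrow> C_k k f"
proof (induction k arbitrary: f)
  case 0
  from bump_algebra_derivative[OF 0] show ?case
    by (auto intro!: continuous_at_imp_continuous_on dest: has_derivative_continuous)
next
  case (Suc k)
  obtain f' where f': "\<And>x. (f has_derivative f' x) (at x)" "\<And>v. bump_algebra (\<lambda>x. f' x v)"
    using bump_algebra_derivative[OF Suc.prems] by blast
  have "frechet_derivative f (at x) = f' x" for x
    using f'(1) by (metis frechet_derivative_at)
  with f' Suc.IH show ?case by (auto simp: differentiable_def)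
qed

text \<open>
  All radii are dilates of one profile, which makes the moments in the radius explicit.
\<close>

definition bump :: "real \<Rightarrow> 'a::euclidean_space \<Rightarrow> real" where
  "bump s x = flat 0 (1 - (norm x / s)\<^sup>2)"

lemma C_k_bump: "C_k k (bump s)"
proof -
  have "bump s = (\<lambda>x::'a. flat 0 (1 - (1 / s\<^sup>2) * (x \<bullet> x)))"
    by (auto simp: bump_def fun_eq_iff power_divide power2_norm_eq_inner)
  then show ?thesis by (simp only: bump_algebra_C_k[OF bump_algebra.flat])
qed

lemma bump_pos_iff: "0 < s \<Longrightarrow> 0 < bump s x \<longleftrightarrow> norm x < s"
  by (simp add: bump_def abs_square_less_1)

lemma bump_nonneg [simp]: "0 \<le> bump s x"
  by (simp add: bump_def)

lemma bump_eq_0: "0 < s \<Longrightarrow> s \<le> norm x \<Longrightarrow> bump s x = 0"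
  using bump_pos_iff[of s x] bump_nonneg[of s x] by linarith

lemma radial_bump: "radial (bump s)"
  by (auto simp: radial_def bump_def)

section \<open>Smoothness of convolutions\<close>

lemma convolution_eq_integral:
  fixes f g :: "'a::euclidean_space \<Rightarrow> real"
  assumes f: "continuous_on UNIV f" and g: "continuous_on UNIV g"
    and supp: "\<And>y. y \<notin> cbox a b \<Longrightarrow> g y = 0"
  shows "integrable lborel (\<lambda>y. f (x - y) * g y)"
    and "convolution f g x = integral (cbox a b) (\<lambda>y. f (x - y) * g y)"
proof -
  have c: "continuous_on (cbox a b) (\<lambda>y. f (x - y) * g y)"
    by (intro continuous_intros continuous_on_compose2[OF f] continuous_on_subset[OF g]) auto
  have si: "set_integrable lborel (cbox a b) (\<lambda>y. f (x - y) * g y)"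
    unfolding set_integrable_def by (intro borel_integrable_compact c compact_cbox)
  have eq: "(\<lambda>y. indicat_real (cbox a b) y *\<^sub>R (f (x - y) * g y)) = (\<lambda>y. f (x - y) * g y)"
    using supp by (auto simp: fun_eq_iff indicator_def)
  show "integrable lborel (\<lambda>y. f (x - y) * g y)"
    using si unfolding set_integrable_def eq .
  have "(LBINT y:cbox a b. f (x - y) * g y) = integral (cbox a b) (\<lambda>y. f (x - y) * g y)"
    by (rule set_borel_integral_eq_integral(2)[OF si])
  then show "convolution f g x = integral (cbox a b) (\<lambda>y. f (x - y) * g y)"
    unfolding set_lebesgue_integral_def eq convolution_def .
qed

text \<open>
  The convolution is an integral over the fixed box that contains the support of \<open>g\<close>, so it may be
  differentiated under the integral sign.  The derivative is assembled from its directional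
  derivatives because that is what \<^term>\<open>C_k\<close> provides.
\<close>

lemma convolution_has_derivative:
  fixes f g :: "'a::euclidean_space \<Rightarrow> real"
  assumes df: "\<And>x. f differentiable (at x)"
    and cf: "\<And>v. continuous_on UNIV (\<lambda>x. frechet_derivative f (at x) v)"
    and g: "continuous_on UNIV g"
    and supp: "\<And>y. y \<notin> cbox a b \<Longrightarrow> g y = 0"
  shows "(convolution f g has_derivative
     (\<lambda>v. convolution (\<lambda>x. frechet_derivative f (at x) v) g x)) (at x)"
proof -
  define F where "F x = Blinfun (frechet_derivative f (at x))" for x
  have F: "blinfun_apply (F x) = frechet_derivative f (at x)" for x
    unfolding F_def using df[of x]
    by (simp add: bounded_linear_Blinfun_apply frechet_derivative_works has_derivative_bounded_linear)
  have cF: "continuous_on UNIV F"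
    by (rule continuous_on_blinfun_componentwise) (simp add: F cf)
  have f: "continuous_on UNIV f"
    using df by (auto intro!: continuous_at_imp_continuous_on differentiable_imp_continuous_within)
  define fx where "fx x y = g y *\<^sub>R F (x - y)" for x y
  have "((\<lambda>x. integral (cbox a b) (\<lambda>y. f (x - y) * g y)) has_derivative
      blinfun_apply (integral (cbox a b) (fx x))) (at x)"
  proof (rule leibniz_rule[where U=UNIV])
    fix x y :: 'a
    have "(f has_derivative frechet_derivative f (at (x - y))) (at (x - y))"
      using df by (simp flip: frechet_derivative_works)
    moreover have "((\<lambda>x. x - y) has_derivative (\<lambda>v. v)) (at x)"
      by (auto intro!: derivative_eq_intros)
    ultimately have "((\<lambda>x. f (x - y)) has_derivative (\<lambda>v. frechet_derivative f (at (x - y)) v)) (at x)"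
      using has_derivative_compose by blast
    then show "((\<lambda>x. f (x - y) * g y) has_derivative blinfun_apply (fx x y)) (at x)"
      unfolding fx_def by (auto intro!: derivative_eq_intros simp: F blinfun.scaleR_left)
  next
    fix x :: 'a
    have "continuous_on (cbox a b) (\<lambda>y. f (x - y) * g y)"
      by (intro continuous_intros continuous_on_compose2[OF f] continuous_on_subset[OF g]) auto
    then show "(\<lambda>y. f (x - y) * g y) integrable_on cbox a b"
      by (rule integrable_continuous)
  next
    show "continuous_on (UNIV \<times> cbox a b) (\<lambda>(x, t). fx x t)"
      unfolding fx_def split_def
      by (intro continuous_intros continuous_on_compose2[OF g] continuous_on_compose2[OF cF]) auto
  qed auto
  moreover have "convolution f g = (\<lambda>x. integral (cbox a b) (\<lambda>y. f (x - y) * g y))"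
    using convolution_eq_integral(2)[OF f g supp] by auto
  moreover have "blinfun_apply (integral (cbox a b) (fx x)) v
      = convolution (\<lambda>x. frechet_derivative f (at x) v) g x" for v
  proof -
    have "continuous_on (cbox a b) (fx x)"
      unfolding fx_def
      by (intro continuous_intros continuous_on_subset[OF g] continuous_on_compose2[OF cF]) auto
    then have "fx x integrable_on cbox a b" by (rule integrable_continuous)
    then have "blinfun_apply (integral (cbox a b) (fx x)) v
        = integral (cbox a b) (\<lambda>y. blinfun_apply (fx x y) v)"
      by (rule blinfun_apply_integral)
    also have "\<dots> = integral (cbox a b) (\<lambda>y. frechet_derivative f (at (x - y)) v * g y)"
      by (simp add: fx_def F blinfun.scaleR_left mult.commute)
    also have "\<dots> = convolution (\<lambda>x. frechet_derivative f (at x) v) g x"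
      using convolution_eq_integral(2)[OF cf g supp] by simp
    finally show ?thesis .
  qed
  ultimately show ?thesis by (metis (no_types, lifting) ext)
qed

lemma continuous_convolution:
  fixes f g :: "'a::euclidean_space \<Rightarrow> real"
  assumes f: "continuous_on UNIV f" and g: "continuous_on UNIV g"
    and supp: "\<And>y. y \<notin> cbox a b \<Longrightarrow> g y = 0"
  shows "continuous_on UNIV (convolution f g)"
proof -
  have "continuous_on UNIV (\<lambda>x. integral (cbox a b) (\<lambda>y. f (x - y) * g y))"
    by (rule integral_continuous_on_param)
      (auto simp: split_def intro!: continuous_intros continuous_on_compose2[OF f]
        continuous_on_compose2[OF g])
  moreover have "convolution f g = (\<lambda>x. integral (cbox a b) (\<lambda>y. f (x - y) * g y))"
    using convolution_eq_integral(2)[OF f g supp] by auto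
  ultimately show ?thesis by simp
qed

lemma C_k_convolution:
  fixes f g :: "'a::euclidean_space \<Rightarrow> real"
  assumes "C_k k f" and g: "continuous_on UNIV g"
    and supp: "\<And>y. y \<notin> cbox a b \<Longrightarrow> g y = 0"
  shows "C_k k (convolution f g)"
  using assms(1)
proof (induction k arbitrary: f)
  case 0
  then show ?case using continuous_convolution[OF _ g supp] by simp
next
  case (Suc k)
  have D: "(convolution f g has_derivative
     (\<lambda>v. convolution (\<lambda>x. frechet_derivative f (at x) v) g x)) (at x)" for x
    by (rule convolution_has_derivative[OF _ _ g supp])
      (use Suc.prems in \<open>auto intro: C_k_continuous\<close>)
  then have "frechet_derivative (convolution f g) (at x)
      = (\<lambda>v. convolution (\<lambda>x. frechet_derivative f (at x) v) g x)" for x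
    by (metis frechet_derivative_at)
  with D Suc show ?case by (auto simp: differentiable_def)
qed

section \<open>Isometry invariance of Lebesgue measure\<close>

lemma nn_integral_lborel_translation:
  fixes f :: "'a::euclidean_space \<Rightarrow> ennreal"
  assumes [measurable]: "f \<in> borel_measurable borel"
  shows "(\<integral>\<^sup>+x. f (x + c) \<partial>lborel) = (\<integral>\<^sup>+x. f x \<partial>lborel)"
proof -
  have "(\<integral>\<^sup>+x. f x \<partial>lborel) = (\<integral>\<^sup>+x. f x \<partial>distr lborel borel ((+) c))"
    by (simp add: lborel_distr_plus)
  also have "\<dots> = (\<integral>\<^sup>+x. f (x + c) \<partial>lborel)"
    by (subst nn_integral_distr) (auto simp: add.commute)
  finally show ?thesis ..
qed

lemma nn_integral_lborel_uminus:
  fixes f :: "'a::euclidean_space \<Rightarrow> ennreal"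
  assumes [measurable]: "f \<in> borel_measurable borel"
  shows "(\<integral>\<^sup>+x. f (- x) \<partial>lborel) = (\<integral>\<^sup>+x. f x \<partial>lborel)"
proof -
  have "(\<integral>\<^sup>+x. f x \<partial>lborel) = (\<integral>\<^sup>+x. f x \<partial>density (distr lborel borel (\<lambda>x. 0 + (-1) *\<^sub>R x)) (\<lambda>_. ennreal (\<bar>-1\<bar>^DIM('a))))"
    using lborel_affine[of "-1" "0::'a"] by simp
  also have "\<dots> = (\<integral>\<^sup>+x. f (- x) \<partial>lborel)"
    by (simp add: nn_integral_density nn_integral_distr)
  finally show ?thesis ..
qed

lemma borel_measurable_linear_map:
  fixes T :: "'a::euclidean_space \<Rightarrow> 'b::euclidean_space"
  assumes "linear T"
  shows "T \<in> borel_measurable borel"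
  using assms
  by (intro borel_measurable_continuous_onI linear_continuous_on)
    (simp add: linear_conv_bounded_linear)

text \<open>
  The uniqueness argument for Haar measure: write the integral of \<open>g \<circ> T\<close> times the volume of the unit
  ball as a double integral, and use translation invariance in each variable to exchange the roles of
  the two integrands.  The unit ball has the same volume on both sides, so the constant is one.  Domain
  and range may be different types, which later identifies \<open>real \<times> 'a\<close> with another space of
  the same dimension.
\<close>

lemma nn_integral_lborel_isometry:
  fixes T :: "'a::euclidean_space \<Rightarrow> 'b::euclidean_space" and g :: "'b \<Rightarrow> ennreal"
  assumes T: "linear T" "\<And>x. norm (T x) = norm x" "surj T" "DIM('a) = DIM('b)"
    and g [measurable]: "g \<in> borel_measurable borel"
  shows "(\<integral>\<^sup>+x. g (T x) \<partial>lborel) = (\<integral>\<^sup>+x. g x \<partial>lborel)"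
proof -
  have [measurable]: "T \<in> borel_measurable borel"
    using T(1) by (rule borel_measurable_linear_map)
  define h :: "'b \<Rightarrow> ennreal" where "h = indicator (ball 0 1)"
  have [measurable]: "h \<in> borel_measurable borel"
    unfolding h_def by (intro borel_measurable_indicator borel_open open_ball)
  have hT: "h (T x) = indicator (ball 0 1) x" for x
    using T(2)[of x] by (auto simp: h_def indicator_def)
  define V where "V = (\<integral>\<^sup>+x. h x \<partial>lborel)"
  have V: "V = ennreal (unit_ball_vol (DIM('b)))"
    by (simp add: V_def h_def emeasure_ball)
  have VT: "(\<integral>\<^sup>+x. h (T x) \<partial>lborel) = V"
    by (simp add: V hT emeasure_ball T(4))
  have "(\<integral>\<^sup>+x. g (T x) \<partial>lborel) * V = (\<integral>\<^sup>+x. \<integral>\<^sup>+y. g (T x) * h y \<partial>lborel \<partial>lborel)"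
    by (simp add: V_def nn_integral_cmult nn_integral_multc)
  also have "\<dots> = (\<integral>\<^sup>+x. \<integral>\<^sup>+y. g (T x) * h (y + T x) \<partial>lborel \<partial>lborel)"
    by (simp add: nn_integral_cmult nn_integral_lborel_translation)
  also have "\<dots> = (\<integral>\<^sup>+y. \<integral>\<^sup>+x. g (T x) * h (y + T x) \<partial>lborel \<partial>lborel)"
    by (rule lborel_pair.Fubini') measurable
  also have "\<dots> = (\<integral>\<^sup>+y. \<integral>\<^sup>+x. g (T x - y) * h (T x) \<partial>lborel \<partial>lborel)"
  proof (rule nn_integral_cong)
    fix y :: 'b
    obtain z where z: "T z = y" using T(3) by (metis surjD)
    have "(\<integral>\<^sup>+x. g (T x) * h (y + T x) \<partial>lborel) =
       (\<integral>\<^sup>+x. g (T (x + (- z))) * h (y + T (x + (- z))) \<partial>lborel)"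
      by (rule nn_integral_lborel_translation[symmetric]) measurable
    also have "\<dots> = (\<integral>\<^sup>+x. g (T x - y) * h (T x) \<partial>lborel)"
      using T(1) z by (simp add: linear_diff)
    finally show "(\<integral>\<^sup>+x. g (T x) * h (y + T x) \<partial>lborel) = (\<integral>\<^sup>+x. g (T x - y) * h (T x) \<partial>lborel)" .
  qed
  also have "\<dots> = (\<integral>\<^sup>+x. \<integral>\<^sup>+y. g (T x - y) * h (T x) \<partial>lborel \<partial>lborel)"
    by (rule lborel_pair.Fubini') measurable
  also have "\<dots> = (\<integral>\<^sup>+x. (\<integral>\<^sup>+y. g y \<partial>lborel) * h (T x) \<partial>lborel)"
  proof (rule nn_integral_cong)
    fix x :: 'a
    have "(\<integral>\<^sup>+y. g (T x - y) \<partial>lborel) = (\<integral>\<^sup>+y. g (T x + y) \<partial>lborel)"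
      using nn_integral_lborel_uminus[of "\<lambda>y. g (T x - y)"] by simp
    also have "\<dots> = (\<integral>\<^sup>+y. g y \<partial>lborel)"
      using nn_integral_lborel_translation[of g "T x"] by (simp add: add.commute)
    finally show "(\<integral>\<^sup>+y. g (T x - y) * h (T x) \<partial>lborel) = (\<integral>\<^sup>+y. g y \<partial>lborel) * h (T x)"
      by (simp add: nn_integral_multc)
  qed
  also have "\<dots> = (\<integral>\<^sup>+y. g y \<partial>lborel) * V"
    by (simp add: nn_integral_cmult VT)
  finally have "(\<integral>\<^sup>+x. g (T x) \<partial>lborel) * V = (\<integral>\<^sup>+y. g y \<partial>lborel) * V" .
  moreover have "V \<noteq> 0"
    using unit_ball_vol_pos[of "real (DIM('b))"] unfolding V ennreal_eq_0_iff by linarith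
  moreover have "V \<noteq> top" by (simp add: V)
  ultimately show ?thesis by (simp add: mult.commute[of _ V] ennreal_mult_cancel_left)
qed

lemma distr_lborel_isometry:
  fixes T :: "'a::euclidean_space \<Rightarrow> 'b::euclidean_space"
  assumes T: "linear T" "\<And>x. norm (T x) = norm x" "surj T" "DIM('a) = DIM('b)"
  shows "distr lborel borel T = lborel"
proof (rule measure_eqI)
  fix A assume "A \<in> sets (distr lborel borel T)"
  then have [measurable]: "A \<in> sets borel" by simp
  have [measurable]: "T \<in> borel_measurable borel"
    using T(1) by (rule borel_measurable_linear_map)
  have "emeasure (distr lborel borel T) A = (\<integral>\<^sup>+x. indicator A x \<partial>distr lborel borel T)"
    by simp
  also have "\<dots> = (\<integral>\<^sup>+x. indicator A (T x) \<partial>lborel)"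
    by (rule nn_integral_distr) auto
  also have "\<dots> = (\<integral>\<^sup>+x. indicator A x \<partial>lborel)"
    by (rule nn_integral_lborel_isometry[OF T]) auto
  finally show "emeasure (distr lborel borel T) A = emeasure lborel A" by simp
qed simp

lemma integral_lborel_isometry:
  fixes T :: "'a::euclidean_space \<Rightarrow> 'b::euclidean_space" and g :: "'b \<Rightarrow> real"
  assumes T: "linear T" "\<And>x. norm (T x) = norm x" "surj T" "DIM('a) = DIM('b)"
    and g [measurable]: "g \<in> borel_measurable borel"
  shows "(LBINT x. g (T x)) = (LBINT x. g x)"
proof -
  have "(LBINT x. g x) = (LINT x|distr lborel borel T. g x)"
    by (simp add: distr_lborel_isometry[OF T])
  also have "\<dots> = (LBINT x. g (T x))"
    using borel_measurable_linear_map[OF T(1)] by (intro integral_distr) auto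
  finally show ?thesis ..
qed

text \<open>
  The reflection in the hyperplane orthogonal to \<open>a - b\<close> exchanges \<open>a\<close> and \<open>b\<close>.
\<close>

lemma rotation_obtain:
  fixes a b :: "'a::euclidean_space"
  assumes "norm a = norm b"
  obtains T where "linear T" "\<And>x. norm (T x) = norm x" "surj T" "T a = b"
    "\<And>x y. T x \<bullet> T y = x \<bullet> y"
proof (cases "a = b")
  case True
  then show ?thesis by (intro that[of "\<lambda>x. x"]) (auto simp: linear_iff)
next
  case False
  define v where "v = a - b"
  have v: "v \<bullet> v \<noteq> 0" using False by (simp add: v_def)
  have vv: "v \<bullet> v = 2 * (a \<bullet> v)"
    using assms by (simp add: v_def inner_diff_left inner_diff_right inner_commute norm_eq)
  define k where "k = 2 / (v \<bullet> v)"
  have k: "k * (v \<bullet> v) = 2" using v by (simp add: k_def)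
  define T where "T x = x - (k * (x \<bullet> v)) *\<^sub>R v" for x
  have lin: "linear T"
    by (rule linearI) (simp_all add: T_def inner_add_left distrib_left scaleR_add_left
        scaleR_diff_right mult.left_commute)
  have inner: "T x \<bullet> T y = x \<bullet> y" for x y
  proof -
    have "T x \<bullet> T y = x \<bullet> y - 2 * k * (x \<bullet> v) * (y \<bullet> v)
        + k * (x \<bullet> v) * (y \<bullet> v) * (k * (v \<bullet> v))"
      by (simp add: T_def inner_diff_left inner_diff_right inner_commute algebra_simps)
    then show ?thesis unfolding k by simp
  qed
  have n: "norm (T x) = norm x" for x
    by (simp add: norm_eq_sqrt_inner inner)
  have "k * (a \<bullet> v) = 1" using k vv by simp
  then have Ta: "T a = b" by (simp add: T_def v_def)
  have "T (T x) = x" for x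
  proof -
    have "T x \<bullet> v = (x \<bullet> v) - (x \<bullet> v) * (k * (v \<bullet> v))"
      by (simp add: T_def inner_diff_left)
    then have "T x \<bullet> v = - (x \<bullet> v)" unfolding k by simp
    then show ?thesis unfolding T_def[of "T x"] by (simp add: T_def)
  qed
  then have "surj T" by (rule surjI)
  from that[OF lin n this Ta inner] show ?thesis .
qed

lemma radial_convolution:
  fixes f g :: "'a::euclidean_space \<Rightarrow> real"
  assumes f: "radial f" "f \<in> borel_measurable borel" and g: "radial g" "g \<in> borel_measurable borel"
  shows "radial (convolution f g)"
  unfolding radial_def
proof (intro allI impI)
  fix x y :: 'a assume "norm x = norm y"
  then obtain T where T: "linear T" "\<And>x. norm (T x) = norm x" "surj T" "T x = y"
    by (rule rotation_obtain) auto
  note [measurable] = f(2) g(2)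
  have "convolution f g y = (LBINT z. f (y - T z) * g (T z))"
    unfolding convolution_def
    using integral_lborel_isometry[OF T(1-3), of "\<lambda>z. f (y - z) * g z"] by simp
  also have "\<dots> = (LBINT z. f (x - z) * g z)"
  proof (intro Bochner_Integration.integral_cong refl arg_cong2[where f="(*)"])
    fix z
    have "norm (y - T z) = norm (x - z)"
      using T(2)[of "x - z"] linear_diff[OF T(1), of x z] T(4) by simp
    then show "f (y - T z) = f (x - z)" using f(1) unfolding radial_def by blast
    show "g (T z) = g z" using g(1) T(2) unfolding radial_def by blast
  qed
  finally show "convolution f g x = convolution f g y"
    by (simp add: convolution_def)
qed

section \<open>Integration of radial functions\<close>

text \<open>
  The surface area of the unit sphere.
\<close>

definition radial_density :: "'a::euclidean_space itself \<Rightarrow> real" where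
  "radial_density _ = DIM('a) * unit_ball_vol (DIM('a))"

lemma radial_density_pos: "radial_density TYPE('a::euclidean_space) > 0"
  by (simp add: radial_density_def)

text \<open>
  Both measures agree on the half lines \<open>{..a}\<close>, by the formula for the volume of a ball.
\<close>

lemma distr_norm_lborel:
  "distr lborel borel (norm :: 'a::euclidean_space \<Rightarrow> real) = density lborel
     (\<lambda>s. ennreal (radial_density TYPE('a) * s ^ (DIM('a) - 1)) * indicator {0..} s)"
  (is "?M = ?N")
proof (rule measure_eqI_generator_eq[where E="range (\<lambda>a. {..a::real})" and \<Omega>=UNIV
      and A="\<lambda>i. {..real i}"])
  have M: "emeasure ?M {..r} = emeasure lborel (cball 0 r :: 'a set)" for r
    by (subst emeasure_distr) (auto intro!: arg_cong2[where f=emeasure])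
  have "emeasure ?M {..r} = emeasure ?N {..r}" for r
  proof (cases "r \<ge> 0")
    case True
    have "emeasure ?N {..r} = (\<integral>\<^sup>+s. ennreal (radial_density TYPE('a) * s ^ (DIM('a) - 1)) *
        indicator {0..r} s \<partial>lborel)"
      by (subst emeasure_density) (auto intro!: nn_integral_cong split: split_indicator)
    also have "\<dots> = unit_ball_vol (DIM('a)) * r ^ DIM('a) - unit_ball_vol (DIM('a)) * 0 ^ DIM('a)"
      using True by (intro nn_integral_FTC_Icc)
        (auto intro!: derivative_eq_intros mult_nonneg_nonneg simp: radial_density_def)
    finally show ?thesis using True unfolding M by (simp add: emeasure_cball)
  next
    case False
    have "emeasure ?N {..r} = (\<integral>\<^sup>+s. ennreal (radial_density TYPE('a) * s ^ (DIM('a) - 1)) *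
        indicator {0..} s * indicator {..r} s \<partial>lborel)"
      by (subst emeasure_density) auto
    also have "\<dots> = (\<integral>\<^sup>+s. 0 \<partial>(lborel::real measure))"
      by (rule nn_integral_cong) (use False in \<open>auto split: split_indicator\<close>)
    finally have "emeasure ?N {..r} = 0" by simp
    with False show ?thesis unfolding M by simp
  qed
  then show "emeasure ?M X = emeasure ?N X" if "X \<in> range (\<lambda>a. {..a::real})" for X
    using that by auto
  show "emeasure ?M {..real i} \<noteq> \<infinity>" for i
    unfolding M by (simp add: emeasure_cball)
  show "Int_stable (range (\<lambda>a. {..a::real}))"
    by (auto simp: Int_stable_def)
  show "sets ?M = sigma_sets UNIV (range (\<lambda>a. {..a::real}))"
    by (simp add: borel_eq_atMost)
  show "sets ?N = sigma_sets UNIV (range (\<lambda>a. {..a::real}))"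
    by (simp add: borel_eq_atMost)
  show "(\<Union>i. {..real i}) = (UNIV::real set)"
    by (auto simp: real_arch_simple)
qed auto

lemma nn_integral_radial:
  fixes F :: "real \<Rightarrow> ennreal"
  assumes [measurable]: "F \<in> borel_measurable borel"
  shows "(\<integral>\<^sup>+x. F (norm (x::'a::euclidean_space)) \<partial>lborel) =
    (\<integral>\<^sup>+s. ennreal (radial_density TYPE('a) * s ^ (DIM('a) - 1)) * indicator {0..} s * F s \<partial>lborel)"
proof -
  have "(\<integral>\<^sup>+x. F (norm (x::'a)) \<partial>lborel) = (\<integral>\<^sup>+s. F s \<partial>distr lborel borel (norm :: 'a \<Rightarrow> real))"
    by (simp add: nn_integral_distr)
  also have "\<dots> = (\<integral>\<^sup>+s. ennreal (radial_density TYPE('a) * s ^ (DIM('a) - 1)) * indicator {0..} s * F s \<partial>lborel)"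
    unfolding distr_norm_lborel by (simp add: nn_integral_density)
  finally show ?thesis .
qed

lemma integrable_radial_iff:
  fixes F :: "real \<Rightarrow> real"
  assumes [measurable]: "F \<in> borel_measurable borel"
  shows "integrable lborel (\<lambda>x::'a::euclidean_space. F (norm x)) \<longleftrightarrow>
    set_integrable lborel {0..} (\<lambda>s. F s * s ^ (DIM('a) - 1))"
    and "(LBINT x. F (norm (x::'a))) =
      radial_density TYPE('a) * (LBINT s:{0..}. F s * s ^ (DIM('a) - 1))"
proof -
  let ?w = "\<lambda>s. indicator {0..} s * (radial_density TYPE('a) * s ^ (DIM('a) - 1)) :: real"
  have w: "(\<lambda>s. ennreal (radial_density TYPE('a) * s ^ (DIM('a) - 1)) * indicator {0..} s) = (\<lambda>s. ennreal (?w s))"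
    by (auto simp: fun_eq_iff split: split_indicator)
  have w0: "AE s in lborel. 0 \<le> ?w s"
    using radial_density_pos[where 'a='a]
    by (intro AE_I2) (auto split: split_indicator intro!: mult_nonneg_nonneg)
  have eq: "(\<lambda>s. ?w s *\<^sub>R F s) = (\<lambda>s. radial_density TYPE('a) * (indicator {0..} s *\<^sub>R (F s * s ^ (DIM('a) - 1))))"
    by (auto simp: fun_eq_iff)
  have "integrable lborel (\<lambda>x::'a. F (norm x)) \<longleftrightarrow> integrable (distr lborel borel (norm::'a\<Rightarrow>real)) F"
    by (simp add: integrable_distr_eq)
  also have "\<dots> \<longleftrightarrow> integrable lborel (\<lambda>s. ?w s *\<^sub>R F s)"
    unfolding distr_norm_lborel w by (rule integrable_density) (use w0 in auto)
  also have "\<dots> \<longleftrightarrow> set_integrable lborel {0..} (\<lambda>s. F s * s ^ (DIM('a) - 1))"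
    unfolding eq set_integrable_def using radial_density_pos[where 'a='a]
    by (subst integrable_mult_left_iff) auto
  finally show "integrable lborel (\<lambda>x::'a::euclidean_space. F (norm x)) \<longleftrightarrow>
    set_integrable lborel {0..} (\<lambda>s. F s * s ^ (DIM('a) - 1))" .
  have "(LBINT x. F (norm (x::'a))) = (LINT s|distr lborel borel (norm::'a\<Rightarrow>real). F s)"
    by (simp add: integral_distr)
  also have "\<dots> = (LBINT s. ?w s *\<^sub>R F s)"
    unfolding distr_norm_lborel w by (rule integral_density) (use w0 in auto)
  also have "\<dots> = radial_density TYPE('a) * (LBINT s:{0..}. F s * s ^ (DIM('a) - 1))"
    unfolding eq set_lebesgue_integral_def by simp
  finally show "(LBINT x. F (norm (x::'a))) =
      radial_density TYPE('a) * (LBINT s:{0..}. F s * s ^ (DIM('a) - 1))" .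
qed

section \<open>Integration of zonal functions over the unit ball\<close>

text \<open>
  Any isometry, followed by a rotation that takes the image of the first axis to \<open>e\<close>.
\<close>

lemma axis_isometry_obtain:
  fixes e :: "'b::euclidean_space"
  assumes e: "norm e = 1" and D: "DIM('b) = DIM('a::euclidean_space) + 1"
  obtains T :: "real \<times> 'a::euclidean_space \<Rightarrow> 'b" where "linear T" "\<And>x. norm (T x) = norm x" "surj T"
    "\<And>x. T x \<bullet> e = fst x"
proof -
  have "DIM(real \<times> 'a) = DIM('b)" by (simp add: D)
  from isomorphisms_UNIV_UNIV[OF this]
  obtain f :: "real \<times> 'a \<Rightarrow> 'b" and g where f: "linear f" "\<And>x. norm (f x) = norm x" "\<And>x. f (g x) = x"
    by metis
  have "norm (f (1, 0)) = norm e" using f(2) e by (simp add: norm_Pair)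
  then obtain S where S: "linear S" "\<And>x. norm (S x) = norm x" "surj S" "S (f (1, 0)) = e"
    by (rule rotation_obtain) auto
  define T where "T = S \<circ> f"
  have T: "linear T" "\<And>x. norm (T x) = norm x"
    using f S by (auto simp: T_def intro: linear_compose)
  have "surj T" unfolding T_def
    using S(3) f(3) by (metis comp_surj surjI)
  moreover have "T x \<bullet> e = fst x" for x
  proof -
    have "T x \<bullet> T (1, 0) = x \<bullet> (1, 0)"
      using T(2)[of "x + (1, 0)"] T(2)[of x] T(2)[of "(1, 0)"] linear_add[OF T(1), of x "(1,0)"]
      by (simp only: dot_norm)
    then show ?thesis using S(4) by (cases x) (simp add: T_def)
  qed
  ultimately show ?thesis using that T by metis
qed

text \<open>
  In the coordinates \<open>(t, z)\<close> along and across the axis \<open>e\<close>, with \<open>s = norm z\<close>, the substitution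
  \<open>t = s \<tau>\<close> makes the zonal function depend on \<open>\<tau>\<close> only, and the integral over \<open>s\<close> can then be carried
  out.  With \<open>\<tau> = tan \<theta>\<close> this is integration in spherical coordinates.
\<close>

lemma nn_integral_ball_axis:
  fixes e :: "'b::euclidean_space" and g :: "real \<Rightarrow> ennreal"
  assumes e: "norm e = 1" and D: "DIM('b) = DIM('a::euclidean_space) + 1"
    and [measurable]: "g \<in> borel_measurable borel"
  shows "(\<integral>\<^sup>+x. g (x \<bullet> e / norm x) * indicator (cball 0 1) x \<partial>lborel) =
    (\<integral>\<^sup>+\<tau>. g (\<tau> / sqrt (1 + \<tau>\<^sup>2)) *
       ennreal (radial_density TYPE('a::euclidean_space) / DIM('b) * (1 / sqrt (1 + \<tau>\<^sup>2)) ^ DIM('b)) \<partial>lborel)"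
proof -
  let ?d = "DIM('a)"
  let ?c = "radial_density TYPE('a)"
  obtain T :: "real \<times> 'a \<Rightarrow> 'b" where T: "linear T" "\<And>x. norm (T x) = norm x" "surj T"
    "\<And>x. T x \<bullet> e = fst x"
    by (rule axis_isometry_obtain[OF e D]) auto
  have [measurable]: "(cball 0 1 :: 'b set) \<in> sets borel" by (intro borel_closed closed_cball)
  define G where "G t s = g (t / sqrt (t\<^sup>2 + s\<^sup>2)) * (if sqrt (t\<^sup>2 + s\<^sup>2) \<le> 1 then 1 else 0)" for t s :: real
  have [measurable]: "(\<lambda>x. G (fst x) (snd x)) \<in> borel_measurable (borel \<Otimes>\<^sub>M borel)"
    "(\<lambda>x. G (snd x) (fst x)) \<in> borel_measurable (borel \<Otimes>\<^sub>M borel)"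
    unfolding G_def by measurable
  have "(\<integral>\<^sup>+x. g (x \<bullet> e / norm x) * indicator (cball 0 1) x \<partial>lborel) =
      (\<integral>\<^sup>+x. g (T x \<bullet> e / norm (T x)) * indicator (cball 0 1) (T x) \<partial>lborel)"
    by (rule nn_integral_lborel_isometry[OF T(1-3), symmetric]) (auto simp: D)
  also have "\<dots> = (\<integral>\<^sup>+x. G (fst x) (norm (snd x :: 'a)) \<partial>(lborel \<Otimes>\<^sub>M lborel))"
    unfolding lborel_prod T(2,4) G_def
    by (intro nn_integral_cong) (auto simp: T(2) norm_prod_def indicator_def)
  also have "\<dots> = (\<integral>\<^sup>+z. \<integral>\<^sup>+t. G t (norm (z::'a)) \<partial>lborel \<partial>lborel)"
    by (subst lborel_pair.nn_integral_snd[symmetric]) (simp_all add: G_def split_def)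
  also have "\<dots> = (\<integral>\<^sup>+s. ennreal (?c * s ^ (?d - 1)) * indicator {0..} s * (\<integral>\<^sup>+t. G t s \<partial>lborel) \<partial>lborel)"
    by (rule nn_integral_radial[where F="\<lambda>s. \<integral>\<^sup>+t. G t s \<partial>lborel"]) measurable
  also have "\<dots> = (\<integral>\<^sup>+s. \<integral>\<^sup>+\<tau>. g (\<tau> / sqrt (1 + \<tau>\<^sup>2)) *
       (ennreal (?c * s ^ ?d) * indicator {0..1 / sqrt (1 + \<tau>\<^sup>2)} s) \<partial>lborel \<partial>lborel)"
  proof (rule nn_integral_cong_AE)
    have "AE s in lborel. s \<noteq> (0::real)" by (rule AE_lborel_singleton)
    then show "AE s in lborel. ennreal (?c * s ^ (?d - 1)) * indicator {0..} s * (\<integral>\<^sup>+t. G t s \<partial>lborel)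
      = (\<integral>\<^sup>+\<tau>. g (\<tau> / sqrt (1 + \<tau>\<^sup>2)) *
       (ennreal (?c * s ^ ?d) * indicator {0..1 / sqrt (1 + \<tau>\<^sup>2)} s) \<partial>lborel)"
    proof eventually_elim
      case (elim s)
      show ?case
      proof (cases "s > 0")
        case False
        with elim show ?thesis by (simp add: indicator_def)
      next
        case s: True
        have r: "sqrt ((0 + s * \<tau>)\<^sup>2 + s\<^sup>2) = s * sqrt (1 + \<tau>\<^sup>2)" for \<tau>
        proof -
          have "(0 + s * \<tau>)\<^sup>2 + s\<^sup>2 = s\<^sup>2 * (1 + \<tau>\<^sup>2)" by (simp add: algebra_simps power_mult_distrib)
          then show ?thesis using s by (simp add: real_sqrt_mult)
        qed
        have pos: "sqrt (1 + \<tau>\<^sup>2) > 0" for \<tau> by (simp add: add_pos_nonneg)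
        have G: "G (0 + s * \<tau>) s = g (\<tau> / sqrt (1 + \<tau>\<^sup>2)) * indicator {0..1 / sqrt (1 + \<tau>\<^sup>2)} s" for \<tau>
          unfolding G_def r using s pos[of \<tau>]
          by (auto simp: indicator_def field_simps)
        have "ennreal (?c * s ^ (?d - 1)) * ennreal s = ennreal (?c * s ^ ?d)"
        proof -
          have "s ^ ?d = s ^ (?d - 1) * s"
            using power_minus_mult[of ?d s] DIM_positive[where 'a='a] by simp
          then show ?thesis using s by (simp add: ennreal_mult'' mult.assoc[symmetric])
        qed
        moreover have "(\<integral>\<^sup>+t. G t s \<partial>lborel) = ennreal s * (\<integral>\<^sup>+\<tau>. G (0 + s * \<tau>) s \<partial>lborel)"
          using s nn_integral_real_affine[of "\<lambda>t. G t s" s 0] by (simp add: G_def)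
        ultimately have "ennreal (?c * s ^ (?d - 1)) * indicator {0..} s * (\<integral>\<^sup>+t. G t s \<partial>lborel)
          = ennreal (?c * s ^ ?d) * (\<integral>\<^sup>+\<tau>. G (0 + s * \<tau>) s \<partial>lborel)"
          using s by (simp add: mult.assoc[symmetric])
        also have "\<dots> = (\<integral>\<^sup>+\<tau>. ennreal (?c * s ^ ?d) * G (0 + s * \<tau>) s \<partial>lborel)"
          by (rule nn_integral_cmult[symmetric]) (simp add: G_def)
        finally show ?thesis unfolding G by (simp add: mult_ac)
      qed
    qed
  qed
  also have "\<dots> = (\<integral>\<^sup>+\<tau>. \<integral>\<^sup>+s. g (\<tau> / sqrt (1 + \<tau>\<^sup>2)) *
       (ennreal (?c * s ^ ?d) * indicator {0..1 / sqrt (1 + \<tau>\<^sup>2)} s) \<partial>lborel \<partial>lborel)"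
  proof (rule lborel_pair.Fubini')
    have "(\<lambda>x::real\<times>real. (indicator {0..1 / sqrt (1 + (fst x)\<^sup>2)} (snd x) :: ennreal)) \<in> borel_measurable (lborel \<Otimes>\<^sub>M lborel)"
      unfolding indicator_def atLeastAtMost_iff by measurable
    then show "(\<lambda>(\<tau>, s). g (\<tau> / sqrt (1 + \<tau>\<^sup>2)) *
       (ennreal (?c * s ^ ?d) * indicator {0..1 / sqrt (1 + \<tau>\<^sup>2)} s)) \<in> borel_measurable (lborel \<Otimes>\<^sub>M lborel)"
      by (auto simp: split_def)
  qed
  also have "\<dots> = (\<integral>\<^sup>+\<tau>. g (\<tau> / sqrt (1 + \<tau>\<^sup>2)) *
       ennreal (?c / DIM('b) * (1 / sqrt (1 + \<tau>\<^sup>2)) ^ DIM('b)) \<partial>lborel)"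
  proof (rule nn_integral_cong)
    fix \<tau> :: real
    have "(\<integral>\<^sup>+s. (ennreal (?c * s ^ ?d) * indicator {0..1 / sqrt (1 + \<tau>\<^sup>2)} s) \<partial>lborel)
       = ?c / DIM('b) * (1 / sqrt (1 + \<tau>\<^sup>2)) ^ DIM('b) - ?c / DIM('b) * 0 ^ DIM('b)"
    proof (rule nn_integral_FTC_Icc[where F="\<lambda>s. ?c / DIM('b) * s ^ DIM('b)"])
      fix s :: real
      show "((\<lambda>s. ?c / DIM('b) * s ^ DIM('b)) has_real_derivative ?c * s ^ ?d) (at s)"
        using DERIV_cmult[OF DERIV_pow[of "DIM('b)" s], of "?c / DIM('b)"] by (simp add: D)
    qed (use radial_density_pos[where 'a='a] in \<open>auto intro!: mult_nonneg_nonneg\<close>)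
    then show "(\<integral>\<^sup>+s. g (\<tau> / sqrt (1 + \<tau>\<^sup>2)) *
       (ennreal (?c * s ^ ?d) * indicator {0..1 / sqrt (1 + \<tau>\<^sup>2)} s) \<partial>lborel) =
       g (\<tau> / sqrt (1 + \<tau>\<^sup>2)) * ennreal (?c / DIM('b) * (1 / sqrt (1 + \<tau>\<^sup>2)) ^ DIM('b))"
      by (subst nn_integral_cmult) (auto simp: zero_power)
  qed
  finally show ?thesis .
qed

text \<open>
  The identity for nonnegative integrands is an equality of image measures, and so it extends to signed
  integrands.
\<close>

lemma integral_ball_axis:
  fixes e :: "'b::euclidean_space" and g :: "real \<Rightarrow> real"
  assumes e: "norm e = 1" and D: "DIM('b) = DIM('a::euclidean_space) + 1"
    and g [measurable]: "g \<in> borel_measurable borel"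
  shows "(LBINT x:cball 0 1. g (x \<bullet> e / norm x)) =
    radial_density TYPE('a::euclidean_space) / DIM('b) *
      (LBINT \<tau>. g (\<tau> / sqrt (1 + \<tau>\<^sup>2)) * (1 / sqrt (1 + \<tau>\<^sup>2)) ^ DIM('b))"
proof -
  let ?c = "radial_density TYPE('a) / DIM('b)"
  let ?w = "\<lambda>\<tau>. ?c * (1 / sqrt (1 + \<tau>\<^sup>2)) ^ DIM('b)"
  have w0: "?w \<tau> \<ge> 0" for \<tau>
    using radial_density_pos[where 'a='a] by (auto intro!: mult_nonneg_nonneg)
  let ?M = "distr (density lborel (indicator (cball 0 1))) borel (\<lambda>x::'b. x \<bullet> e / norm x)"
  let ?N = "distr (density lborel (\<lambda>\<tau>. ennreal (?w \<tau>))) borel (\<lambda>\<tau>. \<tau> / sqrt (1 + \<tau>\<^sup>2))"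
  have ind [measurable]: "(indicator (cball 0 1) :: 'b \<Rightarrow> ennreal) \<in> borel_measurable borel"
    "(indicator (cball 0 1) :: 'b \<Rightarrow> real) \<in> borel_measurable borel"
    by (intro borel_measurable_indicator borel_closed closed_cball)+
  have "?M = ?N"
  proof (rule measure_eqI)
    fix A assume "A \<in> sets ?M"
    then have [measurable]: "A \<in> sets borel" by simp
    have "emeasure ?M A = (\<integral>\<^sup>+x. indicator A x \<partial>?M)" by simp
    also have "\<dots> = (\<integral>\<^sup>+x. indicator A (x \<bullet> e / norm x) * indicator (cball 0 1) x \<partial>lborel)"
      by (subst nn_integral_distr) (auto simp: nn_integral_density mult.commute)
    also have "\<dots> = (\<integral>\<^sup>+\<tau>. indicator A (\<tau> / sqrt (1 + \<tau>\<^sup>2)) * ennreal (?w \<tau>) \<partial>lborel)"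
      by (rule nn_integral_ball_axis[OF e D]) auto
    also have "\<dots> = (\<integral>\<^sup>+x. indicator A x \<partial>?N)"
      by (subst nn_integral_distr) (auto simp: nn_integral_density mult.commute)
    finally show "emeasure ?M A = emeasure ?N A" by simp
  qed simp
  have "(LBINT x:cball 0 1. g (x \<bullet> e / norm x)) =
     (LINT x|density lborel (\<lambda>x::'b. ennreal (indicator (cball 0 1) x)). g (x \<bullet> e / norm x))"
    unfolding set_lebesgue_integral_def by (subst integral_density) auto
  also have "\<dots> = (LINT x|?M. g x)"
    by (subst integral_distr) (auto simp: ennreal_indicator)
  also have "\<dots> = (LINT x|?N. g x)" unfolding \<open>?M = ?N\<close> ..
  also have "\<dots> = (LINT \<tau>|density lborel (\<lambda>\<tau>. ennreal (?w \<tau>)). g (\<tau> / sqrt (1 + \<tau>\<^sup>2)))"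
    by (rule integral_distr) auto
  also have "\<dots> = (LBINT \<tau>. ?w \<tau> *\<^sub>R g (\<tau> / sqrt (1 + \<tau>\<^sup>2)))"
    by (rule integral_density) (use w0 in auto)
  also have "\<dots> = ?c * (LBINT \<tau>. g (\<tau> / sqrt (1 + \<tau>\<^sup>2)) * (1 / sqrt (1 + \<tau>\<^sup>2)) ^ DIM('b))"
    by (subst integral_mult_right_zero[symmetric]) (simp add: mult_ac)
  finally show ?thesis .
qed

lemma integral_tan_substitution:
  fixes g :: "real \<Rightarrow> real"
  assumes g: "continuous_on UNIV g" and B: "\<And>t. \<bar>g t\<bar> \<le> B" and D: "2 \<le> D"
  shows "(LBINT \<tau>. g (\<tau> / sqrt (1 + \<tau>\<^sup>2)) * (1 / sqrt (1 + \<tau>\<^sup>2)) ^ D) =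
    (LBINT r:{0..pi}. g (cos r) * sin r ^ (D - 2))"
proof -
  define f where "f \<tau> = g (\<tau> / sqrt (1 + \<tau>\<^sup>2)) * (1 / sqrt (1 + \<tau>\<^sup>2)) ^ D" for \<tau>
  define h where "h \<theta> = g (sin \<theta>) * cos \<theta> ^ (D - 2)" for \<theta>
  have pos: "sqrt (1 + \<tau>\<^sup>2) > 0" for \<tau> :: real by (simp add: add_pos_nonneg)
  have cg: "isCont g t" for t using g by (simp add: continuous_on_eq_continuous_at)
  have cf: "isCont f \<tau>" for \<tau>
    unfolding f_def using pos[of \<tau>]
    by (intro continuous_intros isCont_o2[OF _ cg]) auto
  have ch: "continuous_on S h" for S
    unfolding h_def by (intro continuous_intros continuous_on_compose2[OF g]) auto
  have [measurable]: "f \<in> borel_measurable borel"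
    by (intro borel_measurable_continuous_onI continuous_at_imp_continuous_on) (use cf in auto)
  have fi: "set_integrable lborel (einterval (-\<infinity>) \<infinity>) f"
  proof (rule set_integrable_bound[where f="\<lambda>\<tau>. B * inverse (1 + \<tau>\<^sup>2)"])
    show "set_integrable lborel (einterval (-\<infinity>) \<infinity>) (\<lambda>\<tau>. B * inverse (1 + \<tau>\<^sup>2))"
      using integrable_inverse_1_plus_square by (intro set_integrable_mult_right) auto
    show "set_borel_measurable lborel (einterval (- \<infinity>) \<infinity>) f"
      by (simp add: set_borel_measurable_def einterval_def)
    show "AE x in lborel. x \<in> einterval (- \<infinity>) \<infinity> \<longrightarrow> norm (f x) \<le> norm (B * inverse (1 + x\<^sup>2))"
    proof (intro AE_I2 impI)
      fix x :: real
      have "(1 / sqrt (1 + x\<^sup>2)) ^ D \<le> (1 / sqrt (1 + x\<^sup>2)) ^ 2"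
        using D pos[of x] by (intro power_decreasing) (auto simp: divide_le_eq)
      also have "\<dots> = inverse (1 + x\<^sup>2)"
        by (simp add: power_divide field_simps)
      finally have "\<bar>g (x / sqrt (1 + x\<^sup>2))\<bar> * (1 / sqrt (1 + x\<^sup>2)) ^ D \<le> B * inverse (1 + x\<^sup>2)"
        using B[of 0] by (intro mult_mono B) auto
      moreover have "norm (f x) = \<bar>g (x / sqrt (1 + x\<^sup>2))\<bar> * (1 / sqrt (1 + x\<^sup>2)) ^ D"
        using pos[of x] by (simp add: f_def abs_mult)
      ultimately show "norm (f x) \<le> norm (B * inverse (1 + x\<^sup>2))" by simp
    qed
  qed
  have th: "(1 / (cos \<theta>)\<^sup>2) *\<^sub>R f (tan \<theta>) = h \<theta>" if "- (pi / 2) < \<theta>" "\<theta> < pi / 2" for \<theta>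
  proof -
    have c: "cos \<theta> > 0" using that by (rule cos_gt_zero_pi)
    have "1 + (tan \<theta>)\<^sup>2 = (1 / cos \<theta>)\<^sup>2"
      using c tan_sec[of \<theta>] by (simp add: inverse_eq_divide)
    then have s: "sqrt (1 + (tan \<theta>)\<^sup>2) = 1 / cos \<theta>" using c by simp
    have "f (tan \<theta>) = g (sin \<theta>) * cos \<theta> ^ D"
      unfolding f_def s using c by (simp add: tan_def)
    also have "cos \<theta> ^ D = cos \<theta> ^ (D - 2) * (cos \<theta>)\<^sup>2"
      using D by (metis le_add_diff_inverse2 power_add)
    finally show ?thesis using c by (simp add: h_def)
  qed
  have hint: "set_integrable lborel (einterval (ereal (- (pi / 2))) (ereal (pi / 2))) h"
    by (rule set_integrable_subset[of _ "{- (pi / 2)..pi / 2}"])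
      (auto intro!: borel_integrable_atLeastAtMost' ch simp: einterval_def)
  have "(LBINT \<tau>. f \<tau>) = (LBINT \<tau>=-\<infinity>..\<infinity>. f \<tau>)"
    by (simp add: interval_lebesgue_integral_def set_lebesgue_integral_def einterval_def)
  also have "\<dots> = (LBINT \<theta>=ereal (- (pi / 2))..ereal (pi / 2). (1 / (cos \<theta>)\<^sup>2) *\<^sub>R f (tan \<theta>))"
  proof (rule interval_integral_substitution_integrable)
    fix \<theta> assume "ereal (- (pi / 2)) < ereal \<theta>" "ereal \<theta> < ereal (pi / 2)"
    then have c: "cos \<theta> > 0" by (intro cos_gt_zero_pi) auto
    show "(tan has_real_derivative 1 / (cos \<theta>)\<^sup>2) (at \<theta>)"
      using DERIV_tan[of \<theta>] c by (simp add: inverse_eq_divide)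
    show "isCont f (tan \<theta>)" by (rule cf)
    show "isCont (\<lambda>\<theta>. 1 / (cos \<theta>)\<^sup>2) \<theta>" using c by (intro continuous_intros) auto
  next
    show "((ereal \<circ> tan \<circ> real_of_ereal) \<longlongrightarrow> - \<infinity>) (at_right (ereal (- (pi / 2))))"
      by (simp add: ereal_tendsto_simps filterlim_tan_at_right)
    show "((ereal \<circ> tan \<circ> real_of_ereal) \<longlongrightarrow> \<infinity>) (at_left (ereal (pi / 2)))"
      by (simp add: ereal_tendsto_simps filterlim_tan_at_left)
    show "set_integrable lborel (einterval (ereal (- (pi / 2))) (ereal (pi / 2))) (\<lambda>x. (1 / (cos x)\<^sup>2) *\<^sub>R f (tan x))"
      using hint by (rule set_integrable_cong[THEN iffD1, rotated 3])
        (auto simp: einterval_def simp del: scaleR_conv_of_real intro!: th[symmetric, simplified])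
  qed (use fi in auto)
  also have "\<dots> = (LBINT \<theta>=ereal (- (pi / 2))..ereal (pi / 2). h \<theta>)"
    by (rule interval_integral_cong, rule th) (auto simp: einterval_def min_def max_def)
  also have "\<dots> = (LBINT \<theta>:{- (pi/2)..pi/2}. h \<theta>)"
    by (subst interval_integral_Icc) auto
  also have "\<dots> = (LBINT \<theta>. indicator {- (pi/2)..pi/2} (pi/2 + (-1) * \<theta>) *\<^sub>R h (pi/2 + (-1) * \<theta>))"
    unfolding set_lebesgue_integral_def by (subst lborel_integral_real_affine[where c="-1" and t="pi/2"]) auto
  also have "\<dots> = (LBINT r:{0..pi}. g (cos r) * sin r ^ (D - 2))"
    unfolding set_lebesgue_integral_def
  proof (intro Bochner_Integration.integral_cong refl)
    fix r :: real
    have "sin (pi/2 + (-1) * r) = cos r" "cos (pi/2 + (-1) * r) = sin r"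
      by (simp_all add: sin_diff cos_diff)
    then show "indicator {- (pi/2)..pi/2} (pi/2 + (-1) * r) *\<^sub>R h (pi/2 + (-1) * r)
        = indicator {0..pi} r *\<^sub>R (g (cos r) * sin r ^ (D - 2))"
      unfolding h_def by (auto simp: indicator_def)
  qed
  finally show ?thesis unfolding f_def .
qed

section \<open>Even entire functions\<close>

text \<open>
  The factor \<open>1 / (k!)^2\<close> holds, up to a geometric factor, for every even entire function of exponential
  type.  It leaves one factorial to spare against the moments of a Gaussian, which grow like \<open>k!\<close> up to
  geometric factors.
\<close>

definition even_entire :: "(real \<Rightarrow> real) \<Rightarrow> bool" where
  "even_entire f \<longleftrightarrow> (\<exists>w C A. A \<ge> 0 \<and> (\<forall>k. \<bar>w k\<bar> \<le> C * A ^ k / (fact k)\<^sup>2) \<and>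
     (\<forall>r. (\<lambda>k. w k * r ^ (2 * k)) sums f r))"

lemma even_entire_const: "even_entire (\<lambda>_. c)"
  unfolding even_entire_def
proof (intro exI[of _ "\<lambda>k. if k = 0 then c else 0"] exI[of _ "\<bar>c\<bar>"] exI[of _ "0::real"] conjI allI)
  fix r :: real
  show "(\<lambda>k. (if k = 0 then c else 0) * r ^ (2 * k)) sums c"
  proof -
    have "(\<lambda>k. (if k = 0 then c else 0) * r ^ (2 * k)) = (\<lambda>k. if k = 0 then c else 0)" by auto
    then show ?thesis using sums_single[of 0 "\<lambda>_. c"] by simp
  qed
qed auto

lemma bounded_coeff_summable:
  fixes w :: "nat \<Rightarrow> real"
  assumes w: "\<And>k. \<bar>w k\<bar> \<le> C * A ^ k / (fact k)\<^sup>2" and A: "A \<ge> 0"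
  shows "summable (\<lambda>k. \<bar>w k * r ^ (2 * k)\<bar>)"
proof (rule summable_comparison_test'[where N=0])
  show "summable (\<lambda>k. C * ((A * r\<^sup>2) ^ k / fact k))"
    using summable_exp[of "A * r\<^sup>2"] by (intro summable_mult) (simp add: field_simps)
  fix k :: nat
  have C: "C \<ge> 0" using w[of 0] by simp
  have "\<bar>w k * r ^ (2 * k)\<bar> = \<bar>w k\<bar> * (r\<^sup>2) ^ k"
    by (simp add: abs_mult power_mult)
  also have "\<dots> \<le> C * A ^ k / (fact k)\<^sup>2 * (r\<^sup>2) ^ k"
    by (intro mult_right_mono w) auto
  also have "\<dots> = C * (A * r\<^sup>2) ^ k / (fact k)\<^sup>2" by (simp add: power_mult_distrib)
  also have "\<dots> \<le> C * (A * r\<^sup>2) ^ k / fact k"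
    using A C by (intro divide_left_mono) (auto simp: power2_eq_square)
  finally show "norm \<bar>w k * r ^ (2 * k)\<bar> \<le> C * ((A * r\<^sup>2) ^ k / fact k)" by simp
qed

text \<open>
  The Cauchy product; the factorials combine to squares of binomial coefficients, of sum at most \<open>4^k\<close>.
\<close>

lemma even_entire_mult:
  assumes "even_entire f" "even_entire g"
  shows "even_entire (\<lambda>r. f r * g r)"
proof -
  obtain w C A where w: "A \<ge> 0" "\<And>k. \<bar>w k\<bar> \<le> C * A ^ k / (fact k)\<^sup>2"
    "\<And>r. (\<lambda>k. w k * r ^ (2 * k)) sums f r"
    using assms(1) unfolding even_entire_def by blast
  obtain v C' A' where v: "A' \<ge> 0" "\<And>k. \<bar>v k\<bar> \<le> C' * A' ^ k / (fact k)\<^sup>2"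
    "\<And>r. (\<lambda>k. v k * r ^ (2 * k)) sums g r"
    using assms(2) unfolding even_entire_def by blast
  define M where "M = max A A'"
  have M: "M \<ge> 0" "A \<le> M" "A' \<le> M" using w(1) by (auto simp: M_def)
  have C: "C \<ge> 0" "C' \<ge> 0" using w(2)[of 0] v(2)[of 0] by auto
  define u where "u k = (\<Sum>i\<le>k. w i * v (k - i))" for k
  have "\<bar>u k\<bar> \<le> (C * C') * (4 * M) ^ k / (fact k)\<^sup>2" for k
  proof -
    have t: "\<bar>w i * v (k - i)\<bar> \<le> (C * C') * M ^ k / (fact k)\<^sup>2 * (2 ^ k * real (k choose i))" if i: "i \<le> k" for i
    proof -
      have "\<bar>w i\<bar> \<le> C * M ^ i / (fact i)\<^sup>2"
        by (rule order.trans[OF w(2)]) (use w(1) C M in \<open>intro divide_right_mono mult_left_mono power_mono, auto\<close>)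
      moreover have "\<bar>v (k - i)\<bar> \<le> C' * M ^ (k - i) / (fact (k - i))\<^sup>2"
        by (rule order.trans[OF v(2)]) (use v(1) C M in \<open>intro divide_right_mono mult_left_mono power_mono, auto\<close>)
      ultimately have "\<bar>w i * v (k - i)\<bar> \<le> (C * M ^ i / (fact i)\<^sup>2) * (C' * M ^ (k - i) / (fact (k - i))\<^sup>2)"
        unfolding abs_mult by (intro mult_mono) (use C M in auto)
      also have "\<dots> = (C * C') * M ^ k / (fact i * fact (k - i))\<^sup>2"
        using i by (simp add: power_mult_distrib flip: power_add)
      also have "\<dots> = (C * C') * M ^ k / (fact k)\<^sup>2 * (real (k choose i))\<^sup>2"
        using i by (simp add: binomial_fact power_divide)
      also have "\<dots> \<le> (C * C') * M ^ k / (fact k)\<^sup>2 * (2 ^ k * real (k choose i))"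
      proof (rule mult_left_mono)
        have "real (k choose i) \<le> 2 ^ k"
          by (metis binomial_le_pow2 of_nat_le_iff of_nat_numeral of_nat_power)
        then show "(real (k choose i))\<^sup>2 \<le> 2 ^ k * real (k choose i)"
          by (simp add: power2_eq_square mult_right_mono)
      qed (use C M in auto)
      finally show ?thesis .
    qed
    have "\<bar>u k\<bar> \<le> (\<Sum>i\<le>k. (C * C') * M ^ k / (fact k)\<^sup>2 * (2 ^ k * real (k choose i)))"
      unfolding u_def by (rule order.trans[OF sum_abs sum_mono]) (use t in auto)
    also have "\<dots> = (C * C') * M ^ k / (fact k)\<^sup>2 * (2 ^ k * real (\<Sum>i\<le>k. k choose i))"
      by (simp add: sum_distrib_left)
    also have "\<dots> = (C * C') * M ^ k / (fact k)\<^sup>2 * 4 ^ k"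
      unfolding choose_row_sum by (simp flip: power_mult_distrib)
    finally show ?thesis by (simp add: power_mult_distrib mult_ac)
  qed
  moreover have "(\<lambda>k. u k * r ^ (2 * k)) sums (f r * g r)" for r
  proof -
    have "(\<lambda>k. \<Sum>i\<le>k. (w i * r ^ (2 * i)) * (v (k - i) * r ^ (2 * (k - i)))) sums
        ((\<Sum>k. w k * r ^ (2 * k)) * (\<Sum>k. v k * r ^ (2 * k)))"
      by (intro Cauchy_product_sums)
        (use bounded_coeff_summable[OF w(2,1)] bounded_coeff_summable[OF v(2,1)] in auto)
    also have "(\<lambda>k. \<Sum>i\<le>k. (w i * r ^ (2 * i)) * (v (k - i) * r ^ (2 * (k - i)))) = (\<lambda>k. u k * r ^ (2 * k))"
    proof (intro ext)
      fix k
      have "(w i * r ^ (2 * i)) * (v (k - i) * r ^ (2 * (k - i))) = w i * v (k - i) * r ^ (2 * k)" if "i \<le> k" for i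
      proof -
        have "2 * i + 2 * (k - i) = 2 * k" using that by simp
        then have "r ^ (2 * i) * r ^ (2 * (k - i)) = r ^ (2 * k)" by (metis power_add)
        then show ?thesis by (simp add: mult_ac)
      qed
      then show "(\<Sum>i\<le>k. (w i * r ^ (2 * i)) * (v (k - i) * r ^ (2 * (k - i)))) = u k * r ^ (2 * k)"
        unfolding u_def sum_distrib_right by (intro sum.cong refl) auto
    qed
    finally show ?thesis
      using w(3)[of r] v(3)[of r] by (simp add: sums_iff)
  qed
  ultimately show ?thesis
    unfolding even_entire_def using M(1) by (intro exI[of _ u] exI[of _ "C * C'"] exI[of _ "4 * M"]) auto
qed

lemma even_entire_power: "even_entire f \<Longrightarrow> even_entire (\<lambda>r. f r ^ n)"
  by (induction n) (auto intro: even_entire_const even_entire_mult)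

lemma even_entire_add:
  assumes "even_entire f" "even_entire g"
  shows "even_entire (\<lambda>r. f r + g r)"
proof -
  obtain w C A where w: "A \<ge> 0" "\<And>k. \<bar>w k\<bar> \<le> C * A ^ k / (fact k)\<^sup>2"
    "\<And>r. (\<lambda>k. w k * r ^ (2 * k)) sums f r"
    using assms(1) unfolding even_entire_def by blast
  obtain v C' A' where v: "A' \<ge> 0" "\<And>k. \<bar>v k\<bar> \<le> C' * A' ^ k / (fact k)\<^sup>2"
    "\<And>r. (\<lambda>k. v k * r ^ (2 * k)) sums g r"
    using assms(2) unfolding even_entire_def by blast
  define M where "M = max A A'"
  have M: "M \<ge> 0" "A \<le> M" "A' \<le> M" using w(1) by (auto simp: M_def)
  have C: "C \<ge> 0" "C' \<ge> 0" using w(2)[of 0] v(2)[of 0] by auto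
  have "\<bar>w k + v k\<bar> \<le> (C + C') * M ^ k / (fact k)\<^sup>2" for k
  proof -
    have "\<bar>w k\<bar> \<le> C * M ^ k / (fact k)\<^sup>2"
      by (rule order.trans[OF w(2)]) (use w(1) C M in \<open>intro divide_right_mono mult_left_mono power_mono, auto\<close>)
    moreover have "\<bar>v k\<bar> \<le> C' * M ^ k / (fact k)\<^sup>2"
      by (rule order.trans[OF v(2)]) (use v(1) C M in \<open>intro divide_right_mono mult_left_mono power_mono, auto\<close>)
    ultimately show ?thesis by (simp add: distrib_right add_divide_distrib)
  qed
  moreover have "(\<lambda>k. (w k + v k) * r ^ (2 * k)) sums (f r + g r)" for r
    using sums_add[OF w(3) v(3)] by (simp add: distrib_right)
  ultimately show ?thesis
    unfolding even_entire_def using M(1)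
    by (intro exI[of _ "\<lambda>k. w k + v k"] exI[of _ "C + C'"] exI[of _ "M"]) auto
qed

lemma fact_square_le: "(fact k)\<^sup>2 \<le> (fact (2 * k) :: real)"
proof -
  have "fact k * fact k dvd (fact (2 * k) :: nat)"
    using fact_fact_dvd_fact[of k k, where 'a=nat] by (simp add: mult_2)
  then have "fact k * fact k \<le> (fact (2 * k) :: nat)" by (intro dvd_imp_le) auto
  then have "real (fact k * fact k) \<le> real (fact (2 * k))" by (rule of_nat_mono)
  then show ?thesis by (simp add: power2_eq_square)
qed

lemma even_entire_cos: "even_entire cos"
  unfolding even_entire_def
proof (intro exI[of _ "\<lambda>k. (-1) ^ k / fact (2 * k)"] exI[of _ "1::real"] conjI allI)
  fix k :: nat
  show "\<bar>(-1) ^ k / fact (2 * k) :: real\<bar> \<le> 1 * 1 ^ k / (fact k)\<^sup>2"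
    using fact_square_le[of k] by (simp add: abs_mult power_abs frac_le)
next
  fix r :: real
  show "(\<lambda>k. (-1) ^ k / fact (2 * k) * r ^ (2 * k)) sums cos r" by (rule cos_paired)
qed auto

definition sinc :: "real \<Rightarrow> real" where "sinc r = (if r = 0 then 1 else sin r / r)"

lemma even_entire_sinc: "even_entire sinc"
  unfolding even_entire_def
proof (intro exI[of _ "\<lambda>k. (-1) ^ k / fact (2 * k + 1)"] exI[of _ "1::real"] conjI allI)
  fix k :: nat
  have "(fact (2 * k) :: real) \<le> fact (2 * k + 1)" by (rule fact_mono) simp
  then show "\<bar>(-1) ^ k / fact (2 * k + 1) :: real\<bar> \<le> 1 * 1 ^ k / (fact k)\<^sup>2"
    using fact_square_le[of k] by (simp add: abs_mult power_abs frac_le del: fact_Suc)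
next
  fix r :: real
  show "(\<lambda>k. (-1) ^ k / fact (2 * k + 1) * r ^ (2 * k)) sums sinc r"
  proof (cases "r = 0")
    case True
    then show ?thesis
      using sums_single[of 0 "\<lambda>k. 1 :: real"] by (auto simp: sinc_def power_0_left if_distrib cong: if_cong)
  next
    case False
    from sums_divide[OF sin_paired[of r], of r] False show ?thesis
      by (simp add: sinc_def del: fact_Suc)
  qed
qed auto

section \<open>The degree-two Gegenbauer weight against wide Gaussians\<close>

definition gegenbauer_weight :: "nat \<Rightarrow> real \<Rightarrow> real" where
  "gegenbauer_weight d r = gegenbauer 2 ((real d - 1) / 2) (cos r) * sin r ^ (d - 1)"

text \<open>
  The weight divided by the Jacobian \<open>r^(d-1)\<close> of polar coordinates.
\<close>

definition gegenbauer_kernel :: "nat \<Rightarrow> real \<Rightarrow> real" where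
  "gegenbauer_kernel d r = gegenbauer 2 ((real d - 1) / 2) (cos r) * sinc r ^ (d - 1)"

lemma gegenbauer_kernel_weight:
  "d \<ge> 2 \<Longrightarrow> gegenbauer_kernel d r * r ^ (d - 1) = gegenbauer_weight d r"
  by (auto simp: gegenbauer_kernel_def gegenbauer_weight_def sinc_def power_divide power_0_left)

lemma even_entire_gegenbauer_kernel: "even_entire (gegenbauer_kernel d)"
  unfolding gegenbauer_kernel_def gegenbauer_2
  by (intro even_entire_mult even_entire_add even_entire_power even_entire_const even_entire_cos even_entire_sinc)

text \<open>
  From \<open>(sin^n)'' = n (n - 1) sin^(n-2) - n^2 sin^n\<close> one passes from \<open>n - 2\<close> to \<open>n\<close>, starting with
  \<open>U = - sin\<close> for \<open>n = 1\<close>; the sign of \<open>U'(0)\<close> is inherited because the correction term has vanishing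
  derivative at zero.
\<close>

lemma odd_sine_power_double_primitive:
  "\<exists>U U1 B. (\<forall>r. (U has_real_derivative U1 r) (at r)) \<and>
     (\<forall>r. (U1 has_real_derivative sin r ^ (2 * j + 1)) (at r)) \<and>
     (\<forall>r. \<bar>U r\<bar> \<le> B) \<and> (\<forall>r. \<bar>U1 r\<bar> \<le> B) \<and> U1 0 < (0::real)"
proof (induction j)
  case 0
  show ?case
    by (rule exI[of _ "\<lambda>r. - sin r"], rule exI[of _ "\<lambda>r. - cos r"], rule exI[of _ 1])
      (auto intro!: derivative_eq_intros)
next
  case (Suc j)
  define n where "n = real (2 * j + 3)"
  have n: "n \<ge> 3" by (simp add: n_def)
  obtain U U1 B where U: "\<And>r. (U has_real_derivative U1 r) (at r)"
    "\<And>r. (U1 has_real_derivative sin r ^ (2 * j + 1)) (at r)"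
    "\<And>r. \<bar>U r\<bar> \<le> B" "\<And>r. \<bar>U1 r\<bar> \<le> B" "U1 0 < 0"
    using Suc by blast
  define V where "V r = (n - 1) / n * U r - sin r ^ (2 * j + 3) / n\<^sup>2" for r
  define V1 where "V1 r = (n - 1) / n * U1 r - sin r ^ (2 * j + 2) * cos r / n" for r
  have "(V has_real_derivative V1 r) (at r)" for r
  proof -
    have "((\<lambda>r. sin r ^ (2 * j + 3)) has_real_derivative n * (sin r ^ (2 * j + 2) * cos r)) (at r)"
      using DERIV_power[OF DERIV_sin[of r], of "2 * j + 3"] by (simp add: n_def mult_ac)
    from DERIV_diff[OF DERIV_cmult[OF U(1)[of r], of "(n - 1) / n"] DERIV_cdivide[OF this, of "n\<^sup>2"]] n
    show ?thesis unfolding V_def[abs_def] V1_def by (simp add: power2_eq_square)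
  qed
  moreover have "(V1 has_real_derivative sin r ^ (2 * Suc j + 1)) (at r)" for r
  proof -
    have D: "(V1 has_real_derivative ((n - 1) / n * sin r ^ (2 * j + 1) -
       ((2 * j + 2) * sin r ^ (2 * j + 1) * cos r * cos r - sin r ^ (2 * j + 2) * sin r) / n)) (at r)"
    proof -
      have p: "((\<lambda>r. sin r ^ (2 * j + 2)) has_real_derivative (2 * j + 2) * sin r ^ (2 * j + 1) * cos r) (at r)"
        using DERIV_power[OF DERIV_sin[of r], of "2 * j + 2"] by (simp add: mult_ac)
      have "((\<lambda>r. sin r ^ (2 * j + 2) * cos r) has_real_derivative
          (2 * j + 2) * sin r ^ (2 * j + 1) * cos r * cos r - sin r ^ (2 * j + 2) * sin r) (at r)"
        using DERIV_mult[OF p DERIV_cos[of r]] by (simp add: algebra_simps)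
      from DERIV_diff[OF DERIV_cmult[OF U(2)[of r], of "(n - 1) / n"] DERIV_cdivide[OF this, of n]]
      show ?thesis unfolding V1_def[abs_def] by simp
    qed
    have c: "cos r * cos r = 1 - sin r * sin r"
      using sin_cos_squared_add3[of r] by (simp add: algebra_simps)
    have e: "real (2 * j + 2) = n - 1" by (simp add: n_def)
    have "(n - 1) / n * sin r ^ (2 * j + 1) -
       ((2 * j + 2) * sin r ^ (2 * j + 1) * cos r * cos r - sin r ^ (2 * j + 2) * sin r) / n
       = sin r ^ (2 * j + 1) * ((n - 1) - (n - 1) * (cos r * cos r) + sin r * sin r) / n"
    proof -
      have p: "sin r ^ (2 * j + 2) = sin r ^ (2 * j + 1) * sin r" by simp
      have "(n - 1) / n * q - ((n - 1) * q * x * x - q * y * y) / n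
          = q * ((n - 1) - (n - 1) * (x * x) + y * y) / n" for q x y :: real
        using n by (simp add: field_simps)
      then show ?thesis unfolding e p .
    qed
    also have "\<dots> = sin r ^ (2 * j + 1) * (n * (sin r * sin r)) / n"
    proof -
      have "(n - 1) - (n - 1) * (1 - q) + q = n * q" for q by (simp add: algebra_simps)
      then show ?thesis unfolding c by (simp only:)
    qed
    also have "\<dots> = sin r ^ (2 * j + 1) * (sin r * sin r)" using n by simp
    finally show ?thesis using D by (simp add: mult_ac)
  qed
  moreover have "\<bar>V r\<bar> \<le> B + 1" for r
  proof -
    have "\<bar>(n - 1) / n * U r\<bar> \<le> 1 * B"
      unfolding abs_mult using n U(3)[of r] by (intro mult_mono) (auto simp: field_simps)
    moreover have "\<bar>sin r ^ (2 * j + 3)\<bar> \<le> 1"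
      unfolding power_abs by (rule power_le_one) auto
    then have "\<bar>sin r ^ (2 * j + 3) / n\<^sup>2\<bar> \<le> 1 / 1"
      unfolding abs_divide using n by (intro frac_le) (auto simp: power2_eq_square intro: order.trans[OF _ mult_mono[of 1 _ 1]])
    ultimately show ?thesis unfolding V_def by linarith
  qed
  moreover have "\<bar>V1 r\<bar> \<le> B + 1" for r
  proof -
    have "\<bar>(n - 1) / n * U1 r\<bar> \<le> 1 * B"
      unfolding abs_mult using n U(4)[of r] by (intro mult_mono) (auto simp: field_simps)
    moreover have "\<bar>sin r ^ (2 * j + 2)\<bar> \<le> 1"
      unfolding power_abs by (rule power_le_one) auto
    then have "\<bar>sin r ^ (2 * j + 2)\<bar> * \<bar>cos r\<bar> \<le> 1 * 1"
      by (intro mult_mono) auto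
    then have "\<bar>sin r ^ (2 * j + 2) * cos r / n\<bar> \<le> 1 / 1"
      unfolding abs_divide abs_mult using n by (intro frac_le) auto
    ultimately show ?thesis unfolding V1_def by linarith
  qed
  moreover have "V1 0 < 0"
    using n mult_pos_neg[of "(n - 1) / n" "U1 0"] U(5) by (simp add: V1_def)
  ultimately show ?case by blast
qed

lemma integrable_gaussian_polynomial:
  "integrable lborel (\<lambda>x::real. indicator {0..} x * (exp (- x\<^sup>2) * (16 * x ^ 4 + 48 * x\<^sup>2 + 12)))"
proof -
  have *: "integrable lborel (\<lambda>x::real. indicator {0..} x *\<^sub>R (exp (-x\<^sup>2) * x ^ (2 * k)))" for k
    using gaussian_moment_even_pos[of k] by (simp add: has_bochner_integral_iff)
  have "integrable lborel (\<lambda>x::real. 16 * (indicator {0..} x *\<^sub>R (exp (-x\<^sup>2) * x ^ (2 * 2)))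
     + 48 * (indicator {0..} x *\<^sub>R (exp (-x\<^sup>2) * x ^ (2 * 1))) + 12 * (indicator {0..} x *\<^sub>R (exp (-x\<^sup>2) * x ^ (2 * 0))))"
    by (intro Bochner_Integration.integrable_add integrable_mult_right *)
  then show ?thesis by (simp add: algebra_simps power2_eq_square)
qed

text \<open>
  With \<open>S = sin^D\<close> and \<open>E = exp (- a r^2)\<close> the weight is a positive multiple of \<open>S'' = U''''\<close>, where \<open>U\<close> is the
  bounded double primitive of \<open>S\<close>.  The derivatives of \<open>U\<close> and \<open>E\<close> are combined in one function \<open>F\<close> with
  \<open>F' = U'''' E - U E''''\<close>, so the integral is \<open>- F(0) = 2 a U'(0)\<close> plus the integral of \<open>U E''''\<close>.  Scaling
  by \<open>b = sqrt a\<close> shows that the latter is \<open>O(b^3)\<close>.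
\<close>

lemma gaussian_gegenbauer_negative:
  assumes d: "even d" "d \<ge> 2"
  shows "\<exists>a>0. (LBINT r:{0..}. gegenbauer_weight d r * exp (- a * r\<^sup>2)) < 0"
proof -
  define D where "D = d + 1"
  obtain j where j: "D = 2 * j + 1" using d(1) by (auto simp: D_def elim: evenE)
  obtain U U1 B where U: "\<And>r. (U has_real_derivative U1 r) (at r)"
    "\<And>r. (U1 has_real_derivative sin r ^ D) (at r)"
    "\<And>r. \<bar>U r\<bar> \<le> B" "\<And>r. \<bar>U1 r\<bar> \<le> B" "U1 0 < 0"
    using odd_sine_power_double_primitive[of j] unfolding j by blast
  have B: "B \<ge> 0" using U(3)[of 0] by simp
  define S where "S r = sin r ^ D" for r :: real
  define S1 where "S1 r = D * (sin r ^ d * cos r)" for r :: real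
  define S2 where "S2 r = D * (sin r ^ (d - 1) * (D * (cos r)\<^sup>2 - 1))" for r :: real
  have dS: "(S has_real_derivative S1 r) (at r)" for r
    unfolding S_def[abs_def] S1_def
    using DERIV_power[OF DERIV_sin[of r], of D] by (simp add: D_def mult_ac)
  have dS1: "(S1 has_real_derivative S2 r) (at r)" for r
  proof -
    have "(S1 has_real_derivative D * (d * sin r ^ (d - 1) * cos r * cos r - sin r ^ d * sin r)) (at r)"
      unfolding S1_def[abs_def] by (auto intro!: derivative_eq_intros)
    also have "sin r ^ d = sin r ^ (d - 1) * sin r"
      using d(2) power_minus_mult[of d "sin r"] by simp
    also have "D * (d * sin r ^ (d - 1) * cos r * cos r - sin r ^ (d - 1) * sin r * sin r)
      = D * (sin r ^ (d - 1) * (d * (cos r)\<^sup>2 - (sin r)\<^sup>2))"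
      by (simp add: algebra_simps power2_eq_square)
    also have "\<dots> = S2 r" unfolding S2_def D_def sin_squared_eq by (simp add: algebra_simps)
    finally show ?thesis .
  qed
  have bS: "\<bar>S r\<bar> \<le> 1" for r
    unfolding S_def power_abs by (rule power_le_one) auto
  have bS1: "\<bar>S1 r\<bar> \<le> D" for r
  proof -
    have "\<bar>sin r ^ d\<bar> \<le> 1" unfolding power_abs by (rule power_le_one) auto
    then have "\<bar>sin r ^ d\<bar> * \<bar>cos r\<bar> \<le> 1 * 1" by (intro mult_mono) auto
    then show ?thesis unfolding S1_def by (simp add: abs_mult mult_left_le)
  qed
  have bS2: "\<bar>S2 r\<bar> \<le> real D * (real D + 1)" for r
  proof -
    have "\<bar>sin r ^ (d - 1)\<bar> \<le> 1" unfolding power_abs by (rule power_le_one) auto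
    moreover have "\<bar>D * (cos r)\<^sup>2 - 1\<bar> \<le> real D + 1"
    proof -
      have "(cos r)\<^sup>2 \<le> 1" by (simp add: abs_square_le_1)
      then have "D * (cos r)\<^sup>2 \<le> real D * 1" by (intro mult_left_mono) auto
      moreover have "0 \<le> D * (cos r)\<^sup>2" by simp
      ultimately show ?thesis by linarith
    qed
    ultimately have "\<bar>sin r ^ (d - 1)\<bar> * \<bar>D * (cos r)\<^sup>2 - 1\<bar> \<le> 1 * (real D + 1)"
      by (intro mult_mono) auto
    then show ?thesis unfolding S2_def abs_mult by (simp add: mult_left_mono)
  qed
  define lam where "lam = (real d - 1) / 2"
  have lam: "lam > 0" using d by (simp add: lam_def)
  have weight: "gegenbauer_weight d r = (lam / D) * S2 r" for r
  proof -
    have "2 * (lam + 1) = D" by (simp add: lam_def D_def field_simps)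
    then have "- lam + 2 * lam * (lam + 1) * (cos r)\<^sup>2 = lam * (D * (cos r)\<^sup>2 - 1)"
      by (simp add: algebra_simps)
    then show ?thesis
      unfolding gegenbauer_weight_def gegenbauer_2 lam_def[symmetric] S2_def
      by (simp add: D_def)
  qed
  define H where "H x = indicator {0..} x * (exp (- x\<^sup>2) * (16 * x ^ 4 + 48 * x\<^sup>2 + 12))" for x :: real
  define I where "I = (LBINT x. H x)"
  have H: "integrable lborel H" unfolding H_def[abs_def] by (rule integrable_gaussian_polynomial)
  have H0: "H x \<ge> 0" for x by (auto simp: H_def intro!: mult_nonneg_nonneg add_nonneg_nonneg)
  have I0: "I \<ge> 0" unfolding I_def using H0 by simp
  \<comment> \<open>small enough that the remainder, at most \<open>B I b^3\<close>, is less than \<open>- 2 U'(0) b^2\<close>\<close>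
  define b where "b = - U1 0 / (B * I + 1)"
  have BI: "B * I + 1 > 0" using B I0 by (simp add: add_nonneg_pos)
  have b: "b > 0" using U(5) BI by (simp add: b_def divide_neg_pos)
  define a where "a = b\<^sup>2"
  have a: "a > 0" using b by (simp add: a_def)
  define E where "E r = exp (- a * r\<^sup>2)" for r :: real
  define E1 where "E1 r = - 2 * a * r * E r" for r :: real
  define E2 where "E2 r = (4 * a\<^sup>2 * r\<^sup>2 - 2 * a) * E r" for r :: real
  define E3 where "E3 r = (12 * a\<^sup>2 * r - 8 * a ^ 3 * r ^ 3) * E r" for r :: real
  define E4 where "E4 r = (16 * a ^ 4 * r ^ 4 - 48 * a ^ 3 * r\<^sup>2 + 12 * a\<^sup>2) * E r" for r :: real
  have dE: "(E has_real_derivative E1 r) (at r)" for r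
    unfolding E_def[abs_def] E1_def by (auto intro!: derivative_eq_intros)
  have dE1: "(E1 has_real_derivative E2 r) (at r)" for r
    unfolding E1_def[abs_def] E2_def
    by (auto intro!: derivative_eq_intros dE simp: E1_def algebra_simps power2_eq_square)
  have dE2: "(E2 has_real_derivative E3 r) (at r)" for r
    unfolding E2_def[abs_def] E3_def
    by (auto intro!: derivative_eq_intros dE simp: E1_def algebra_simps power2_eq_square power3_eq_cube)
  have dE3: "(E3 has_real_derivative E4 r) (at r)" for r
    unfolding E3_def[abs_def] E4_def
    by (auto intro!: derivative_eq_intros dE simp: E1_def algebra_simps power2_eq_square power3_eq_cube power4_eq_xxxx)
  \<comment> \<open>the boundary terms of the four integrations by parts\<close>
  define F where "F r = S1 r * E r - S r * E1 r + U1 r * E2 r - U r * E3 r" for r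
  have dF: "(F has_real_derivative (S2 r * E r - U r * E4 r)) (at r)" for r
    unfolding F_def[abs_def]
    by (auto intro!: derivative_eq_intros dE dE1 dE2 dE3 dS dS1 U(1,2) simp: S_def[symmetric])
  have eqH: "indicator {0..} r * E r * (16 * a ^ 4 * r ^ 4 + 48 * a ^ 3 * r\<^sup>2 + 12 * a\<^sup>2) = b ^ 4 * H (b * r)" for r
    using b unfolding H_def E_def a_def
    by (auto simp: indicator_def zero_le_mult_iff power_mult_distrib algebra_simps simp flip: power_mult power_add)
  have Hb: "integrable lborel (\<lambda>r. H (b * r))" "(LBINT r. H (b * r)) = I / b"
    using lborel_integrable_real_affine[OF H, of b 0] lborel_integral_real_affine[of b H 0] b
    by (auto simp: I_def)
  have bUE: "\<bar>indicator {0..} r * (U r * E4 r)\<bar> \<le> B * (b ^ 4 * H (b * r))" for r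
  proof -
    have "\<bar>16 * a ^ 4 * r ^ 4 - 48 * a ^ 3 * r\<^sup>2 + 12 * a\<^sup>2\<bar> \<le> 16 * a ^ 4 * r ^ 4 + 48 * a ^ 3 * r\<^sup>2 + 12 * a\<^sup>2"
    proof -
      have "0 \<le> 16 * a ^ 4 * r ^ 4" "0 \<le> 48 * a ^ 3 * r\<^sup>2" "0 \<le> 12 * a\<^sup>2" using a by auto
      then show ?thesis by linarith
    qed
    then have "\<bar>E4 r\<bar> \<le> (16 * a ^ 4 * r ^ 4 + 48 * a ^ 3 * r\<^sup>2 + 12 * a\<^sup>2) * E r"
      unfolding E4_def abs_mult by (simp add: E_def)
    then have "\<bar>U r\<bar> * \<bar>E4 r\<bar> \<le> B * ((16 * a ^ 4 * r ^ 4 + 48 * a ^ 3 * r\<^sup>2 + 12 * a\<^sup>2) * E r)"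
      using U(3)[of r] B by (intro mult_mono) auto
    then show ?thesis unfolding eqH[symmetric] by (auto simp: indicator_def abs_mult mult_ac)
  qed
  have cont: "continuous_on UNIV U" "continuous_on UNIV E4" "continuous_on UNIV S2" "continuous_on UNIV E"
  proof -
    show "continuous_on UNIV U"
      using U(1) by (intro continuous_at_imp_continuous_on ballI) (rule DERIV_isCont)
    show "continuous_on UNIV E4" "continuous_on UNIV S2" "continuous_on UNIV E"
      unfolding E4_def[abs_def] S2_def[abs_def] E_def[abs_def] by (intro continuous_intros)+
  qed
  have meas [measurable]: "U \<in> borel_measurable borel" "E4 \<in> borel_measurable borel"
    "S2 \<in> borel_measurable borel" "E \<in> borel_measurable borel"
    using cont by (auto intro: borel_measurable_continuous_onI)
  have iUE: "set_integrable lborel {0..} (\<lambda>r. U r * E4 r)"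
    unfolding set_integrable_def
    by (rule Bochner_Integration.integrable_bound[where f="\<lambda>r. B * (b ^ 4 * H (b * r))"])
      (use Hb bUE in \<open>auto simp: abs_le_iff intro: order.trans[OF _ abs_ge_self]\<close>)
  have iSE: "set_integrable lborel {0..} (\<lambda>r. S2 r * E r)"
    unfolding set_integrable_def
  proof (rule Bochner_Integration.integrable_bound[where f="\<lambda>r. real D * (real D + 1) * (indicator {0..} (0 + b * r) *\<^sub>R exp (- (0 + b * r)\<^sup>2))"])
    have "integrable lborel (\<lambda>x::real. indicator {0..} x *\<^sub>R exp (- x\<^sup>2))"
      using gaussian_moment_0 by (simp add: has_bochner_integral_iff)
    from lborel_integrable_real_affine[OF this, of b 0] b
    show "integrable lborel (\<lambda>r. real D * (real D + 1) * (indicator {0..} (0 + b * r) *\<^sub>R exp (- (0 + b * r)\<^sup>2)))"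
      by (intro integrable_mult_right) auto
    show "AE x in lborel. norm (indicat_real {0..} x *\<^sub>R (S2 x * E x))
         \<le> norm (real D * (real D + 1) * (indicat_real {0..} (0 + b * x) *\<^sub>R exp (- (0 + b * x)\<^sup>2)))"
    proof (rule AE_I2)
      fix x :: real
      have "\<bar>S2 x\<bar> * E x \<le> real D * (real D + 1) * E x" using bS2[of x] by (intro mult_right_mono) (auto simp: E_def)
      then show "norm (indicat_real {0..} x *\<^sub>R (S2 x * E x))
         \<le> norm (real D * (real D + 1) * (indicat_real {0..} (0 + b * x) *\<^sub>R exp (- (0 + b * x)\<^sup>2)))"
        using b by (auto simp: indicator_def abs_mult E_def a_def power_mult_distrib zero_le_mult_iff)
    qed
  qed auto
  have "(LBINT r=ereal 0..\<infinity>. S2 r * E r - U r * E4 r) = 0 - F 0"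
  proof (rule interval_integral_FTC_integrable)
    show "(F has_vector_derivative S2 r * E r - U r * E4 r) (at r)" for r
      using dF[of r] by (simp add: has_real_derivative_iff_has_vector_derivative)
    show "isCont (\<lambda>r. S2 r * E r - U r * E4 r) r" for r
      using cont by (intro continuous_intros) (auto simp: continuous_on_eq_continuous_at)
    show "set_integrable lborel (einterval (ereal 0) \<infinity>) (\<lambda>r. S2 r * E r - U r * E4 r)"
      by (rule set_integrable_subset[where A="{0..}"]) (auto simp: einterval_def intro: iUE iSE)
    have "isCont F 0" using dF by (rule DERIV_isCont)
    then have "(F \<longlongrightarrow> F 0) (at_right 0)" by (auto simp: isCont_def filterlim_at_split)
    then show "((F \<circ> real_of_ereal) \<longlongrightarrow> F 0) (at_right (ereal 0))"
      by (simp add: ereal_tendsto_simps)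
    have t: "((\<lambda>r. f r * e r) \<longlongrightarrow> 0) at_top" if "\<And>r. \<bar>f r\<bar> \<le> K" "(e \<longlongrightarrow> 0) at_top" for f e :: "real \<Rightarrow> real" and K
    proof (rule Lim_null_comparison)
      show "\<forall>\<^sub>F r in at_top. norm (f r * e r) \<le> K * \<bar>e r\<bar>"
        using that(1) by (intro always_eventually) (auto simp: abs_mult intro: mult_right_mono)
      show "((\<lambda>r. K * \<bar>e r\<bar>) \<longlongrightarrow> 0) at_top"
        using that(2) by (intro tendsto_mult_right_zero tendsto_rabs_zero)
    qed
    have "(F \<longlongrightarrow> 0 - 0 + 0 - 0) at_top"
      unfolding F_def[abs_def]
    proof (intro tendsto_add tendsto_diff)
      show "((\<lambda>r. S1 r * E r) \<longlongrightarrow> 0) at_top"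
        by (rule t[OF bS1]) (unfold E_def, use a in real_asymp)
      show "((\<lambda>r. S r * E1 r) \<longlongrightarrow> 0) at_top"
        by (rule t[OF bS]) (unfold E1_def E_def, use a in real_asymp)
      show "((\<lambda>r. U1 r * E2 r) \<longlongrightarrow> 0) at_top"
        by (rule t[OF U(4)]) (unfold E2_def E_def, use a in real_asymp)
      show "((\<lambda>r. U r * E3 r) \<longlongrightarrow> 0) at_top"
        by (rule t[OF U(3)]) (unfold E3_def E_def, use a in real_asymp)
    qed
    then show "((F \<circ> real_of_ereal) \<longlongrightarrow> 0) (at_left \<infinity>)"
      by (simp add: ereal_tendsto_simps)
  qed auto
  also have "F 0 = - 2 * a * U1 0"
    using d by (simp add: F_def S1_def S_def E1_def E2_def E3_def E_def D_def)
  also have "(LBINT r=ereal 0..\<infinity>. S2 r * E r - U r * E4 r) = (LBINT r:{0..}. S2 r * E r - U r * E4 r)"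
    unfolding interval_integral_to_infinity_eq set_lebesgue_integral_def
    by (rule integral_discrete_difference[of "{0}"]) (auto simp: indicator_def)
  also have "\<dots> = (LBINT r:{0..}. S2 r * E r) - (LBINT r:{0..}. U r * E4 r)"
    by (rule set_integral_diff) (rule iSE iUE)+
  finally have "(LBINT r:{0..}. S2 r * E r) = 2 * a * U1 0 + (LBINT r:{0..}. U r * E4 r)"
    by simp
  also have "(LBINT r:{0..}. U r * E4 r) \<le> (LBINT r. B * (b ^ 4 * H (b * r)))"
    unfolding set_lebesgue_integral_def
    by (rule integral_mono) (use iUE Hb bUE in \<open>auto simp: set_integrable_def abs_le_iff\<close>)
  also have "\<dots> = B * b ^ 3 * I"
    using Hb b by (simp add: power4_eq_xxxx power3_eq_cube)
  also have "2 * a * U1 0 + B * b ^ 3 * I = b\<^sup>2 * (2 * U1 0 + b * (B * I))"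
    by (simp add: a_def power2_eq_square power3_eq_cube algebra_simps)
  also have "\<dots> < 0"
  proof -
    have "b * (B * I) \<le> b * (B * I + 1)" using b by simp
    also have "\<dots> = - U1 0" using BI by (simp add: b_def)
    finally have "2 * U1 0 + b * (B * I) < 0" using U(5) by linarith
    then show ?thesis using b by (simp add: mult_pos_neg)
  qed
  finally have neg: "(LBINT r:{0..}. S2 r * E r) < 0" by simp
  have w: "(\<lambda>r. gegenbauer_weight d r * exp (- a * r\<^sup>2)) = (\<lambda>r. (lam / D) * (S2 r * E r))"
    by (auto simp: fun_eq_iff weight E_def)
  have "(LBINT r:{0..}. (lam / D) * (S2 r * E r)) < 0"
    using mult_pos_neg[OF _ neg, of "lam / D"] lam by (simp add: D_def)
  then show ?thesis unfolding w[symmetric] using a by blast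
qed

section \<open>Functions of Gaussian decay and their convolutions\<close>

lemma set_integrable_power_gaussian:
  assumes b: "b > 0"
  shows "set_integrable lborel {0..} (\<lambda>s::real. exp (- b * s\<^sup>2) * s ^ k)"
proof -
  have int: "integrable lborel (\<lambda>x::real. indicator {0..} x *\<^sub>R (exp (-x\<^sup>2) * x ^ k))"
  proof (cases "even k")
    case True
    then obtain j where "k = 2 * j" by (rule evenE)
    then show ?thesis using gaussian_moment_even_pos[of j] by (simp add: has_bochner_integral_iff)
  next
    case False
    then obtain j where "k = 2 * j + 1" by (rule oddE)
    then show ?thesis using gaussian_moment_odd_pos[of j] by (simp add: has_bochner_integral_iff)
  qed
  define c where "c = sqrt b"
  have c: "c > 0" "c\<^sup>2 = b" using b by (auto simp: c_def)
  have "integrable lborel (\<lambda>s::real. indicator {0..} (0 + c * s) *\<^sub>R (exp (-(0 + c * s)\<^sup>2) * (0 + c * s) ^ k))"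
    by (rule lborel_integrable_real_affine[OF int]) (use c in auto)
  then have "integrable lborel (\<lambda>s::real. (1 / c ^ k) * (indicator {0..} (0 + c * s) *\<^sub>R (exp (-(0 + c * s)\<^sup>2) * (0 + c * s) ^ k)))"
    by (rule integrable_mult_right)
  also have "(\<lambda>s::real. (1 / c ^ k) * (indicator {0..} (0 + c * s) *\<^sub>R (exp (-(0 + c * s)\<^sup>2) * (0 + c * s) ^ k))) =
     (\<lambda>s. indicator {0..} s *\<^sub>R (exp (- b * s\<^sup>2) * s ^ k))"
    using c by (auto simp: fun_eq_iff indicator_def zero_le_mult_iff power_mult_distrib)
  finally show ?thesis by (simp add: set_integrable_def)
qed

definition gaussian :: "real \<Rightarrow> 'a::euclidean_space \<Rightarrow> real" where
  "gaussian b x = exp (- b * (norm x)\<^sup>2)"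

lemma gaussian_measurable [measurable]: "gaussian b \<in> borel_measurable borel"
  unfolding gaussian_def[abs_def] by measurable

lemma gaussian_pos [simp]: "gaussian b x > 0" "gaussian b x \<ge> 0"
  by (auto simp: gaussian_def)

lemma integrable_gaussian: "b > 0 \<Longrightarrow> integrable lborel (gaussian b :: 'a::euclidean_space \<Rightarrow> real)"
  using integrable_radial_iff(1)[of "\<lambda>s. exp (- b * s\<^sup>2)", where 'a='a]
    set_integrable_power_gaussian[of b "DIM('a) - 1"]
  by (simp add: gaussian_def[abs_def])

lemma power_le_fact_exp: "u \<ge> 0 \<Longrightarrow> u ^ k \<le> fact k * exp (u::real)"
proof -
  assume u: "u \<ge> 0"
  have "(\<Sum>n\<in>{k}. u ^ n /\<^sub>R fact n) \<le> (\<Sum>n. u ^ n /\<^sub>R fact n)"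
    by (rule sum_le_suminf) (use u summable_exp_generic[of u] in auto)
  then show ?thesis by (simp add: exp_def field_simps)
qed

text \<open>
  Trading a part \<open>c\<close> of the Gaussian exponent for a power of the norm costs only \<open>k! / c^k\<close>.
\<close>

lemma norm_power_gaussian_le:
  assumes "c > 0"
  shows "norm x ^ (2 * k) * gaussian (b + c) x \<le> fact k * (1 / c) ^ k * gaussian b x"
proof -
  have "(c * (norm x)\<^sup>2) ^ k * gaussian (b + c) x \<le> fact k * exp (c * (norm x)\<^sup>2) * gaussian (b + c) x"
    using assms by (intro mult_right_mono power_le_fact_exp) auto
  also have "\<dots> = fact k * gaussian b x"
    by (simp add: gaussian_def exp_add[symmetric] algebra_simps)
  finally show ?thesis
    using assms by (simp add: power_mult_distrib field_simps flip: power_mult)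
qed

text \<open>
  Both the Gaussians and the continuous functions of compact support satisfy such a bound, and convolution
  squares satisfy it with half the exponent, so that all of these can be treated at once.
\<close>

definition gauss_bounded :: "real \<Rightarrow> ('a::euclidean_space \<Rightarrow> real) \<Rightarrow> bool" where
  "gauss_bounded b q \<longleftrightarrow> q \<in> borel_measurable borel \<and> (\<exists>C. \<forall>x. \<bar>q x\<bar> \<le> C * gaussian b x)"

lemma gauss_bounded_integrable:
  assumes q: "gauss_bounded b q" and b: "b > 0"
  shows "integrable lborel q"
proof -
  obtain C where C: "\<And>x. \<bar>q x\<bar> \<le> C * gaussian b x" and [measurable]: "q \<in> borel_measurable borel"
    using q by (auto simp: gauss_bounded_def)
  show ?thesis
    by (rule Bochner_Integration.integrable_bound[where f="\<lambda>x. C * gaussian b x"])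
      (use C integrable_gaussian[OF b] in \<open>auto intro: order.trans[OF _ abs_ge_self]\<close>)
qed

lemma gauss_bounded_compact_support:
  fixes f :: "'a::euclidean_space \<Rightarrow> real"
  assumes f: "continuous_on UNIV f" and s: "\<And>x. s \<le> norm x \<Longrightarrow> f x = 0"
  shows "gauss_bounded b f"
proof -
  have "continuous_on (cball 0 \<bar>s\<bar>) (\<lambda>x. f x / gaussian b x)"
    unfolding gaussian_def[abs_def]
    by (intro continuous_intros continuous_on_subset[OF f]) auto
  then have "bounded ((\<lambda>x. f x / gaussian b x) ` cball 0 \<bar>s\<bar>)"
    by (intro compact_imp_bounded compact_continuous_image) auto
  then obtain C where "\<forall>y\<in>(\<lambda>x. f x / gaussian b x) ` cball 0 \<bar>s\<bar>. norm y \<le> C"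
    unfolding bounded_iff by blast
  then have C: "\<bar>f x / gaussian b x\<bar> \<le> C" if "norm x \<le> \<bar>s\<bar>" for x
    using that by auto
  have C0: "C \<ge> 0" using order.trans[OF abs_ge_zero C[of 0]] by simp
  have "\<bar>f x\<bar> \<le> C * gaussian b x" for x
  proof (cases "norm x \<le> \<bar>s\<bar>")
    case True
    from C[OF this] show ?thesis by (simp add: pos_divide_le_eq)
  next
    case False
    then show ?thesis using s[of x] C0 by simp
  qed
  moreover have "f \<in> borel_measurable borel" using f by (rule borel_measurable_continuous_onI)
  ultimately show ?thesis unfolding gauss_bounded_def by blast
qed

lemma gauss_bounded_power_mult_le:
  assumes q: "gauss_bounded (b + c) q" and c: "c > 0"
  obtains C where "C \<ge> 0" "\<And>h k x. \<bar>h x\<bar> \<le> norm x ^ (2 * k) \<Longrightarrow>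
    \<bar>q x * h x\<bar> \<le> (C * (fact k * (1 / c) ^ k)) * gaussian b x"
proof -
  obtain C where C: "\<And>x. \<bar>q x\<bar> \<le> C * gaussian (b + c) x"
    using q by (auto simp: gauss_bounded_def)
  have C0: "C \<ge> 0" using order.trans[OF abs_ge_zero C[of 0]] by (simp add: zero_le_mult_iff gaussian_def)
  have "\<bar>q x * h x\<bar> \<le> (C * (fact k * (1 / c) ^ k)) * gaussian b x"
    if h: "\<bar>h x\<bar> \<le> norm x ^ (2 * k)" for h k x
  proof -
    have "\<bar>q x * h x\<bar> \<le> (C * gaussian (b + c) x) * norm x ^ (2 * k)"
      unfolding abs_mult by (intro mult_mono C h) (auto simp: C0)
    also have "\<dots> = C * (norm x ^ (2 * k) * gaussian (b + c) x)" by simp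
    also have "\<dots> \<le> C * (fact k * (1 / c) ^ k * gaussian b x)"
      using C0 c by (intro mult_left_mono norm_power_gaussian_le)
    finally show ?thesis by (simp add: mult_ac)
  qed
  with C0 that show ?thesis by blast
qed

lemma gauss_bounded_power_mult:
  assumes q: "gauss_bounded (b + c) q" and c: "c > 0"
    and h: "h \<in> borel_measurable borel" "\<And>x. \<bar>h x\<bar> \<le> norm x ^ (2 * k)"
  shows "gauss_bounded b (\<lambda>x. q x * h x)"
proof -
  obtain C where "\<And>h k x. \<bar>h x\<bar> \<le> norm x ^ (2 * k) \<Longrightarrow>
    \<bar>q x * h x\<bar> \<le> (C * (fact k * (1 / c) ^ k)) * gaussian b x"
    by (rule gauss_bounded_power_mult_le[OF q c]) blast
  then have "\<forall>x. \<bar>q x * h x\<bar> \<le> (C * (fact k * (1 / c) ^ k)) * gaussian b x" using h(2) by blast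
  moreover have "(\<lambda>x. q x * h x) \<in> borel_measurable borel"
    using h(1) q by (auto simp: gauss_bounded_def)
  ultimately show ?thesis unfolding gauss_bounded_def by blast
qed

lemma moment_bound:
  fixes q :: "'a::euclidean_space \<Rightarrow> real"
  assumes q: "gauss_bounded (b + c) q" and b: "b > 0" and c: "c > 0"
  obtains K where "K \<ge> 0" "\<And>h k. h \<in> borel_measurable borel \<Longrightarrow> (\<And>x. \<bar>h x\<bar> \<le> norm x ^ (2 * k)) \<Longrightarrow>
     integrable lborel (\<lambda>x. q x * h x) \<and> (LBINT x. \<bar>q x * h x\<bar>) \<le> K * (1 / c) ^ k * fact k"
proof -
  obtain C where C: "C \<ge> 0" "\<And>h k x. \<bar>h x\<bar> \<le> norm x ^ (2 * k) \<Longrightarrow>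
    \<bar>q x * h x\<bar> \<le> (C * (fact k * (1 / c) ^ k)) * gaussian b x"
    by (rule gauss_bounded_power_mult_le[OF q c]) blast
  define K where "K = C * (LBINT x. gaussian b (x::'a))"
  show ?thesis
  proof (rule that[of K])
    show "K \<ge> 0" unfolding K_def using C(1) by (intro mult_nonneg_nonneg integral_nonneg) auto
    fix h :: "'a \<Rightarrow> real" and k
    assume h: "h \<in> borel_measurable borel" "\<And>x. \<bar>h x\<bar> \<le> norm x ^ (2 * k)"
    have int: "integrable lborel (\<lambda>x. q x * h x)"
      by (rule gauss_bounded_integrable[OF gauss_bounded_power_mult[OF q c h] b])
    have "(LBINT x. \<bar>q x * h x\<bar>) \<le> (LBINT x. (C * (fact k * (1 / c) ^ k)) * gaussian b (x::'a))"
      using C(2)[of h _ k] h int integrable_gaussian[OF b, where 'a='a] by (intro integral_mono) auto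
    then show "integrable lborel (\<lambda>x. q x * h x) \<and> (LBINT x. \<bar>q x * h x\<bar>) \<le> K * (1 / c) ^ k * fact k"
      using int by (simp add: K_def mult_ac)
  qed
qed

text \<open>
  The parallelogram law for \<open>z - y\<close> and \<open>y\<close>.
\<close>

lemma gaussian_product:
  "gaussian b (z - y) * gaussian b y = gaussian (b / 2) z * gaussian (2 * b) (y - (1/2) *\<^sub>R z)"
proof -
  have "(norm (z - y))\<^sup>2 + (norm y)\<^sup>2 = (norm z)\<^sup>2 / 2 + 2 * (norm (y - (1/2) *\<^sub>R z))\<^sup>2"
    by (simp add: power2_norm_eq_inner inner_diff_left inner_diff_right inner_commute algebra_simps)
  then have "- b * ((norm (z - y))\<^sup>2 + (norm y)\<^sup>2) = - b * ((norm z)\<^sup>2 / 2 + 2 * (norm (y - (1/2) *\<^sub>R z))\<^sup>2)"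
    by (rule arg_cong)
  then have "- b * (norm (z - y))\<^sup>2 + - b * (norm y)\<^sup>2 = - (b / 2) * (norm z)\<^sup>2 + - (2 * b) * (norm (y - (1/2) *\<^sub>R z))\<^sup>2"
    unfolding distrib_left by simp
  then show ?thesis unfolding gaussian_def exp_add[symmetric] by simp
qed

lemma integral_lborel_translation:
  fixes f :: "'a::euclidean_space \<Rightarrow> real"
  assumes [measurable]: "f \<in> borel_measurable borel"
  shows "(LBINT x. f (x - c)) = (LBINT x. f x)"
    and "integrable lborel (\<lambda>x. f (x - c)) \<longleftrightarrow> integrable lborel f"
proof -
  have d: "distr lborel borel (\<lambda>x. x - c) = lborel"
  proof -
    have "(\<lambda>x. x - c) = (+) (- c)" by auto
    then show ?thesis using lborel_distr_plus[of "- c"] by simp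
  qed
  show "(LBINT x. f (x - c)) = (LBINT x. f x)"
    using integral_distr[of "\<lambda>x. x - c" lborel borel f] by (simp add: d)
  show "integrable lborel (\<lambda>x. f (x - c)) \<longleftrightarrow> integrable lborel f"
    using integrable_distr_eq[of "\<lambda>x. x - c" lborel borel f] by (simp add: d)
qed

lemma convolution_gaussian:
  fixes z :: "'a::euclidean_space"
  assumes "b > 0"
  shows "convolution (gaussian b) (gaussian b) z =
    (LBINT y. gaussian (2 * b) (y::'a)) * gaussian (b / 2) z"
proof -
  have "convolution (gaussian b) (gaussian b) z = (LBINT y. gaussian (b / 2) z * gaussian (2 * b) (y - (1/2) *\<^sub>R z))"
    unfolding convolution_def gaussian_product ..
  also have "\<dots> = gaussian (b / 2) z * (LBINT y. gaussian (2 * b) (y - (1/2) *\<^sub>R z))"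
    by simp
  also have "(LBINT y. gaussian (2 * b) (y - (1/2) *\<^sub>R z)) = (LBINT y. gaussian (2 * b) (y::'a))"
    by (rule integral_lborel_translation(1)) simp
  finally show ?thesis by simp
qed

lemma gauss_bounded_convolution:
  fixes q :: "'a::euclidean_space \<Rightarrow> real"
  assumes q: "gauss_bounded b q" and b: "b > 0"
  shows "gauss_bounded (b / 2) (convolution q q)"
    and "integrable lborel (\<lambda>y. q (z - y) * q y)"
proof -
  obtain C where C: "\<And>x. \<bar>q x\<bar> \<le> C * gaussian b x" and [measurable]: "q \<in> borel_measurable borel"
    using q by (auto simp: gauss_bounded_def)
  have C0: "C \<ge> 0" using order.trans[OF abs_ge_zero C[of 0]] by (simp add: zero_le_mult_iff gaussian_def)
  have le: "\<bar>q (z - y) * q y\<bar> \<le> C\<^sup>2 * (gaussian b (z - y) * gaussian b y)" for z y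
  proof -
    have "\<bar>q (z - y)\<bar> * \<bar>q y\<bar> \<le> (C * gaussian b (z - y)) * (C * gaussian b y)"
      by (intro mult_mono C) (auto simp: C0)
    then show ?thesis by (simp add: abs_mult power2_eq_square mult_ac)
  qed
  have ig: "integrable lborel (\<lambda>y. gaussian b (z - y) * gaussian b y)" for z :: 'a
    unfolding gaussian_product
    using integral_lborel_translation(2)[of "gaussian (2 * b)" "(1/2) *\<^sub>R z"] integrable_gaussian[of "2 * b", where 'a='a] b
    by (intro integrable_mult_right) auto
  show int: "integrable lborel (\<lambda>y. q (z - y) * q y)" for z
    by (rule Bochner_Integration.integrable_bound[OF integrable_mult_right[OF ig[of z], of "C\<^sup>2"]])
      (use le in \<open>auto intro: order.trans[OF _ abs_ge_self]\<close>)
  have "\<bar>convolution q q z\<bar> \<le> (C\<^sup>2 * (LBINT y. gaussian (2 * b) (y::'a))) * gaussian (b / 2) z" for z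
  proof -
    have "\<bar>convolution q q z\<bar> \<le> (LBINT y. \<bar>q (z - y) * q y\<bar>)"
      unfolding convolution_def by (rule integral_abs_bound)
    also have "\<dots> \<le> (LBINT y. C\<^sup>2 * (gaussian b (z - y) * gaussian b y))"
      using le int ig by (intro integral_mono) auto
    also have "\<dots> = C\<^sup>2 * convolution (gaussian b) (gaussian b) z"
      by (simp add: convolution_def)
    finally show ?thesis unfolding convolution_gaussian[OF b] by (simp add: mult.assoc)
  qed
  moreover have "convolution q q \<in> borel_measurable borel"
  proof -
    have "(\<lambda>z. LBINT y. q (z - y) * q y) \<in> borel_measurable lborel"
      by (rule lborel.borel_measurable_lebesgue_integral) simp
    then show ?thesis by (simp add: convolution_def[abs_def])
  qed
  ultimately show "gauss_bounded (b / 2) (convolution q q)" unfolding gauss_bounded_def by blast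
qed

section \<open>Moments of radial functions\<close>

lemma integral_pos:
  fixes f :: "'a::euclidean_space \<Rightarrow> real"
  assumes f: "continuous_on UNIV f" "\<And>x. f x \<ge> 0" "integrable lborel f" and x: "f x > 0"
  shows "(LBINT x. f x) > 0"
proof -
  have "isCont f x" using f(1) by (simp add: continuous_on_eq_continuous_at)
  then obtain d where d: "d > 0" "\<And>y. dist y x < d \<Longrightarrow> dist (f y) (f x) < f x / 2"
    unfolding continuous_at_eps_delta dist_norm using x by (metis half_gt_zero)
  have le: "f x / 2 * indicator (ball x d) y \<le> f y" for y
  proof (cases "y \<in> ball x d")
    case True
    then have "\<bar>f y - f x\<bar> < f x / 2" using d(2)[of y] by (simp add: dist_commute dist_real_def abs_minus_commute)
    then have "f x / 2 \<le> f y" by linarith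
    with True show ?thesis by simp
  qed (use f(2) in simp)
  have b: "ball x d \<in> sets lborel" "emeasure lborel (ball x d) < \<infinity>"
    using emeasure_lborel_ball_finite[of x d] by auto
  have "0 < f x / 2 * measure lborel (ball x d)"
    using x d(1) by (simp add: content_ball_pos)
  also have "\<dots> = (LBINT y. f x / 2 * indicator (ball x d) y)"
    by simp
  also have "\<dots> \<le> (LBINT y. f y)"
    using le f(3) b by (intro integral_mono integrable_mult_right integrable_real_indicator) auto
  finally show ?thesis .
qed

text \<open>
  Rotate \<open>u\<close> to \<open>v\<close>.
\<close>

lemma radial_integral_inner:
  fixes \<Phi> :: "'a::euclidean_space \<Rightarrow> real" and h :: "real \<Rightarrow> real"
  assumes "radial \<Phi>" and [measurable]: "\<Phi> \<in> borel_measurable borel" "h \<in> borel_measurable borel"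
    and uv: "norm u = norm v"
  shows "(LBINT z. \<Phi> z * h (z \<bullet> u)) = (LBINT z. \<Phi> z * h (z \<bullet> v))"
proof -
  obtain T where T: "linear T" "\<And>x. norm (T x) = norm x" "surj T" "T u = v"
    "\<And>x y. T x \<bullet> T y = x \<bullet> y"
    by (rule rotation_obtain[OF uv]) auto
  have "(LBINT z. \<Phi> z * h (z \<bullet> v)) = (LBINT z. \<Phi> (T z) * h (T z \<bullet> v))"
    using integral_lborel_isometry[OF T(1-3), of "\<lambda>z. \<Phi> z * h (z \<bullet> v)"] by simp
  also have "\<dots> = (LBINT z. \<Phi> z * h (z \<bullet> u))"
  proof (intro Bochner_Integration.integral_cong refl)
    fix z
    have "\<Phi> (T z) = \<Phi> z" using assms(1) T(2) unfolding radial_def by blast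
    moreover have "T z \<bullet> v = z \<bullet> u" using T(4,5) by metis
    ultimately show "\<Phi> (T z) * h (T z \<bullet> v) = \<Phi> z * h (z \<bullet> u)" by simp
  qed
  finally show ?thesis ..
qed

lemma integrable_pair_mult:
  fixes f :: "'a::euclidean_space \<Rightarrow> real" and g :: "'b::euclidean_space \<Rightarrow> real"
  assumes f: "integrable lborel f" and g: "integrable lborel g"
  shows "integrable (lborel \<Otimes>\<^sub>M lborel) (\<lambda>(x, y). f x * g y)"
proof (rule lborel_pair.Fubini_integrable)
  note [measurable] = borel_measurable_integrable[OF f] borel_measurable_integrable[OF g]
  show "(\<lambda>(x, y). f x * g y) \<in> borel_measurable (lborel \<Otimes>\<^sub>M lborel)" by measurable
  show "integrable lborel (\<lambda>x. LBINT y. norm (case (x, y) of (x, y) \<Rightarrow> f x * g y))"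
    using f by (simp add: abs_mult)
  show "AE x in lborel. integrable lborel (\<lambda>y. case (x, y) of (x, y) \<Rightarrow> f x * g y)"
    using g by simp
qed

lemma gauss_bounded_gaussian: "gauss_bounded b (gaussian b)"
  unfolding gauss_bounded_def by (auto intro!: exI[of _ 1])

lemma radial_gaussian: "radial (gaussian b)"
  by (simp add: radial_def gaussian_def)

lemma abs_inner_power_le:
  assumes "norm e \<le> 1"
  shows "\<bar>(x \<bullet> e) ^ n\<bar> \<le> norm x ^ n"
  unfolding power_abs
  using Cauchy_Schwarz_ineq2[of x e] mult_left_le[OF assms, of "norm x"]
  by (intro power_mono) auto

lemma gauss_bounded_moment_integrable:
  assumes "gauss_bounded b q" "b > 0" "norm e \<le> 1"
  shows "integrable lborel (\<lambda>x. q x * (x \<bullet> e) ^ (2 * k))"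
    and "integrable lborel (\<lambda>x. q x * norm x ^ (2 * k))"
proof -
  have q: "gauss_bounded (b / 2 + b / 2) q" using assms(1) by simp
  show "integrable lborel (\<lambda>x. q x * (x \<bullet> e) ^ (2 * k))"
    by (rule gauss_bounded_integrable[OF gauss_bounded_power_mult[OF q, of _ k]])
      (use assms abs_inner_power_le[OF assms(3), of _ "2 * k"] in auto)
  show "integrable lborel (\<lambda>x. q x * norm x ^ (2 * k))"
    by (rule gauss_bounded_integrable[OF gauss_bounded_power_mult[OF q, of _ k]])
      (use assms in auto)
qed

text \<open>
  Some coordinate satisfies \<open>(norm u)^2 \<le> d (u . i)^2\<close>.
\<close>

lemma norm_power_le_sum_inner_power:
  "norm (u::'a::euclidean_space) ^ (2 * k) \<le> DIM('a) ^ k * (\<Sum>i\<in>Basis. (u \<bullet> i) ^ (2 * k))"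
proof -
  have "\<exists>i\<in>Basis. (norm u)\<^sup>2 \<le> DIM('a) * (u \<bullet> i)\<^sup>2"
  proof (rule ccontr)
    assume "\<not> ?thesis"
    then have "\<And>i. i \<in> Basis \<Longrightarrow> (u \<bullet> i)\<^sup>2 < (norm u)\<^sup>2 / DIM('a)"
      by (auto simp: not_le field_simps)
    then have "(\<Sum>i\<in>Basis. (u \<bullet> i)\<^sup>2) < (\<Sum>i\<in>(Basis :: 'a set). (norm u)\<^sup>2 / DIM('a))"
      by (intro sum_strict_mono) auto
    moreover have "(\<Sum>i\<in>Basis. (u \<bullet> i)\<^sup>2) = (norm u)\<^sup>2"
      by (simp only: power2_norm_eq_inner euclidean_inner[of u u]) (simp add: power2_eq_square)
    ultimately show False by simp
  qed
  then obtain i where i: "i \<in> Basis" "(norm u)\<^sup>2 \<le> DIM('a) * (u \<bullet> i)\<^sup>2" by blast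
  have "norm u ^ (2 * k) \<le> (DIM('a) * (u \<bullet> i)\<^sup>2) ^ k"
    unfolding power_mult by (rule power_mono[OF i(2)]) simp
  also have "\<dots> = DIM('a) ^ k * (u \<bullet> i) ^ (2 * k)"
    by (simp add: power_mult_distrib power_mult)
  also have "\<dots> \<le> DIM('a) ^ k * (\<Sum>i\<in>Basis. (u \<bullet> i) ^ (2 * k))"
    using i(1) by (intro mult_left_mono member_le_sum) (auto simp: power_mult)
  finally show ?thesis by simp
qed

text \<open>
  Integrate \<open>(z . u)^(2 k)\<close> over \<open>z\<close> against \<open>\<Phi>\<close> and over \<open>u\<close> against a Gaussian.  Rotation invariance
  in \<open>u\<close> turns the result into the moment of the norm, rotation invariance in \<open>z\<close> into the moment along
  \<open>e\<close>, each times a constant that does not depend on \<open>\<Phi>\<close>.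
\<close>

lemma radial_moment_ratio:
  fixes e :: "'a::euclidean_space"
  assumes e: "norm e = 1"
  obtains \<rho> :: real where "0 \<le> \<rho>" "\<rho> \<le> DIM('a) ^ (k + 1)"
    "\<And>\<Phi> b. radial \<Phi> \<Longrightarrow> gauss_bounded b \<Phi> \<Longrightarrow> b > 0 \<Longrightarrow>
       (LBINT z. \<Phi> z * norm z ^ (2 * k)) = \<rho> * (LBINT z. \<Phi> z * (z \<bullet> e) ^ (2 * k))"
proof -
  let ?g = "gaussian 1 :: 'a \<Rightarrow> real"
  define B where "B = (LBINT u. ?g u * norm u ^ (2 * k))"
  define B1 where "B1 = (LBINT u. ?g u * (u \<bullet> e) ^ (2 * k))"
  have g: "gauss_bounded 1 ?g" "radial ?g" by (rule gauss_bounded_gaussian radial_gaussian)+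
  have int: "integrable lborel (\<lambda>u. ?g u * norm u ^ (2 * k))"
    "norm v \<le> 1 \<Longrightarrow> integrable lborel (\<lambda>u. ?g u * (u \<bullet> v) ^ (2 * k))" for v
    using gauss_bounded_moment_integrable(2)[OF g(1), of e] gauss_bounded_moment_integrable(1)[OF g(1), of v] e
    by auto
  have "B > 0" unfolding B_def
  proof (rule integral_pos)
    show "continuous_on UNIV (\<lambda>u. ?g u * norm u ^ (2 * k))"
      unfolding gaussian_def by (intro continuous_intros)
    show "?g e * norm e ^ (2 * k) > 0" using e by simp
  qed (use int in auto)
  have rot: "(LBINT u. ?g u * (u \<bullet> v) ^ (2 * k)) = norm v ^ (2 * k) * B1" for v
  proof -
    have "(LBINT u. ?g u * (u \<bullet> v) ^ (2 * k)) = (LBINT u. ?g u * (u \<bullet> (norm v *\<^sub>R e)) ^ (2 * k))"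
      by (rule radial_integral_inner[OF g(2), of "\<lambda>t. t ^ (2 * k)"]) (use e in auto)
    also have "(\<lambda>u. ?g u * (u \<bullet> (norm v *\<^sub>R e)) ^ (2 * k)) = (\<lambda>u. norm v ^ (2 * k) * (?g u * (u \<bullet> e) ^ (2 * k)))"
      by (simp add: power_mult_distrib mult_ac)
    also have "(LBINT u. norm v ^ (2 * k) * (?g u * (u \<bullet> e) ^ (2 * k))) = norm v ^ (2 * k) * B1"
      unfolding B1_def by simp
    finally show ?thesis .
  qed
  have "B \<le> (LBINT u. DIM('a) ^ k * (\<Sum>i\<in>Basis. ?g u * (u \<bullet> i) ^ (2 * k)))"
    unfolding B_def
  proof (rule integral_mono)
    show "?g u * norm u ^ (2 * k) \<le> DIM('a) ^ k * (\<Sum>i\<in>Basis. ?g u * (u \<bullet> i) ^ (2 * k))" for u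
      using mult_left_mono[OF norm_power_le_sum_inner_power[of u k], of "?g u"]
      by (simp add: sum_distrib_left mult.left_commute)
    show "integrable lborel (\<lambda>u. DIM('a) ^ k * (\<Sum>i\<in>Basis. ?g u * (u \<bullet> i) ^ (2 * k)))"
      by (intro integrable_mult_right Bochner_Integration.integrable_sum int) auto
  qed (rule int)
  also have "\<dots> = DIM('a) ^ k * (\<Sum>i\<in>(Basis::'a set). LBINT u. ?g u * (u \<bullet> i) ^ (2 * k))"
    by (subst integral_mult_right_zero, subst Bochner_Integration.integral_sum) (auto intro: int)
  also have "\<dots> = DIM('a) ^ (k + 1) * B1"
    by (simp add: rot)
  finally have BB: "B \<le> DIM('a) ^ (k + 1) * B1" .
  have B1: "B1 > 0"
  proof (rule ccontr)
    assume "\<not> B1 > 0"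
    then have "DIM('a) ^ (k + 1) * B1 \<le> 0" by (intro mult_nonneg_nonpos) auto
    with BB \<open>B > 0\<close> show False by linarith
  qed
  show ?thesis
  proof (rule that[of "B / B1"])
    show "0 \<le> B / B1" using \<open>B > 0\<close> B1 by simp
    show "B / B1 \<le> DIM('a) ^ (k + 1)" using BB B1 by (simp add: pos_divide_le_eq)
    fix \<Phi> :: "'a \<Rightarrow> real" and b :: real assume P: "radial \<Phi>" "gauss_bounded b \<Phi>" and b: "b > 0"
    have [measurable]: "\<Phi> \<in> borel_measurable borel" using P(2) by (simp add: gauss_bounded_def)
    have Pint: "integrable lborel (\<lambda>z. \<Phi> z * norm z ^ (2 * k))"
      using gauss_bounded_moment_integrable(2)[OF P(2) b, of e] e by simp
    have "integrable (lborel \<Otimes>\<^sub>M lborel) (\<lambda>(z, u). \<Phi> z * (?g u * (z \<bullet> u) ^ (2 * k)))"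
    proof (rule Bochner_Integration.integrable_bound[OF integrable_pair_mult[OF Pint int(1)]])
      show "(\<lambda>(z, u). \<Phi> z * (?g u * (z \<bullet> u) ^ (2 * k))) \<in> borel_measurable (lborel \<Otimes>\<^sub>M lborel)"
        by measurable
      show "AE p in lborel \<Otimes>\<^sub>M lborel. norm (case p of (z, u) \<Rightarrow> \<Phi> z * (?g u * (z \<bullet> u) ^ (2 * k)))
        \<le> norm (case p of (z, u) \<Rightarrow> \<Phi> z * norm z ^ (2 * k) * (?g u * norm u ^ (2 * k)))"
      proof (rule AE_I2, clarify)
        fix z u :: 'a
        have "\<bar>(z \<bullet> u) ^ (2 * k)\<bar> \<le> (norm z * norm u) ^ (2 * k)"
          unfolding power_abs by (intro power_mono Cauchy_Schwarz_ineq2) auto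
        then have "\<bar>\<Phi> z\<bar> * (?g u * \<bar>(z \<bullet> u) ^ (2 * k)\<bar>) \<le> \<bar>\<Phi> z\<bar> * (?g u * (norm z * norm u) ^ (2 * k))"
          by (intro mult_left_mono) auto
        then show "norm (\<Phi> z * (?g u * (z \<bullet> u) ^ (2 * k))) \<le> norm (\<Phi> z * norm z ^ (2 * k) * (?g u * norm u ^ (2 * k)))"
          by (simp add: abs_mult power_mult_distrib power_abs mult_ac)
      qed
    qed
    from lborel_pair.Fubini_integral[OF this]
    have "(LBINT u. LBINT z. \<Phi> z * (?g u * (z \<bullet> u) ^ (2 * k))) =
        (LBINT z. LBINT u. \<Phi> z * (?g u * (z \<bullet> u) ^ (2 * k)))" .
    also have "(\<lambda>z. LBINT u. \<Phi> z * (?g u * (z \<bullet> u) ^ (2 * k))) = (\<lambda>z. B1 * (\<Phi> z * norm z ^ (2 * k)))"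
    proof
      fix z
      have "(LBINT u. \<Phi> z * (?g u * (z \<bullet> u) ^ (2 * k))) = \<Phi> z * (LBINT u. ?g u * (u \<bullet> z) ^ (2 * k))"
        by (simp add: inner_commute)
      then show "(LBINT u. \<Phi> z * (?g u * (z \<bullet> u) ^ (2 * k))) = B1 * (\<Phi> z * norm z ^ (2 * k))"
        unfolding rot by (simp add: mult_ac)
    qed
    also have "(\<lambda>u. LBINT z. \<Phi> z * (?g u * (z \<bullet> u) ^ (2 * k))) =
       (\<lambda>u. (LBINT z. \<Phi> z * (z \<bullet> e) ^ (2 * k)) * (?g u * norm u ^ (2 * k)))"
    proof
      fix u
      have "(LBINT z. \<Phi> z * (?g u * (z \<bullet> u) ^ (2 * k))) = (LBINT z. ?g u * (\<Phi> z * (z \<bullet> u) ^ (2 * k)))"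
        by (simp add: mult_ac)
      also have "\<dots> = ?g u * (LBINT z. \<Phi> z * (z \<bullet> u) ^ (2 * k))" by simp
      also have "(LBINT z. \<Phi> z * (z \<bullet> u) ^ (2 * k)) = (LBINT z. \<Phi> z * (z \<bullet> (norm u *\<^sub>R e)) ^ (2 * k))"
        by (rule radial_integral_inner[OF P(1), of "\<lambda>t. t ^ (2 * k)"]) (use e in auto)
      also have "\<dots> = (LBINT z. norm u ^ (2 * k) * (\<Phi> z * (z \<bullet> e) ^ (2 * k)))"
        by (simp add: power_mult_distrib mult_ac)
      also have "\<dots> = norm u ^ (2 * k) * (LBINT z. \<Phi> z * (z \<bullet> e) ^ (2 * k))" by simp
      finally show "(LBINT z. \<Phi> z * (?g u * (z \<bullet> u) ^ (2 * k))) =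
          (LBINT z. \<Phi> z * (z \<bullet> e) ^ (2 * k)) * (?g u * norm u ^ (2 * k))"
        by (simp add: mult_ac)
    qed
    finally have "(LBINT z. \<Phi> z * (z \<bullet> e) ^ (2 * k)) * B = B1 * (LBINT z. \<Phi> z * norm z ^ (2 * k))"
      by (simp add: B_def)
    then show "(LBINT z. \<Phi> z * norm z ^ (2 * k)) = B / B1 * (LBINT z. \<Phi> z * (z \<bullet> e) ^ (2 * k))"
      using B1 by (simp add: field_simps)
  qed
qed

text \<open>
  The moments along an axis are used instead of those of the norm because \<open>(x + y) . e\<close> is additive, which
  gives moments of convolutions by the binomial theorem.
\<close>

definition axis_moment :: "'a::euclidean_space \<Rightarrow> ('a \<Rightarrow> real) \<Rightarrow> nat \<Rightarrow> real" where
  "axis_moment e q i = (LBINT x. q x * (x \<bullet> e) ^ (2 * i))"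

section \<open>Convolution squares integrated against an even entire function of the norm\<close>

text \<open>
  With suitable coefficients \<open>h\<close>, the sum over \<open>k\<close> is the integral of a convolution square against an even
  entire function of the norm, when \<open>x = y\<close> is the moment sequence of the function that is convolved.
\<close>

definition moment_form :: "(nat \<Rightarrow> real) \<Rightarrow> (nat \<Rightarrow> real) \<Rightarrow> (nat \<Rightarrow> real) \<Rightarrow> nat \<Rightarrow> real" where
  "moment_form h x y k = h k * (\<Sum>i\<le>k. real (2 * k choose (2 * i)) * x i * y (k - i))"

lemma sum_even_indices:
  fixes f :: "nat \<Rightarrow> real"
  assumes "\<And>j. odd j \<Longrightarrow> f j = 0"
  shows "(\<Sum>j\<le>2 * k. f j) = (\<Sum>i\<le>k. f (2 * i))"
  by (induction k) (simp_all add: assms)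

lemma gauss_bounded_integrable_power:
  assumes q: "gauss_bounded b q" and b: "b > 0" and e: "norm e = 1"
  shows "integrable lborel (\<lambda>x. q x * (x \<bullet> e) ^ n)"
proof -
  obtain C where C: "\<And>x. \<bar>q x\<bar> \<le> C * gaussian b x" and [measurable]: "q \<in> borel_measurable borel"
    using q by (auto simp: gauss_bounded_def)
  have i0: "integrable lborel (\<lambda>x. q x)" and i1: "integrable lborel (\<lambda>x. q x * (x \<bullet> e) ^ (2 * n))"
    using gauss_bounded_integrable[OF q b] gauss_bounded_moment_integrable(1)[OF q b, of e n] e by auto
  show ?thesis
  proof (rule Bochner_Integration.integrable_bound)
    show "integrable lborel (\<lambda>x. \<bar>q x\<bar> + \<bar>q x * (x \<bullet> e) ^ (2 * n)\<bar>)"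
      using i0 i1 by (intro Bochner_Integration.integrable_add integrable_abs)
    show "AE x in lborel. norm (q x * (x \<bullet> e) ^ n) \<le> norm (\<bar>q x\<bar> + \<bar>q x * (x \<bullet> e) ^ (2 * n)\<bar>)"
    proof (rule AE_I2)
      fix x
      let ?t = "\<bar>(x \<bullet> e) ^ n\<bar>"
      have "?t \<le> 1 + ?t\<^sup>2"
        using zero_le_power2[of "?t - 1"] by (simp add: power2_eq_square algebra_simps)
      then have "\<bar>q x\<bar> * ?t \<le> \<bar>q x\<bar> * (1 + ?t\<^sup>2)" by (rule mult_left_mono) simp
      also have "?t\<^sup>2 = (x \<bullet> e) ^ (2 * n)" by (simp add: power_mult mult.commute[of 2])
      finally show "norm (q x * (x \<bullet> e) ^ n) \<le> norm (\<bar>q x\<bar> + \<bar>q x * (x \<bullet> e) ^ (2 * n)\<bar>)"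
        by (simp add: abs_mult distrib_left)
    qed
  qed measurable
qed

text \<open>
  Expand \<open>((x + y) . e)^(2 k)\<close> by the binomial theorem; the odd moments of an even function vanish.
\<close>

lemma convolution_axis_moment:
  fixes e :: "'a::euclidean_space"
  assumes e: "norm e = 1" and q: "radial q" "gauss_bounded b q" and b: "b > 0"
  shows "(LBINT z. convolution q q z * (z \<bullet> e) ^ (2 * k)) =
     (\<Sum>i\<le>k. real (2 * k choose (2 * i)) * axis_moment e q i * axis_moment e q (k - i))"
proof -
  have [measurable]: "q \<in> borel_measurable borel" using q(2) by (simp add: gauss_bounded_def)
  define Y where "Y j = (LBINT x. q x * (x \<bullet> e) ^ j)" for j
  have int: "integrable lborel (\<lambda>x. q x * (x \<bullet> e) ^ j)" for j
    by (rule gauss_bounded_integrable_power[OF q(2) b e])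
  have Y_odd: "Y j = 0" if "odd j" for j
  proof -
    have "Y j = (LBINT x. q x * (x \<bullet> (- e)) ^ j)"
      unfolding Y_def by (rule radial_integral_inner[OF q(1), of "\<lambda>t. t ^ j"]) auto
    also have "\<dots> = - Y j" using that by (simp add: Y_def power_minus_odd)
    finally show ?thesis by simp
  qed
  let ?a = "\<lambda>x. \<bar>q x\<bar>"
  have qa: "gauss_bounded b ?a" using q(2) by (auto simp: gauss_bounded_def)
  have i2: "integrable (lborel \<Otimes>\<^sub>M lborel) (\<lambda>(z, y). q (z - y) * q y * (z \<bullet> e) ^ (2 * k))"
  proof (rule lborel_pair.Fubini_integrable)
    show "(\<lambda>(z, y). q (z - y) * q y * (z \<bullet> e) ^ (2 * k)) \<in> borel_measurable (lborel \<Otimes>\<^sub>M lborel)"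
      by measurable
    have "integrable lborel (\<lambda>z. convolution ?a ?a z * (z \<bullet> e) ^ (2 * k))"
      using gauss_bounded_moment_integrable(1)[OF gauss_bounded_convolution(1)[OF qa b], of e k] b e by simp
    then show "integrable lborel (\<lambda>z. LBINT y. norm (case (z, y) of (z, y) \<Rightarrow> q (z - y) * q y * (z \<bullet> e) ^ (2 * k)))"
      by (simp add: convolution_def abs_mult power_abs[symmetric] power_even_abs)
    show "AE z in lborel. integrable lborel (\<lambda>y. case (z, y) of (z, y) \<Rightarrow> q (z - y) * q y * (z \<bullet> e) ^ (2 * k))"
      using gauss_bounded_convolution(2)[OF q(2) b] by simp
  qed
  have "(LBINT z. convolution q q z * (z \<bullet> e) ^ (2 * k)) =
      (LBINT z. LBINT y. q (z - y) * q y * (z \<bullet> e) ^ (2 * k))"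
    by (simp add: convolution_def)
  also have "\<dots> = (LBINT y. LBINT z. q (z - y) * q y * (z \<bullet> e) ^ (2 * k))"
    using lborel_pair.Fubini_integral[OF i2] by simp
  also have "\<dots> = (LBINT y. (\<Sum>j\<le>2 * k. real (2 * k choose j) * Y j * (q y * (y \<bullet> e) ^ (2 * k - j))))"
  proof (intro Bochner_Integration.integral_cong refl)
    fix y
    have "(LBINT z. q (z - y) * q y * (z \<bullet> e) ^ (2 * k)) =
        (LBINT x. q x * q y * ((x + y) \<bullet> e) ^ (2 * k))"
      using integral_lborel_translation(1)[of "\<lambda>x. q x * q y * ((x + y) \<bullet> e) ^ (2 * k)" y] by simp
    also have "\<dots> = (LBINT x. (\<Sum>j\<le>2 * k. (real (2 * k choose j) * q y * (y \<bullet> e) ^ (2 * k - j)) * (q x * (x \<bullet> e) ^ j)))"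
      unfolding inner_add_left binomial_ring sum_distrib_left
      by (intro Bochner_Integration.integral_cong sum.cong refl) (simp add: mult_ac)
    also have "\<dots> = (\<Sum>j\<le>2 * k. (real (2 * k choose j) * q y * (y \<bullet> e) ^ (2 * k - j)) * Y j)"
      unfolding Y_def by (subst Bochner_Integration.integral_sum) (auto intro: int)
    finally show "(LBINT z. q (z - y) * q y * (z \<bullet> e) ^ (2 * k)) =
        (\<Sum>j\<le>2 * k. real (2 * k choose j) * Y j * (q y * (y \<bullet> e) ^ (2 * k - j)))"
      by (simp add: mult_ac)
  qed
  also have "\<dots> = (\<Sum>j\<le>2 * k. real (2 * k choose j) * Y j * Y (2 * k - j))"
    unfolding Y_def by (subst Bochner_Integration.integral_sum) (auto intro: int)
  also have "\<dots> = (\<Sum>i\<le>k. real (2 * k choose (2 * i)) * Y (2 * i) * Y (2 * k - 2 * i))"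
    by (rule sum_even_indices) (simp add: Y_odd)
  also have "\<dots> = (\<Sum>i\<le>k. real (2 * k choose (2 * i)) * axis_moment e q i * axis_moment e q (k - i))"
    by (simp add: axis_moment_def Y_def diff_mult_distrib2)
  finally show ?thesis .
qed

text \<open>
  Half of the exponent \<open>b\<close> pays for the power, the other half keeps the integral finite.
\<close>

lemma axis_moment_bound:
  assumes q: "gauss_bounded b q" and b: "b > 0" and e: "norm e = 1"
  obtains K where "K \<ge> 0" "\<And>i. \<bar>axis_moment e q i\<bar> \<le> K * (2 / b) ^ i * fact i"
proof -
  have "gauss_bounded (b / 2 + b / 2) q" using q by simp
  then obtain K where K: "K \<ge> 0"
    "\<And>h k. h \<in> borel_measurable borel \<Longrightarrow> (\<And>x. \<bar>h x\<bar> \<le> norm x ^ (2 * k)) \<Longrightarrow>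
     integrable lborel (\<lambda>x. q x * h x) \<and> (LBINT x. \<bar>q x * h x\<bar>) \<le> K * (1 / (b / 2)) ^ k * fact k"
    by (rule moment_bound) (use b in auto)
  have "\<bar>axis_moment e q i\<bar> \<le> K * (2 / b) ^ i * fact i" for i
  proof -
    have "\<bar>axis_moment e q i\<bar> \<le> (LBINT x. \<bar>q x * (x \<bullet> e) ^ (2 * i)\<bar>)"
      unfolding axis_moment_def by (rule integral_abs_bound)
    also have "\<dots> \<le> K * (1 / (b / 2)) ^ i * fact i"
      by (rule K(2)[THEN conjunct2]) (use e abs_inner_power_le[of e _ "2 * i"] in auto)
    finally show ?thesis by simp
  qed
  with K(1) that show ?thesis by blast
qed

text \<open>
  The convolution square \<open>\<Phi>\<close> of \<open>q\<close> is radial, so its norm moments are multiples of its axis moments, and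
  these are given by the moments of \<open>q\<close>.  The coefficients \<open>h\<close> depend only on \<open>W\<close> and the dimension.
\<close>

lemma convolution_expansion:
  fixes e :: "'a::euclidean_space"
  assumes e: "norm e = 1" and W: "even_entire W"
  obtains h :: "nat \<Rightarrow> real" and C M :: real where "C \<ge> 0" "M \<ge> 0" "\<And>k. \<bar>h k\<bar> \<le> C * M ^ k / (fact k)\<^sup>2"
    "\<And>q b. radial q \<Longrightarrow> gauss_bounded b q \<Longrightarrow> b > 0 \<Longrightarrow>
      moment_form h (axis_moment e q) (axis_moment e q) sums (LBINT z. convolution q q z * W (norm z))"
proof -
  obtain w C A where w: "A \<ge> 0" "\<And>k. \<bar>w k\<bar> \<le> C * A ^ k / (fact k)\<^sup>2"
    "\<And>r. (\<lambda>k. w k * r ^ (2 * k)) sums W r"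
    using W unfolding even_entire_def by blast
  have C: "C \<ge> 0" using order.trans[OF abs_ge_zero w(2)[of 0]] by simp
  define R where "R k \<rho> \<longleftrightarrow> 0 \<le> \<rho> \<and> \<rho> \<le> DIM('a) ^ (k + 1) \<and>
      (\<forall>(\<Phi> :: 'a \<Rightarrow> real) b. radial \<Phi> \<longrightarrow> gauss_bounded b \<Phi> \<longrightarrow> b > 0 \<longrightarrow>
       (LBINT z. \<Phi> z * norm z ^ (2 * k)) = \<rho> * (LBINT z. \<Phi> z * (z \<bullet> e) ^ (2 * k)))"
    for k and \<rho> :: real
  have "\<exists>\<rho>. R k \<rho>" for k
    unfolding R_def by (rule radial_moment_ratio[OF e, of k]) blast
  then obtain \<rho> where R: "\<And>k. R k (\<rho> k)" by metis
  have \<rho>: "0 \<le> \<rho> k" "\<rho> k \<le> DIM('a) ^ (k + 1)" for k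
    using R[of k] by (auto simp: R_def)
  have ratio: "(LBINT z. \<Phi> z * norm z ^ (2 * k)) = \<rho> k * (LBINT z. \<Phi> z * (z \<bullet> e) ^ (2 * k))"
    if "radial \<Phi>" "gauss_bounded b \<Phi>" "b > 0" for k b and \<Phi> :: "'a \<Rightarrow> real"
    using R[of k] that unfolding R_def by blast
  show ?thesis
  proof (rule that[of "C * DIM('a)" "A * DIM('a)" "\<lambda>k. w k * \<rho> k"])
    show "0 \<le> C * DIM('a)" "0 \<le> A * DIM('a)" using C w(1) by auto
    fix k
    have "\<bar>w k * \<rho> k\<bar> \<le> (C * A ^ k / (fact k)\<^sup>2) * DIM('a) ^ (k + 1)"
      unfolding abs_mult using \<rho>[of k] by (intro mult_mono w) (auto simp: C w(1))
    then show "\<bar>w k * \<rho> k\<bar> \<le> C * DIM('a) * (A * DIM('a)) ^ k / (fact k)\<^sup>2"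
      by (simp add: power_mult_distrib mult_ac)
  next
    fix q :: "'a \<Rightarrow> real" and b :: real assume q: "radial q" "gauss_bounded b q" and b: "b > 0"
    have [measurable]: "q \<in> borel_measurable borel" using q(2) by (simp add: gauss_bounded_def)
    let ?P = "convolution q q"
    \<comment> \<open>the convolution square has the exponent \<open>b / 2\<close>; one half of it is traded for the powers of the norm\<close>
    have P: "gauss_bounded (b / 4 + b / 4) ?P" "radial ?P"
      using gauss_bounded_convolution(1)[OF q(2) b] q(1) by (auto intro: radial_convolution)
    obtain K where K: "K \<ge> 0"
      "\<And>h k. h \<in> borel_measurable borel \<Longrightarrow> (\<And>x. \<bar>h x\<bar> \<le> norm x ^ (2 * k)) \<Longrightarrow>
       integrable lborel (\<lambda>x. ?P x * h x) \<and> (LBINT x. \<bar>?P x * h x\<bar>) \<le> K * (1 / (b / 4)) ^ k * fact k"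
      by (rule moment_bound[OF P(1)]) (use b in auto)
    let ?f = "\<lambda>k z. w k * (?P z * norm z ^ (2 * k))"
    have s: "(\<lambda>k. ?f k z) sums (?P z * W (norm z))" for z
      using sums_mult[OF w(3), of "?P z" "norm z"] by (simp add: mult_ac)
    have "(\<lambda>k. LBINT z. ?f k z) sums (LBINT z. (\<Sum>k. ?f k z))"
    proof (rule sums_integral)
      show "integrable lborel (?f k)" for k
        using K(2)[of "\<lambda>z. norm z ^ (2 * k)" k] by (intro integrable_mult_right) auto
      show "AE z in lborel. summable (\<lambda>k. norm (?f k z))"
      proof (rule AE_I2)
        fix z
        have "summable (\<lambda>k. \<bar>?P z\<bar> * \<bar>w k * norm z ^ (2 * k)\<bar>)"
          by (intro summable_mult bounded_coeff_summable[OF w(2,1)])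
        then show "summable (\<lambda>k. norm (?f k z))" by (simp add: abs_mult mult_ac)
      qed
      show "summable (\<lambda>k. LBINT z. norm (?f k z))"
      proof (rule summable_comparison_test'[where N=0])
        show "summable (\<lambda>k. (C * K) * ((A * (1 / (b / 4))) ^ k / fact k))"
          using summable_exp[of "A * (1 / (b / 4))"] by (intro summable_mult) (simp add: field_simps)
        fix k :: nat
        have "(LBINT z. norm (?f k z)) = \<bar>w k\<bar> * (LBINT z. \<bar>?P z * norm z ^ (2 * k)\<bar>)"
          by (simp add: abs_mult)
        also have "\<dots> \<le> (C * A ^ k / (fact k)\<^sup>2) * (K * (1 / (b / 4)) ^ k * fact k)"
          using K(2)[of "\<lambda>z. norm z ^ (2 * k)" k] C w(1) by (intro mult_mono w(2)) auto
        also have "\<dots> = (C * K) * ((A * (1 / (b / 4))) ^ k / fact k)"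
          by (simp add: power2_eq_square power_mult_distrib field_simps)
        finally show "norm (LBINT z. norm (?f k z)) \<le> (C * K) * ((A * (1 / (b / 4))) ^ k / fact k)"
          by simp
      qed
    qed
    also have "(LBINT z. (\<Sum>k. ?f k z)) = (LBINT z. ?P z * W (norm z))"
      using s by (simp add: sums_iff)
    also have "(\<lambda>k. LBINT z. ?f k z) = moment_form (\<lambda>k. w k * \<rho> k) (axis_moment e q) (axis_moment e q)"
    proof
      fix k
      have "(LBINT z. ?f k z) = w k * (LBINT z. ?P z * norm z ^ (2 * k))" by simp
      also have "(LBINT z. ?P z * norm z ^ (2 * k)) = \<rho> k * (LBINT z. ?P z * (z \<bullet> e) ^ (2 * k))"
        by (rule ratio[OF P(2,1)]) (use b in simp)
      also have "(LBINT z. ?P z * (z \<bullet> e) ^ (2 * k)) =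
         (\<Sum>i\<le>k. real (2 * k choose (2 * i)) * axis_moment e q i * axis_moment e q (k - i))"
        by (rule convolution_axis_moment[OF e q b])
      finally show "(LBINT z. ?f k z) = moment_form (\<lambda>k. w k * \<rho> k) (axis_moment e q) (axis_moment e q) k"
        by (simp add: moment_form_def)
    qed
    finally show "moment_form (\<lambda>k. w k * \<rho> k) (axis_moment e q) (axis_moment e q)
        sums (LBINT z. ?P z * W (norm z))" .
  qed
qed

section \<open>Continuity of the moment form\<close>

text \<open>
  Weights \<open>A^i / (i!)^2\<close>: the moments of functions of Gaussian decay are summable with these weights for
  every \<open>A\<close>, and for suitable \<open>A\<close> the moment form is bounded.
\<close>

definition wsummable :: "real \<Rightarrow> (nat \<Rightarrow> real) \<Rightarrow> bool" where
  "wsummable A x \<longleftrightarrow> summable (\<lambda>i. A ^ i / (fact i)\<^sup>2 * \<bar>x i\<bar>)"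

definition wnorm :: "real \<Rightarrow> (nat \<Rightarrow> real) \<Rightarrow> real" where
  "wnorm A x = (\<Sum>i. A ^ i / (fact i)\<^sup>2 * \<bar>x i\<bar>)"

lemma wnorm_add:
  assumes A: "A \<ge> 0" and x: "wsummable A x" and y: "wsummable A y"
  shows "wsummable A (\<lambda>i. x i + y i)" and "wnorm A (\<lambda>i. x i + y i) \<le> wnorm A x + wnorm A y"
proof -
  let ?w = "\<lambda>i. A ^ i / (fact i)\<^sup>2"
  have s: "summable (\<lambda>i. ?w i * \<bar>x i\<bar> + ?w i * \<bar>y i\<bar>)"
    using x y unfolding wsummable_def by (rule summable_add)
  have le: "?w i * \<bar>x i + y i\<bar> \<le> ?w i * \<bar>x i\<bar> + ?w i * \<bar>y i\<bar>" for i
    unfolding distrib_left[symmetric] using A by (intro mult_left_mono abs_triangle_ineq) auto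
  show 1: "wsummable A (\<lambda>i. x i + y i)"
    unfolding wsummable_def
    by (rule summable_comparison_test'[OF s, of 0]) (use le A in \<open>simp add: abs_mult\<close>)
  have "wnorm A (\<lambda>i. x i + y i) \<le> (\<Sum>i. ?w i * \<bar>x i\<bar> + ?w i * \<bar>y i\<bar>)"
    unfolding wnorm_def by (rule suminf_le[OF le]) (use 1 s in \<open>auto simp: wsummable_def\<close>)
  also have "\<dots> = wnorm A x + wnorm A y"
    using x y unfolding wnorm_def wsummable_def by (rule suminf_add[symmetric])
  finally show "wnorm A (\<lambda>i. x i + y i) \<le> wnorm A x + wnorm A y" .
qed

lemma wnorm_cmult:
  assumes x: "wsummable A x"
  shows "wsummable A (\<lambda>i. c * x i)" and "wnorm A (\<lambda>i. c * x i) = \<bar>c\<bar> * wnorm A x"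
proof -
  have eq: "(\<lambda>i. A ^ i / (fact i)\<^sup>2 * \<bar>c * x i\<bar>) = (\<lambda>i. \<bar>c\<bar> * (A ^ i / (fact i)\<^sup>2 * \<bar>x i\<bar>))"
    by (simp add: abs_mult mult_ac)
  show "wsummable A (\<lambda>i. c * x i)"
    using x unfolding wsummable_def eq by (rule summable_mult)
  show "wnorm A (\<lambda>i. c * x i) = \<bar>c\<bar> * wnorm A x"
    using x unfolding wsummable_def wnorm_def eq by (rule suminf_mult)
qed

lemma wnorm_nonneg: "A \<ge> 0 \<Longrightarrow> wsummable A x \<Longrightarrow> wnorm A x \<ge> 0"
  unfolding wnorm_def wsummable_def by (rule suminf_nonneg) auto

lemma wnorm_diff:
  assumes A: "A \<ge> 0" and x: "wsummable A x" and y: "wsummable A y"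
  shows "wsummable A (\<lambda>i. x i - y i)" and "wnorm A (\<lambda>i. x i - y i) \<le> wnorm A x + wnorm A y"
  using wnorm_add[OF A x wnorm_cmult(1)[OF y, of "-1"]] wnorm_cmult(2)[OF y, of "-1"] by simp_all

text \<open>
  The binomial coefficients are at most \<open>4^k\<close> and \<open>i! (k - i)! \<le> k!\<close>.  So the coefficient of \<open>x_i y_(k-i)\<close>
  is dominated by a product of weights, and the form by a Cauchy product.
\<close>

lemma moment_form_bound:
  assumes h: "\<And>k. \<bar>h k\<bar> \<le> C * M ^ k / (fact k)\<^sup>2" and C: "C \<ge> 0" and M: "M \<ge> 0"
    and x: "wsummable (4 * M) x" and y: "wsummable (4 * M) y"
  shows "summable (moment_form h x y)"
    and "\<bar>\<Sum>k. moment_form h x y k\<bar> \<le> C * (wnorm (4 * M) x * wnorm (4 * M) y)"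
proof -
  define u where "u i = (4 * M) ^ i / (fact i)\<^sup>2 * \<bar>x i\<bar>" for i
  define v where "v i = (4 * M) ^ i / (fact i)\<^sup>2 * \<bar>y i\<bar>" for i
  have su: "summable u" "summable v" using x y by (auto simp: wsummable_def u_def[abs_def] v_def[abs_def])
  have pos: "u i \<ge> 0" "v i \<ge> 0" for i using M by (auto simp: u_def v_def)
  have le: "\<bar>moment_form h x y k\<bar> \<le> C * (\<Sum>i\<le>k. u i * v (k - i))" for k
  proof -
    have t: "\<bar>h k\<bar> * \<bar>real (2 * k choose (2 * i)) * x i * y (k - i)\<bar> \<le> C * (u i * v (k - i))" if i: "i \<le> k" for i
    proof -
      have b: "real (2 * k choose (2 * i)) \<le> 4 ^ k"
      proof -
        have "(2 * k choose (2 * i)) \<le> 2 ^ (2 * k)" by (rule binomial_le_pow2)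
        then have "real (2 * k choose (2 * i)) \<le> real (2 ^ (2 * k))" by (rule of_nat_mono)
        then show ?thesis by (simp add: power_mult)
      qed
      have f: "fact i * fact (k - i) \<le> (fact k :: real)"
      proof -
        have "fact i * fact (k - i) dvd (fact (i + (k - i)) :: nat)" by (rule fact_fact_dvd_fact)
        then have "fact i * fact (k - i) \<le> (fact k :: nat)" using i by (intro dvd_imp_le) auto
        then have "real (fact i * fact (k - i)) \<le> real (fact k)" by (rule of_nat_mono)
        then show ?thesis by simp
      qed
      have "\<bar>h k\<bar> \<le> C * M ^ k / (fact i * fact (k - i))\<^sup>2"
        by (rule order.trans[OF h divide_left_mono]) (use f C M in \<open>auto intro!: power_mono\<close>)
      then have "\<bar>h k\<bar> * real (2 * k choose (2 * i)) \<le> (C * M ^ k / (fact i * fact (k - i))\<^sup>2) * 4 ^ k"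
        using b C M by (intro mult_mono) auto
      also have "\<dots> = C * (((4 * M) ^ i / (fact i)\<^sup>2) * ((4 * M) ^ (k - i) / (fact (k - i))\<^sup>2))"
      proof -
        have "(4 * M) ^ i * (4 * M) ^ (k - i) = (4 * M) ^ k"
          using i power_add[of "4 * M" i "k - i"] by simp
        then have eq: "((4 * M) ^ i / (fact i)\<^sup>2) * ((4 * M) ^ (k - i) / (fact (k - i))\<^sup>2) = (4 * M) ^ k / (fact i * fact (k - i))\<^sup>2"
          by (simp only: times_divide_times_eq power_mult_distrib[of "fact i" "fact (k - i)" 2])
        show ?thesis unfolding eq by (simp add: power_mult_distrib)
      qed
      finally have "\<bar>h k\<bar> * real (2 * k choose (2 * i)) * (\<bar>x i\<bar> * \<bar>y (k - i)\<bar>)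
        \<le> C * (((4 * M) ^ i / (fact i)\<^sup>2) * ((4 * M) ^ (k - i) / (fact (k - i))\<^sup>2)) * (\<bar>x i\<bar> * \<bar>y (k - i)\<bar>)"
        by (rule mult_right_mono) auto
      then show ?thesis unfolding u_def v_def by (simp add: abs_mult mult_ac)
    qed
    have "\<bar>moment_form h x y k\<bar> \<le> (\<Sum>i\<le>k. \<bar>h k\<bar> * \<bar>real (2 * k choose (2 * i)) * x i * y (k - i)\<bar>)"
      unfolding moment_form_def abs_mult[of "h k"] sum_distrib_left[symmetric]
      by (intro mult_left_mono sum_abs) auto
    also have "\<dots> \<le> (\<Sum>i\<le>k. C * (u i * v (k - i)))" by (intro sum_mono t) auto
    finally show ?thesis by (simp add: sum_distrib_left)
  qed
  have cp: "(\<lambda>k. \<Sum>i\<le>k. u i * v (k - i)) sums ((\<Sum>k. u k) * (\<Sum>k. v k))"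
    by (rule Cauchy_product_sums) (use su pos in auto)
  then have cs: "summable (\<lambda>k. C * (\<Sum>i\<le>k. u i * v (k - i)))"
    by (intro summable_mult) (auto simp: sums_iff)
  have sa: "summable (\<lambda>k. \<bar>moment_form h x y k\<bar>)"
    by (rule summable_comparison_test'[OF cs, of 0]) (use le in auto)
  then show "summable (moment_form h x y)" by (rule summable_rabs_cancel)
  have "\<bar>\<Sum>k. moment_form h x y k\<bar> \<le> (\<Sum>k. \<bar>moment_form h x y k\<bar>)" by (rule summable_rabs[OF sa])
  also have "\<dots> \<le> (\<Sum>k. C * (\<Sum>i\<le>k. u i * v (k - i)))" by (rule suminf_le[OF le sa cs])
  also have "\<dots> = C * (wnorm (4 * M) x * wnorm (4 * M) y)"
    using cp by (subst suminf_mult) (auto simp: sums_iff wnorm_def u_def[abs_def] v_def[abs_def])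
  finally show "\<bar>\<Sum>k. moment_form h x y k\<bar> \<le> C * (wnorm (4 * M) x * wnorm (4 * M) y)" .
qed

text \<open>
  A bounded quadratic form is continuous: \<open>B(x, x) = B(x - y, x) + B(y, x - y) + B(y, y)\<close>.
\<close>

lemma moment_form_negative_open:
  assumes h: "\<And>k. \<bar>h k\<bar> \<le> C * M ^ k / (fact k)\<^sup>2" and C: "C \<ge> 0" and M: "M \<ge> 0"
    and y: "wsummable (4 * M) y" and neg: "(\<Sum>k. moment_form h y y k) < 0"
  obtains \<epsilon> where "\<epsilon> > 0"
    "\<And>x. wsummable (4 * M) x \<Longrightarrow> wnorm (4 * M) (\<lambda>i. x i - y i) < \<epsilon> \<Longrightarrow> (\<Sum>k. moment_form h x x k) < 0"
proof -
  let ?N = "wnorm (4 * M)"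
  have M4: "4 * M \<ge> 0" using M by simp
  define L where "L = C * (2 * ?N y + 1) + 1"
  have Ny: "?N y \<ge> 0" by (rule wnorm_nonneg[OF M4 y])
  have L: "L > 0" "C * (2 * ?N y + 1) < L" using Ny C by (auto simp: L_def intro!: add_nonneg_pos)
  define s where "s = - (\<Sum>k. moment_form h y y k)"
  have s: "s > 0" using neg by (simp add: s_def)
  define \<epsilon> where "\<epsilon> = min 1 (s / L)"
  show ?thesis
  proof (rule that)
    show "\<epsilon> > 0" using s L by (simp add: \<epsilon>_def)
    fix x assume x: "wsummable (4 * M) x" and xy: "?N (\<lambda>i. x i - y i) < \<epsilon>"
    define z where "z i = x i - y i" for i
    have z: "wsummable (4 * M) z" unfolding z_def[abs_def] by (rule wnorm_diff(1)[OF M4 x y])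
    have Nz: "?N z \<ge> 0" "?N z < \<epsilon>" using wnorm_nonneg[OF M4 z] xy by (auto simp: z_def[abs_def])
    have "?N x \<le> ?N z + ?N y"
      using wnorm_add(2)[OF M4 z y] by (simp add: z_def)
    then have Nx: "?N x \<le> 1 + ?N y" using Nz by (simp add: \<epsilon>_def)
    have eq: "moment_form h x x k = moment_form h z x k + (moment_form h y z k + moment_form h y y k)" for k
      unfolding moment_form_def z_def by (simp add: algebra_simps sum.distrib sum_subtractf)
    note b = moment_form_bound[OF h C M]
    have "(\<Sum>k. moment_form h x x k) =
      (\<Sum>k. moment_form h z x k) + ((\<Sum>k. moment_form h y z k) + (\<Sum>k. moment_form h y y k))"
      unfolding eq using b(1)[OF z x] b(1)[OF y z] b(1)[OF y y]
      by (simp add: suminf_add[symmetric] summable_add)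
    also have "\<dots> \<le> C * (?N z * ?N x) + (C * (?N y * ?N z) - s)"
      using b(2)[OF z x] b(2)[OF y z] by (simp add: s_def abs_le_iff)
    also have "\<dots> = ?N z * (C * (?N x + ?N y)) - s" by (simp add: algebra_simps)
    also have "\<dots> \<le> ?N z * (C * (2 * ?N y + 1)) - s"
      using Nz C Nx by (intro diff_right_mono mult_left_mono) auto
    also have "\<dots> \<le> ?N z * L - s" using Nz L by (intro diff_right_mono mult_left_mono) auto
    also have "\<dots> < \<epsilon> * L - s" using Nz L by simp
    also have "\<dots> \<le> (s / L) * L - s" using L by (intro diff_right_mono mult_right_mono) (auto simp: \<epsilon>_def)
    also have "\<dots> = 0" using L by simp
    finally show "(\<Sum>k. moment_form h x x k) < 0" .
  qed
qed

section \<open>Approximation of moment sequences by small bumps\<close>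

definition test_function :: "real \<Rightarrow> ('a::euclidean_space \<Rightarrow> real) \<Rightarrow> bool" where
  "test_function s q \<longleftrightarrow> radial q \<and> (\<forall>k. C_k k q) \<and> (\<forall>x. s \<le> norm x \<longrightarrow> q x = 0)"

lemma test_function_add:
  assumes "test_function s f" "test_function s g"
  shows "test_function s (\<lambda>x. f x + g x)"
proof -
  have "radial f" "radial g" using assms by (auto simp: test_function_def)
  then have "radial (\<lambda>x. f x + g x)" unfolding radial_def by metis
  with assms show ?thesis by (auto simp: test_function_def intro: C_k_add)
qed

lemma test_function_cmult:
  assumes "test_function s f"
  shows "test_function s (\<lambda>x. c * f x)"
proof -
  have "radial f" using assms by (auto simp: test_function_def)
  then have "radial (\<lambda>x. c * f x)" unfolding radial_def by metis
  with assms show ?thesis by (auto simp: test_function_def intro: C_k_cmult)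
qed

lemma test_function_mono: "test_function s f \<Longrightarrow> s \<le> t \<Longrightarrow> test_function t f"
  unfolding test_function_def by auto

lemma test_function_bump: "0 < s \<Longrightarrow> test_function s (bump s)"
  unfolding test_function_def by (auto intro: radial_bump C_k_bump bump_eq_0)

lemma test_function_continuous: "test_function s f \<Longrightarrow> continuous_on UNIV f"
  unfolding test_function_def using C_k_continuous by blast

lemma test_function_gauss_bounded: "test_function s f \<Longrightarrow> gauss_bounded b f"
  by (rule gauss_bounded_compact_support[of f s])
    (erule test_function_continuous, simp add: test_function_def)

lemma axis_moment_add:
  assumes "gauss_bounded b f" "gauss_bounded b g" "b > 0" "norm e = 1"
  shows "axis_moment e (\<lambda>x. f x + g x) i = axis_moment e f i + axis_moment e g i"
  unfolding axis_moment_def distrib_right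
  by (rule Bochner_Integration.integral_add)
    (rule gauss_bounded_integrable_power[OF assms(1,3,4)], rule gauss_bounded_integrable_power[OF assms(2,3,4)])

lemma axis_moment_cmult: "axis_moment e (\<lambda>x. c * f x) i = c * axis_moment e f i"
  unfolding axis_moment_def mult.assoc by simp

lemma axis_moment_wsummable:
  assumes q: "gauss_bounded b q" and b: "b > 0" and e: "norm e = 1" and A: "A \<ge> 0"
  shows "wsummable A (axis_moment e q)"
proof -
  obtain K where K: "K \<ge> 0" "\<And>i. \<bar>axis_moment e q i\<bar> \<le> K * (2 / b) ^ i * fact i"
    by (rule axis_moment_bound[OF q b e]) blast
  have "summable (\<lambda>i. K * ((A * (2 / b)) ^ i / fact i))"
    using summable_exp[of "A * (2 / b)"] by (intro summable_mult) (simp add: field_simps)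
  then show ?thesis
    unfolding wsummable_def
  proof (rule summable_comparison_test'[of _ 0])
    fix i :: nat
    have "A ^ i / (fact i)\<^sup>2 * \<bar>axis_moment e q i\<bar> \<le> A ^ i / (fact i)\<^sup>2 * (K * (2 / b) ^ i * fact i)"
      using A by (intro mult_left_mono K) auto
    also have "\<dots> = K * ((A * (2 / b)) ^ i / fact i)"
      by (simp add: power2_eq_square power_mult_distrib field_simps)
    finally show "norm (A ^ i / (fact i)\<^sup>2 * \<bar>axis_moment e q i\<bar>) \<le> K * ((A * (2 / b)) ^ i / fact i)"
      using A by (simp add: abs_mult)
  qed
qed

lemma integral_lborel_scale:
  fixes f :: "'a::euclidean_space \<Rightarrow> real"
  assumes [measurable]: "f \<in> borel_measurable borel" and c: "c > 0"
  shows "(LBINT x. f x) = c ^ DIM('a) * (LBINT x. f (c *\<^sub>R x))"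
proof -
  have "(LBINT x. f x) = (LINT x|density (distr lborel borel (\<lambda>x::'a. 0 + c *\<^sub>R x)) (\<lambda>_. ennreal (\<bar>c\<bar> ^ DIM('a))). f x)"
    using lborel_affine[of c "0::'a"] c by simp
  also have "\<dots> = (LINT x|distr lborel borel (\<lambda>x::'a. 0 + c *\<^sub>R x). \<bar>c\<bar> ^ DIM('a) *\<^sub>R f x)"
    by (rule integral_density) auto
  also have "\<dots> = c ^ DIM('a) * (LBINT x. f (c *\<^sub>R x))"
    using c by (subst integral_distr) auto
  finally show ?thesis .
qed

lemma axis_moment_bump:
  fixes e :: "'a::euclidean_space"
  assumes "\<sigma> > 0"
  shows "axis_moment e (bump \<sigma>) i = \<sigma> ^ DIM('a) * (\<sigma> ^ (2 * i) * axis_moment e (bump 1) i)"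
proof -
  have [measurable]: "bump \<sigma> \<in> borel_measurable borel"
    using C_k_continuous[OF C_k_bump] by (rule borel_measurable_continuous_onI)
  have "axis_moment e (bump \<sigma>) i = \<sigma> ^ DIM('a) * (LBINT x. bump \<sigma> (\<sigma> *\<^sub>R x) * ((\<sigma> *\<^sub>R x) \<bullet> e) ^ (2 * i))"
    unfolding axis_moment_def by (rule integral_lborel_scale) (use assms in auto)
  also have "(\<lambda>x. bump \<sigma> (\<sigma> *\<^sub>R x) * ((\<sigma> *\<^sub>R x) \<bullet> e) ^ (2 * i)) = (\<lambda>x. \<sigma> ^ (2 * i) * (bump 1 x * (x \<bullet> e) ^ (2 * i)))"
    using assms by (simp add: bump_def power_mult_distrib mult_ac)
  finally show ?thesis by (simp add: axis_moment_def)
qed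

text \<open>
  Positivity makes it possible to divide by these moments in \<open>approximable_unit\<close>.
\<close>

lemma axis_moment_bump_pos:
  fixes e :: "'a::euclidean_space"
  assumes e: "norm e = 1"
  shows "axis_moment e (bump 1) i > 0"
  unfolding axis_moment_def
proof (rule integral_pos)
  show "continuous_on UNIV (\<lambda>x. bump 1 x * (x \<bullet> e) ^ (2 * i))"
    by (intro continuous_intros C_k_continuous[OF C_k_bump])
  show "integrable lborel (\<lambda>x. bump 1 x * (x \<bullet> e) ^ (2 * i))"
    by (rule gauss_bounded_integrable_power[OF test_function_gauss_bounded[OF test_function_bump] zero_less_one e]) simp
  show "bump 1 ((1/2) *\<^sub>R e) * (((1/2) *\<^sub>R e) \<bullet> e) ^ (2 * i) > 0"
    using e by (intro mult_pos_pos) (auto simp: bump_pos_iff dot_square_norm)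
qed auto

text \<open>
  Membership in the closure, for the weighted norm, of the moment sequences of test functions.
\<close>

definition approximable :: "real \<Rightarrow> real \<Rightarrow> 'a::euclidean_space \<Rightarrow> (nat \<Rightarrow> real) \<Rightarrow> bool" where
  "approximable s A e y \<longleftrightarrow> (\<forall>\<epsilon>>0. \<exists>q. test_function s q \<and>
     wsummable A (\<lambda>i. axis_moment e q i - y i) \<and> wnorm A (\<lambda>i. axis_moment e q i - y i) < \<epsilon>)"

lemma approximable_closed:
  assumes A: "A \<ge> 0"
    and "\<And>\<epsilon>. \<epsilon> > 0 \<Longrightarrow> \<exists>z. approximable s A e z \<and> wsummable A (\<lambda>i. z i - y i) \<and> wnorm A (\<lambda>i. z i - y i) < \<epsilon>"
  shows "approximable s A e y"
  unfolding approximable_def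
proof (intro allI impI)
  fix \<epsilon> :: real assume \<epsilon>: "\<epsilon> > 0"
  then obtain z where z: "approximable s A e z" "wsummable A (\<lambda>i. z i - y i)" "wnorm A (\<lambda>i. z i - y i) < \<epsilon> / 2"
    using assms(2)[of "\<epsilon> / 2"] by auto
  obtain q where q: "test_function s q" "wsummable A (\<lambda>i. axis_moment e q i - z i)"
    "wnorm A (\<lambda>i. axis_moment e q i - z i) < \<epsilon> / 2"
    using z(1) \<epsilon> unfolding approximable_def by (meson half_gt_zero)
  show "\<exists>q. test_function s q \<and>
     wsummable A (\<lambda>i. axis_moment e q i - y i) \<and> wnorm A (\<lambda>i. axis_moment e q i - y i) < \<epsilon>"
    using wnorm_add[OF A q(2) z(2)] q z by (intro exI[of _ q]) auto
qed

lemma approximable_add: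
  assumes A: "A \<ge> 0" and e: "norm e = 1" and y: "approximable s A e y" and z: "approximable s A e z"
  shows "approximable s A e (\<lambda>i. y i + z i)"
  unfolding approximable_def
proof (intro allI impI)
  fix \<epsilon> :: real assume "\<epsilon> > 0"
  then have \<epsilon>: "\<epsilon> / 2 > 0" by simp
  obtain p where p: "test_function s p" "wsummable A (\<lambda>i. axis_moment e p i - y i)"
    "wnorm A (\<lambda>i. axis_moment e p i - y i) < \<epsilon> / 2"
    using y \<epsilon> unfolding approximable_def by blast
  obtain q where q: "test_function s q" "wsummable A (\<lambda>i. axis_moment e q i - z i)"
    "wnorm A (\<lambda>i. axis_moment e q i - z i) < \<epsilon> / 2"
    using z \<epsilon> unfolding approximable_def by blast
  have eq: "axis_moment e (\<lambda>x. p x + q x) i - (y i + z i) = (axis_moment e p i - y i) + (axis_moment e q i - z i)" for i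
    using axis_moment_add[of 1 p q e i] p(1) q(1) e by (simp add: test_function_gauss_bounded)
  show "\<exists>q. test_function s q \<and>
     wsummable A (\<lambda>i. axis_moment e q i - (y i + z i)) \<and> wnorm A (\<lambda>i. axis_moment e q i - (y i + z i)) < \<epsilon>"
    using wnorm_add[OF A p(2) q(2)] p q
    by (intro exI[of _ "\<lambda>x. p x + q x"]) (auto simp: eq intro: test_function_add)
qed

lemma approximable_cmult:
  assumes A: "A \<ge> 0" and y: "approximable s A e y"
  shows "approximable s A e (\<lambda>i. c * y i)"
  unfolding approximable_def
proof (intro allI impI)
  fix \<epsilon> :: real assume \<epsilon>: "\<epsilon> > 0"
  then have "\<epsilon> / (\<bar>c\<bar> + 1) > 0" by (intro divide_pos_pos) auto
  then obtain q where q: "test_function s q" "wsummable A (\<lambda>i. axis_moment e q i - y i)"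
    "wnorm A (\<lambda>i. axis_moment e q i - y i) < \<epsilon> / (\<bar>c\<bar> + 1)"
    using y unfolding approximable_def by blast
  have eq: "axis_moment e (\<lambda>x. c * q x) i - c * y i = c * (axis_moment e q i - y i)" for i
    by (simp add: axis_moment_cmult algebra_simps)
  have "\<bar>c\<bar> * wnorm A (\<lambda>i. axis_moment e q i - y i) \<le> (\<bar>c\<bar> + 1) * wnorm A (\<lambda>i. axis_moment e q i - y i)"
    using wnorm_nonneg[OF A q(2)] by (intro mult_right_mono) auto
  also have "\<dots> < \<epsilon>" using q(3) by (simp add: pos_less_divide_eq mult.commute)
  finally show "\<exists>q. test_function s q \<and>
     wsummable A (\<lambda>i. axis_moment e q i - c * y i) \<and> wnorm A (\<lambda>i. axis_moment e q i - c * y i) < \<epsilon>"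
    using wnorm_cmult[OF q(2), of c] q(1)
    by (intro exI[of _ "\<lambda>x. c * q x"]) (auto simp: eq intro: test_function_cmult)
qed

lemma approximable_exact: "test_function s q \<Longrightarrow> approximable s A e (axis_moment e q)"
  unfolding approximable_def by (auto intro!: exI[of _ q] simp: wsummable_def wnorm_def)

lemma approximable_zero:
  assumes "A \<ge> 0" "s > 0"
  shows "approximable s A e (\<lambda>i. 0)"
  using approximable_cmult[OF assms(1) approximable_exact[OF test_function_bump[OF assms(2)]], where c=0] by simp

lemma approximable_finite_sum:
  fixes N :: nat
  assumes A: "A \<ge> 0" and s: "s > 0" and e: "norm e = 1" and u: "\<And>n. n < N \<Longrightarrow> approximable s A e (u n)"
  shows "approximable s A e (\<lambda>i. \<Sum>n<N. c n * u n i)"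
  using u
proof (induction N)
  case 0
  then show ?case using approximable_zero[OF A s] by simp
next
  case (Suc N)
  then have "approximable s A e (\<lambda>i. (\<Sum>n<N. c n * u n i) + c N * u N i)"
    by (intro approximable_add[OF A e] approximable_cmult[OF A]) auto
  then show ?case by simp
qed

text \<open>
  By induction on \<open>n\<close>.  The moments of the bump of radius \<open>\<sigma>\<close>, divided by the \<open>n\<close>-th one, are one at \<open>n\<close>
  and \<open>O(\<sigma>^2)\<close> beyond \<open>n\<close>; the finitely many earlier entries, which blow up as \<open>\<sigma>\<close> tends to zero, are removed
  with the earlier unit sequences.
\<close>

lemma approximable_unit:
  fixes e :: "'a::euclidean_space"
  assumes A: "A \<ge> 0" and s: "s > 0" and e: "norm e = 1"
  shows "approximable s A e (\<lambda>i. if i = n then 1 else 0)"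
proof (induction n rule: less_induct)
  case (less n)
  define a where "a i = axis_moment e (bump 1) i" for i
  have a: "a i > 0" for i unfolding a_def by (rule axis_moment_bump_pos[OF e])
  have wa: "wsummable A a" unfolding a_def[abs_def]
    by (rule axis_moment_wsummable[OF test_function_gauss_bounded[OF test_function_bump], of 1 1]) (use e A in auto)
  define L where "L = wnorm A a / a n + 1"
  have L: "L > 0" "wnorm A a / a n < L" using wnorm_nonneg[OF A wa] a[of n] by (auto simp: L_def add_nonneg_pos)
  show ?case
  proof (rule approximable_closed[OF A])
    fix \<epsilon> :: real assume \<epsilon>: "\<epsilon> > 0"
    \<comment> \<open>at most \<open>s\<close> for the support, at most one for \<open>\<sigma>^(2 (i - n)) \<le> \<sigma>\<close>\<close>
    define \<sigma> where "\<sigma> = Min {s, 1, \<epsilon> / L}"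
    have \<sigma>: "\<sigma> > 0" "\<sigma> \<le> s" "\<sigma> \<le> 1" "\<sigma> \<le> \<epsilon> / L" using s \<epsilon> L by (auto simp: \<sigma>_def)
    define z where "z i = (1 / (\<sigma> ^ DIM('a) * \<sigma> ^ (2 * n) * a n)) * axis_moment e (bump \<sigma>) i
       + (-1) * (\<Sum>j<n. (a j * \<sigma> ^ (2 * j) / (\<sigma> ^ (2 * n) * a n)) * (if i = j then 1 else 0))" for i
    have "approximable s A e z"
      unfolding z_def[abs_def]
      by (intro approximable_add[OF A e] approximable_cmult[OF A] approximable_finite_sum[OF A s e] less.IH
          approximable_exact test_function_mono[OF test_function_bump] \<sigma>)
    have z: "z i - (if i = n then 1 else 0) = (if i \<le> n then 0 else \<sigma> ^ (2 * (i - n)) * a i / a n)" for i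
    proof -
      have q1: "(1 / (\<sigma> ^ DIM('a) * \<sigma> ^ (2 * n) * a n)) * axis_moment e (bump \<sigma>) i = \<sigma> ^ (2 * i) * a i / (\<sigma> ^ (2 * n) * a n)"
        using \<sigma>(1) a[of n] unfolding axis_moment_bump[OF \<sigma>(1)] a_def[symmetric] by simp
      have q2: "(\<Sum>j<n. (a j * \<sigma> ^ (2 * j) / (\<sigma> ^ (2 * n) * a n)) * (if i = j then 1 else 0)) =
          (if i < n then a i * \<sigma> ^ (2 * i) / (\<sigma> ^ (2 * n) * a n) else 0)"
        by (simp add: if_distrib sum.delta cong: if_cong)
      consider "i < n" | "i = n" | "i > n" by linarith
      then show ?thesis
      proof cases
        case 1
        then show ?thesis unfolding z_def q1 q2 by (simp add: mult.commute)
      next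
        case 2
        then show ?thesis unfolding z_def q1 q2 using \<sigma>(1) a[of n] by simp
      next
        case 3
        then have "2 * i = 2 * (i - n) + 2 * n" by simp
        then have "\<sigma> ^ (2 * i) = \<sigma> ^ (2 * (i - n)) * \<sigma> ^ (2 * n)" by (metis power_add)
        with 3 \<sigma>(1) show ?thesis unfolding z_def q1 q2 by simp
      qed
    qed
    have le: "A ^ i / (fact i)\<^sup>2 * \<bar>z i - (if i = n then 1 else 0)\<bar> \<le> (\<sigma> / a n) * (A ^ i / (fact i)\<^sup>2 * \<bar>a i\<bar>)" for i
    proof -
      have "\<bar>z i - (if i = n then 1 else 0)\<bar> \<le> \<sigma> / a n * \<bar>a i\<bar>"
      proof (cases "i \<le> n")
        case False
        have "\<sigma> ^ (2 * (i - n)) \<le> \<sigma> ^ 1"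
          using False \<sigma> by (intro power_decreasing) auto
        then have "\<sigma> ^ (2 * (i - n)) * a i / a n \<le> \<sigma> * a i / a n"
          using a[of i] a[of n] by (intro divide_right_mono mult_right_mono) auto
        with False show ?thesis unfolding z using a[of i] a[of n] \<sigma>(1) by (simp add: abs_mult)
      qed (use z[of i] \<sigma>(1) a[of n] in simp)
      then have "A ^ i / (fact i)\<^sup>2 * \<bar>z i - (if i = n then 1 else 0)\<bar> \<le> A ^ i / (fact i)\<^sup>2 * (\<sigma> / a n * \<bar>a i\<bar>)"
        using A by (intro mult_left_mono) auto
      then show ?thesis by (simp add: mult_ac)
    qed
    have sa: "summable (\<lambda>i. (\<sigma> / a n) * (A ^ i / (fact i)\<^sup>2 * \<bar>a i\<bar>))"
      using wa unfolding wsummable_def by (rule summable_mult)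
    have sz: "wsummable A (\<lambda>i. z i - (if i = n then 1 else 0))"
      unfolding wsummable_def by (rule summable_comparison_test'[OF sa, of 0]) (use le A in \<open>simp add: abs_mult\<close>)
    have "wnorm A (\<lambda>i. z i - (if i = n then 1 else 0)) \<le> (\<Sum>i. (\<sigma> / a n) * (A ^ i / (fact i)\<^sup>2 * \<bar>a i\<bar>))"
      unfolding wnorm_def by (rule suminf_le[OF le _ sa]) (use sz in \<open>simp add: wsummable_def\<close>)
    also have "\<dots> = \<sigma> * (wnorm A a / a n)"
      using wa unfolding wsummable_def wnorm_def by (subst suminf_mult) auto
    also have "\<dots> < \<sigma> * L" using L \<sigma>(1) by (intro mult_strict_left_mono)
    also have "\<dots> \<le> \<epsilon>" using \<sigma>(4) L by (simp add: pos_le_divide_eq)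
    finally show "\<exists>z. approximable s A e z \<and> wsummable A (\<lambda>i. z i - (if i = n then 1 else 0))
        \<and> wnorm A (\<lambda>i. z i - (if i = n then 1 else 0)) < \<epsilon>"
      using \<open>approximable s A e z\<close> sz by blast
  qed
qed

text \<open>
  Truncations are finite combinations of unit sequences.
\<close>

lemma approximable_wsummable:
  fixes e :: "'a::euclidean_space"
  assumes A: "A \<ge> 0" and s: "s > 0" and e: "norm e = 1" and y: "wsummable A y"
  shows "approximable s A e y"
proof (rule approximable_closed[OF A])
  fix \<epsilon> :: real assume \<epsilon>: "\<epsilon> > 0"
  let ?t = "\<lambda>i. A ^ i / (fact i)\<^sup>2 * \<bar>y i\<bar>"
  have st: "summable ?t" using y by (simp add: wsummable_def)
  from suminf_exist_split[OF \<epsilon> st] obtain N where N: "norm (\<Sum>i. ?t (i + N)) < \<epsilon>" by blast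
  define z where "z i = (\<Sum>n<N. y n * (if i = n then 1 else 0))" for i
  have z: "z i = (if i < N then y i else 0)" for i
    unfolding z_def by (simp add: if_distrib sum.delta cong: if_cong)
  have az: "approximable s A e z"
    unfolding z_def[abs_def] by (intro approximable_finite_sum[OF A s e] approximable_unit[OF A s e])
  define t where "t i = A ^ i / (fact i)\<^sup>2 * \<bar>z i - y i\<bar>" for i
  have t: "t i = (if i < N then 0 else ?t i)" for i by (simp add: t_def z)
  have sum: "summable t"
    by (rule summable_comparison_test'[OF st, of 0]) (use A in \<open>simp add: t abs_mult\<close>)
  have "wnorm A (\<lambda>i. z i - y i) = (\<Sum>i. t (i + N)) + (\<Sum>i<N. t i)"
    unfolding wnorm_def t_def[symmetric] by (rule suminf_split_initial_segment[OF sum])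
  also have "(\<Sum>i<N. t i) = 0" by (simp add: t)
  also have "(\<Sum>i. t (i + N)) = (\<Sum>i. ?t (i + N))" by (simp add: t)
  finally have "wnorm A (\<lambda>i. z i - y i) < \<epsilon>" using N by simp
  moreover have "wsummable A (\<lambda>i. z i - y i)" using sum by (simp add: wsummable_def t_def[abs_def])
  ultimately show "\<exists>z. approximable s A e z \<and> wsummable A (\<lambda>i. z i - y i) \<and> wnorm A (\<lambda>i. z i - y i) < \<epsilon>"
    using az by blast
qed

text \<open>
  Functions whose moments are close to those of the Gaussian inherit the sign.  Negativity is an open
  condition, so it also survives adding a small multiple of any test function.
\<close>

lemma negative_test_function:
  fixes e :: "'a::euclidean_space" and W :: "real \<Rightarrow> real"
  assumes e: "norm e = 1" and W: "even_entire W" and b: "b > 0" and s: "s > 0"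
    and neg: "(LBINT z. convolution (gaussian b :: 'a \<Rightarrow> real) (gaussian b) z * W (norm z)) < 0"
  obtains q :: "'a \<Rightarrow> real" where "test_function s q"
    "\<And>p t. test_function t p \<Longrightarrow> \<exists>\<delta>0>0. \<forall>\<delta>. 0 < \<delta> \<longrightarrow> \<delta> < \<delta>0 \<longrightarrow>
      (LBINT z. convolution (\<lambda>x. q x + \<delta> * p x) (\<lambda>x. q x + \<delta> * p x) z * W (norm z)) < 0"
proof -
  obtain h C M where C: "C \<ge> 0" and M: "M \<ge> 0" and h: "\<And>k. \<bar>h k\<bar> \<le> C * M ^ k / (fact k)\<^sup>2"
    and ex: "\<And>(q::'a \<Rightarrow> real) b. radial q \<Longrightarrow> gauss_bounded b q \<Longrightarrow> b > 0 \<Longrightarrow>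
      moment_form h (axis_moment e q) (axis_moment e q) sums (LBINT z. convolution q q z * W (norm z))"
    by (rule convolution_expansion[OF e W]) (rule that, assumption+)
  have form: "(\<Sum>k. moment_form h (axis_moment e q) (axis_moment e q) k) = (LBINT z. convolution q q z * W (norm z))"
    if "radial q" "gauss_bounded b q" "b > 0" for q :: "'a \<Rightarrow> real" and b
    using ex[OF that] by (simp add: sums_iff)
  let ?y = "axis_moment e (gaussian b :: 'a \<Rightarrow> real)"
  have A: "4 * M \<ge> 0" using M by simp
  have y: "wsummable (4 * M) ?y" by (rule axis_moment_wsummable[OF gauss_bounded_gaussian b e A])
  have "(\<Sum>k. moment_form h ?y ?y k) < 0"
    using neg form[OF radial_gaussian gauss_bounded_gaussian b] by simp
  from moment_form_negative_open[OF h C M y this] obtain \<epsilon> where \<epsilon>: "\<epsilon> > 0"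
    "\<And>x. wsummable (4 * M) x \<Longrightarrow> wnorm (4 * M) (\<lambda>i. x i - ?y i) < \<epsilon> \<Longrightarrow> (\<Sum>k. moment_form h x x k) < 0"
    by blast
  obtain q :: "'a \<Rightarrow> real" where q: "test_function s q" "wsummable (4 * M) (\<lambda>i. axis_moment e q i - ?y i)"
    "wnorm (4 * M) (\<lambda>i. axis_moment e q i - ?y i) < \<epsilon>"
    using approximable_wsummable[OF A s e y] \<epsilon>(1) unfolding approximable_def by blast
  show ?thesis
  proof (rule that[OF q(1)])
    fix p :: "'a \<Rightarrow> real" and t assume p: "test_function t p"
    have p': "test_function (max s t) p" and q': "test_function (max s t) q"
      using test_function_mono[OF p] test_function_mono[OF q(1)] by auto
    have wp: "wsummable (4 * M) (axis_moment e p)"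
      by (rule axis_moment_wsummable[OF test_function_gauss_bounded[OF p] zero_less_one e A])
    define P where "P = wnorm (4 * M) (axis_moment e p)"
    have P: "P \<ge> 0" unfolding P_def by (rule wnorm_nonneg[OF A wp])
    define g where "g = \<epsilon> - wnorm (4 * M) (\<lambda>i. axis_moment e q i - ?y i)"
    have g: "g > 0" using q(3) by (simp add: g_def)
    show "\<exists>\<delta>0>0. \<forall>\<delta>. 0 < \<delta> \<longrightarrow> \<delta> < \<delta>0 \<longrightarrow>
      (LBINT z. convolution (\<lambda>x. q x + \<delta> * p x) (\<lambda>x. q x + \<delta> * p x) z * W (norm z)) < 0"
    proof (intro exI[of _ "g / (P + 1)"] conjI allI impI)
      show "g / (P + 1) > 0" using g P by (intro divide_pos_pos) auto
      fix \<delta> :: real assume \<delta>: "0 < \<delta>" "\<delta> < g / (P + 1)"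
      let ?q = "\<lambda>x. q x + \<delta> * p x"
      have t: "test_function (max s t) ?q" by (intro test_function_add test_function_cmult p' q')
      have m: "axis_moment e ?q i = axis_moment e q i + \<delta> * axis_moment e p i" for i
        using axis_moment_add[OF test_function_gauss_bounded[OF q']
            test_function_gauss_bounded[OF test_function_cmult[OF p', of \<delta>]] zero_less_one e, of i]
        by (simp add: axis_moment_cmult)
      have wq: "wsummable (4 * M) (axis_moment e ?q)"
        by (rule axis_moment_wsummable[OF test_function_gauss_bounded[OF t] zero_less_one e A])
      have "wnorm (4 * M) (\<lambda>i. axis_moment e ?q i - ?y i) = wnorm (4 * M) (\<lambda>i. (axis_moment e q i - ?y i) + \<delta> * axis_moment e p i)"
        by (simp add: m algebra_simps)
      also have "\<dots> \<le> wnorm (4 * M) (\<lambda>i. axis_moment e q i - ?y i) + \<bar>\<delta>\<bar> * P"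
        using wnorm_add(2)[OF A q(2) wnorm_cmult(1)[OF wp, of \<delta>]] wnorm_cmult(2)[OF wp, of \<delta>]
        by (simp add: P_def)
      also have "\<dots> < \<epsilon>"
      proof -
        have "\<delta> * P \<le> \<delta> * (P + 1)" using \<delta> by simp
        also have "\<dots> < g" using \<delta> P by (simp add: pos_less_divide_eq)
        finally show ?thesis using \<delta> by (simp add: g_def)
      qed
      finally have "wnorm (4 * M) (\<lambda>i. axis_moment e ?q i - ?y i) < \<epsilon>" .
      from \<epsilon>(2)[OF wq this] form[OF _ test_function_gauss_bounded[OF t] zero_less_one] t
      show "(LBINT z. convolution ?q ?q z * W (norm z)) < 0"
        by (simp add: test_function_def)
    qed
  qed
qed

section \<open>Positive definite functions on the sphere\<close>

lemma sphere_integral_gegenbauer: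
  fixes e :: "'b::euclidean_space"
  assumes e: "norm e = 1" and D: "DIM('b) = DIM('a::euclidean_space) + 1"
    and g: "continuous_on UNIV g" "\<And>t. \<bar>g t\<bar> \<le> B"
  shows "(LBINT x:cball 0 1. g (x \<bullet> e / norm x)) =
    radial_density TYPE('a::euclidean_space) / DIM('b) * (LBINT r:{0..pi}. g (cos r) * sin r ^ (DIM('a) - 1))"
proof -
  have "DIM('b) \<ge> 2" using D DIM_positive[where 'a='a] by simp
  from integral_tan_substitution[OF g this] have
    "(LBINT \<tau>. g (\<tau> / sqrt (1 + \<tau>\<^sup>2)) * (1 / sqrt (1 + \<tau>\<^sup>2)) ^ DIM('b)) =
     (LBINT r:{0..pi}. g (cos r) * sin r ^ (DIM('a) - 1))"
    by (simp add: D)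
  with integral_ball_axis[OF e D borel_measurable_continuous_onI[OF g(1)]] show ?thesis by simp
qed

lemma nonneg_complex_of_real: "0 \<le> complex_of_real r \<longleftrightarrow> 0 \<le> r"
  by (simp add: less_eq_complex_def)

lemma positive_definite_real:
  fixes x :: "nat \<Rightarrow> 'x" and c :: "nat \<Rightarrow> real" and n :: nat
  assumes "positive_definite_on X K" "n \<ge> 1" "x ` {..<n} \<subseteq> X"
  shows "0 \<le> (\<Sum>j<n. \<Sum>k<n. c j * c k * K (x j) (x k))"
proof -
  have "0 \<le> kernel_form K n x (\<lambda>j. complex_of_real (c j))"
    using assms(1)[unfolded positive_definite_on_def, rule_format, OF assms(2,3)] .
  also have "kernel_form K n x (\<lambda>j. complex_of_real (c j)) = complex_of_real (\<Sum>j<n. \<Sum>k<n. c j * c k * K (x j) (x k))"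
    by (simp add: kernel_form_def)
  finally show ?thesis by (simp only: nonneg_complex_of_real)
qed

text \<open>
  The inner product of the trace-free matrices \<open>x x^T - I / D\<close> and \<open>y y^T - I / D\<close>; its entries are
  spherical harmonics of degree two.
\<close>

lemma addition_theorem_degree_two:
  fixes x y :: "'b::euclidean_space"
  assumes "norm x = 1" "norm y = 1"
  shows "(\<Sum>a\<in>Basis. \<Sum>b\<in>Basis. (((x \<bullet> a) * (x \<bullet> b)) - (if a = b then 1 / DIM('b) else 0)) *
      (((y \<bullet> a) * (y \<bullet> b)) - (if a = b then 1 / DIM('b) else 0))) = (x \<bullet> y)\<^sup>2 - 1 / DIM('b)"
proof -
  let ?D = "real DIM('b)"
  have sq: "(\<Sum>a\<in>Basis. (z \<bullet> a) * (z \<bullet> a)) = 1" if "norm z = 1" for z :: 'b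
    using that euclidean_inner[of z z] by (simp add: norm_eq_1)
  have eq: "(((x \<bullet> a) * (x \<bullet> b)) - (if a = b then 1 / ?D else 0)) * (((y \<bullet> a) * (y \<bullet> b)) - (if a = b then 1 / ?D else 0))
     = ((x \<bullet> a) * (y \<bullet> a)) * ((x \<bullet> b) * (y \<bullet> b)) + (if a = b then (1 / ?D) * (1 / ?D - (x \<bullet> a) * (x \<bullet> a) - (y \<bullet> a) * (y \<bullet> a)) else 0)" for a b
    by (simp add: algebra_simps)
  have "(\<Sum>a\<in>Basis. \<Sum>b\<in>Basis. (((x \<bullet> a) * (x \<bullet> b)) - (if a = b then 1 / ?D else 0)) *
      (((y \<bullet> a) * (y \<bullet> b)) - (if a = b then 1 / ?D else 0)))
    = (\<Sum>a\<in>Basis. \<Sum>b\<in>Basis. ((x \<bullet> a) * (y \<bullet> a)) * ((x \<bullet> b) * (y \<bullet> b))) +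
      (\<Sum>a\<in>(Basis :: 'b set). (1 / ?D) * (1 / ?D - (x \<bullet> a) * (x \<bullet> a) - (y \<bullet> a) * (y \<bullet> a)))"
    unfolding eq by (simp add: sum.distrib)
  also have "(\<Sum>a\<in>Basis. \<Sum>b\<in>Basis. ((x \<bullet> a) * (y \<bullet> a)) * ((x \<bullet> b) * (y \<bullet> b))) = (x \<bullet> y)\<^sup>2"
    unfolding power2_eq_square euclidean_inner[of x y] sum_product ..
  also have "(\<Sum>a\<in>(Basis :: 'b set). (1 / ?D) * (1 / ?D - (x \<bullet> a) * (x \<bullet> a) - (y \<bullet> a) * (y \<bullet> a))) = - 1 / ?D"
    unfolding sum_distrib_left[symmetric] sum_subtractf sq[OF assms(1)] sq[OF assms(2)] by simp
  finally show ?thesis by simp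
qed

text \<open>
  The Gegenbauer polynomial is a nonnegative multiple of the sum in the addition theorem, so the double
  sum splits into quadratic forms of \<open>K\<close>.
\<close>

lemma positive_definite_gegenbauer_sum:
  fixes x :: "nat \<Rightarrow> 'b::euclidean_space"
  assumes pd: "positive_definite_on (sphere 0 1) K" and n: "n \<ge> 1" and x: "\<And>j. j < n \<Longrightarrow> norm (x j) = 1"
    and D: "DIM('b) = d + 1" and d: "d \<ge> 1"
  shows "0 \<le> (\<Sum>j<n. \<Sum>k<n. K (x j) (x k) * gegenbauer 2 ((real d - 1) / 2) (x j \<bullet> x k))"
proof -
  define lam where "lam = (real d - 1) / 2"
  have lam: "lam \<ge> 0" "2 * (lam + 1) = real DIM('b)" using d by (auto simp: lam_def D field_simps)
  define Y where "Y a b z = ((z \<bullet> a) * (z \<bullet> b)) - (if a = b then 1 / real DIM('b) else 0)" for a b z :: 'b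
  have geg: "gegenbauer 2 lam t = lam * real DIM('b) * (t\<^sup>2 - 1 / real DIM('b))" for t
  proof -
    have "gegenbauer 2 lam t = lam * ((2 * (lam + 1)) * t\<^sup>2 - 1)" by (simp add: gegenbauer_2 algebra_simps)
    then show ?thesis unfolding lam(2) by (simp add: algebra_simps)
  qed
  have "(\<Sum>j<n. \<Sum>k<n. K (x j) (x k) * gegenbauer 2 lam (x j \<bullet> x k))
     = (\<Sum>j<n. \<Sum>k<n. lam * real DIM('b) * (\<Sum>a\<in>Basis. \<Sum>b\<in>Basis. Y a b (x j) * Y a b (x k) * K (x j) (x k)))"
  proof (intro sum.cong refl)
    fix j k assume "j \<in> {..<n}" "k \<in> {..<n}"
    then have "(\<Sum>a\<in>Basis. \<Sum>b\<in>Basis. Y a b (x j) * Y a b (x k)) = (x j \<bullet> x k)\<^sup>2 - 1 / real DIM('b)"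
      unfolding Y_def by (intro addition_theorem_degree_two x) auto
    then show "K (x j) (x k) * gegenbauer 2 lam (x j \<bullet> x k) =
        lam * real DIM('b) * (\<Sum>a\<in>Basis. \<Sum>b\<in>Basis. Y a b (x j) * Y a b (x k) * K (x j) (x k))"
      unfolding geg sum_distrib_right[symmetric] by simp
  qed
  also have "\<dots> = lam * real DIM('b) * (\<Sum>a\<in>Basis. \<Sum>b\<in>Basis. \<Sum>j<n. \<Sum>k<n. Y a b (x j) * Y a b (x k) * K (x j) (x k))"
    unfolding sum_distrib_left[symmetric]
    by (simp only: sum.swap[of _ "{..<n}" Basis])
  also have "\<dots> \<ge> 0"
    using lam(1) x by (intro mult_nonneg_nonneg sum_nonneg positive_definite_real[OF pd n]) auto
  finally show ?thesis unfolding lam_def .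
qed

text \<open>
  The mean of the function \<open>y \<mapsto> \<Sum>j<n. L (x j . y)\<close> over directions \<open>y\<close> is at most \<open>- \<beta> n\<close>, so
  some direction has a value of at most \<open>- \<beta> n\<close>; it becomes the next point.
\<close>

lemma greedy_points:
  fixes L :: "real \<Rightarrow> real"
  assumes L: "continuous_on UNIV L" "\<And>t. \<bar>L t\<bar> \<le> B" and \<beta>: "\<beta> > 0"
    and neg: "\<And>e. norm (e::'b::euclidean_space) = 1 \<Longrightarrow>
      (LBINT x:cball 0 1. L (x \<bullet> e / norm x)) < - \<beta> * measure lborel (cball 0 1 :: 'b set)"
  shows "\<exists>x :: nat \<Rightarrow> 'b. (\<forall>j<n. norm (x j) = 1) \<and> (\<forall>k<n. (\<Sum>j<k. L (x j \<bullet> x k)) \<le> - \<beta> * k)"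
proof (induction n)
  case (Suc n)
  then obtain x :: "nat \<Rightarrow> 'b" where x: "\<forall>j<n. norm (x j) = 1" "\<forall>k<n. (\<Sum>j<k. L (x j \<bullet> x k)) \<le> - \<beta> * k" by blast
  have [measurable]: "L \<in> borel_measurable borel" using L(1) by (rule borel_measurable_continuous_onI)
  let ?c = "cball 0 1 :: 'b set" and ?V = "measure lborel (cball 0 1 :: 'b set)"
  have [measurable]: "?c \<in> sets borel" by (intro borel_closed closed_cball)
  have fin: "emeasure lborel ?c < \<infinity>" by (simp add: emeasure_cball)
  have "\<exists>y. norm y = 1 \<and> (\<Sum>j<n. L (x j \<bullet> y)) \<le> - \<beta> * n"
  proof (cases "n = 0")
    case True
    have "norm (SOME i. i \<in> (Basis :: 'b set)) = 1" by (rule norm_Basis[OF SOME_Basis])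
    with True show ?thesis by (intro exI[of _ "SOME i. i \<in> (Basis :: 'b set)"]) simp
  next
    case False
    show ?thesis
    proof (rule ccontr)
      assume no: "\<not> ?thesis"
      have int: "set_integrable lborel ?c (\<lambda>y. L (y \<bullet> x j / norm y))" for j
        unfolding set_integrable_def
      proof (rule Bochner_Integration.integrable_bound[where f="\<lambda>y. B * indicat_real ?c y"])
        show "integrable lborel (\<lambda>y. B * indicat_real ?c y)" using fin by (intro integrable_mult_right) simp
        show "AE y in lborel. norm (indicat_real ?c y *\<^sub>R L (y \<bullet> x j / norm y)) \<le> norm (B * indicat_real ?c y)"
        proof (rule AE_I2)
          fix y
          show "norm (indicat_real ?c y *\<^sub>R L (y \<bullet> x j / norm y)) \<le> norm (B * indicat_real ?c y)"
            using order.trans[OF L(2) abs_ge_self, of "y \<bullet> x j / norm y"] by (simp add: indicator_def)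
        qed
      qed measurable
      have "- \<beta> * n * ?V = (LBINT y:?c. - \<beta> * n)"
        by (simp add: set_lebesgue_integral_def)
      also have "\<dots> \<le> (LBINT y:?c. (\<Sum>j<n. L (y \<bullet> x j / norm y)))"
        unfolding set_lebesgue_integral_def
      proof (rule integral_mono_AE)
        show "integrable lborel (\<lambda>y. indicat_real ?c y *\<^sub>R (- \<beta> * n))" using fin by simp
        show "integrable lborel (\<lambda>y. indicat_real ?c y *\<^sub>R (\<Sum>j<n. L (y \<bullet> x j / norm y)))"
          unfolding scaleR_sum_right using int unfolding set_integrable_def
          by (intro Bochner_Integration.integrable_sum) auto
        show "AE y in lborel. indicat_real ?c y *\<^sub>R (- \<beta> * n) \<le> indicat_real ?c y *\<^sub>R (\<Sum>j<n. L (y \<bullet> x j / norm y))"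
          using AE_lborel_singleton[of "0::'b"]
        proof eventually_elim
          case (elim y)
          have "norm ((1 / norm y) *\<^sub>R y) = 1" using elim by simp
          with no have "\<not> (\<Sum>j<n. L (x j \<bullet> ((1 / norm y) *\<^sub>R y))) \<le> - \<beta> * n" by blast
          then have "- \<beta> * n \<le> (\<Sum>j<n. L (y \<bullet> x j / norm y))" by (simp add: inner_commute)
          then show ?case by (intro scaleR_left_mono) auto
        qed
      qed
      also have "\<dots> = (\<Sum>j<n. LBINT y:?c. L (y \<bullet> x j / norm y))"
        unfolding set_lebesgue_integral_def scaleR_sum_right
        using int unfolding set_integrable_def by (intro Bochner_Integration.integral_sum) auto
      also have "\<dots> < (\<Sum>j<n. - \<beta> * ?V)"
        using x(1) False by (intro sum_strict_mono neg) auto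
      finally show False by simp
    qed
  qed
  then obtain y where y: "norm y = 1" "(\<Sum>j<n. L (x j \<bullet> y)) \<le> - \<beta> * n" by blast
  show ?case
  proof (intro exI[of _ "x(n := y)"] conjI allI impI)
    fix k assume k: "k < Suc n"
    have "(\<Sum>j<k. L ((x(n := y)) j \<bullet> (x(n := y)) k)) = (\<Sum>j<k. L (x j \<bullet> (x(n := y)) k))"
      using k by (intro sum.cong) auto
    then show "(\<Sum>j<k. L ((x(n := y)) j \<bullet> (x(n := y)) k)) \<le> - \<beta> * k"
      using x(2) y(2) k by (cases "k = n") auto
  qed (use x(1) y(1) in \<open>auto simp: less_Suc_eq\<close>)
qed auto

text \<open>
  The double sum over \<open>n\<close> greedily chosen points is at most \<open>n L(1) - \<beta> n (n - 1)\<close>, hence negative for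
  large \<open>n\<close>.
\<close>

lemma not_positive_definite_on_sphere:
  assumes \<phi>: "continuous_on {0..pi} \<phi>" and D: "DIM('b::euclidean_space) = DIM('a::euclidean_space) + 1"
    and neg: "gegenbauer_coeff 2 DIM('a) \<phi> < 0"
  shows "\<not> positive_definite_on (sphere 0 1 :: 'b set) (\<lambda>x y. \<phi> (geodesic_dist x y))"
proof
  assume pd: "positive_definite_on (sphere 0 1 :: 'b set) (\<lambda>x y. \<phi> (geodesic_dist x y))"
  let ?d = "DIM('a)"
  define G where "G = gegenbauer 2 ((real ?d - 1) / 2)"
  \<comment> \<open>clamping makes \<open>L\<close> continuous and bounded on the whole line\<close>
  define clamp where "clamp t = max (-1) (min 1 t)" for t :: real
  define L where "L t = \<phi> (arccos (clamp t)) * G (clamp t)" for t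
  have clamp: "-1 \<le> clamp t" "clamp t \<le> 1" for t by (auto simp: clamp_def)
  have clamp_id: "clamp t = t" if "-1 \<le> t" "t \<le> 1" for t using that by (auto simp: clamp_def)
  have cc: "continuous_on UNIV clamp" unfolding clamp_def by (intro continuous_intros)
  have L: "continuous_on UNIV L"
  proof -
    have "continuous_on UNIV (\<lambda>t. arccos (clamp t))"
      by (rule continuous_on_compose2[OF continuous_on_arccos' cc]) (use clamp in auto)
    then have "continuous_on UNIV (\<lambda>t. \<phi> (arccos (clamp t)))"
      by (rule continuous_on_compose2[OF \<phi>])
        (use clamp arccos_lbound arccos_ubound in \<open>auto simp: image_subset_iff\<close>)
    then show ?thesis
      unfolding L_def G_def gegenbauer_2 by (intro continuous_intros cc)
  qed
  have "bounded (L ` {-1..1})"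
    by (intro compact_imp_bounded compact_continuous_image continuous_on_subset[OF L]) auto
  then obtain B where "\<forall>y\<in>L ` {-1..1}. norm y \<le> B" unfolding bounded_iff by blast
  then have B0: "\<bar>L t\<bar> \<le> B" if "-1 \<le> t" "t \<le> 1" for t using that by auto
  have B: "\<bar>L t\<bar> \<le> B" for t
  proof -
    have "L t = L (clamp t)" using clamp by (simp add: L_def clamp_id)
    then show ?thesis using B0[of "clamp t"] clamp by simp
  qed
  define I where "I = radial_density TYPE('a) / DIM('b) * gegenbauer_coeff 2 ?d \<phi>"
  have I: "I < 0" unfolding I_def using neg radial_density_pos[where 'a='a] by (intro mult_pos_neg) auto
  have int: "(LBINT x:cball 0 1. L (x \<bullet> e / norm x)) = I" if "norm e = 1" for e :: 'b
  proof -
    have "(LBINT r:{0..pi}. L (cos r) * sin r ^ (?d - 1)) = gegenbauer_coeff 2 ?d \<phi>"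
      unfolding gegenbauer_coeff_def
      by (rule set_lebesgue_integral_cong) (auto simp: L_def G_def clamp_id arccos_cos)
    then show ?thesis using sphere_integral_gegenbauer[OF that D L B] by (simp add: I_def)
  qed
  define V where "V = measure lborel (cball 0 1 :: 'b set)"
  have V: "V > 0" by (simp add: V_def content_cball)
  define \<beta> where "\<beta> = - I / (2 * V)"
  have \<beta>: "\<beta> > 0" "I < - \<beta> * V" using I V by (auto simp: \<beta>_def divide_neg_pos)
  obtain n :: nat where n: "real n > \<bar>L 1\<bar> / \<beta> + 1" using reals_Archimedean2 by blast
  have "real n > 0" using n \<beta>(1) divide_nonneg_pos[of "\<bar>L 1\<bar>" \<beta>] by linarith
  then have n1: "n \<ge> 1" by simp
  obtain x :: "nat \<Rightarrow> 'b" where x: "\<And>j. j < n \<Longrightarrow> norm (x j) = 1" "\<And>k. k < n \<Longrightarrow> (\<Sum>j<k. L (x j \<bullet> x k)) \<le> - \<beta> * k"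
    using greedy_points[OF L B \<beta>(1), where 'b='b and n=n] int \<beta>(2) unfolding V_def by auto
  have S: "(\<Sum>j<N. \<Sum>k<N. L (x j \<bullet> x k)) \<le> N * L 1 - \<beta> * (N * (real N - 1))" if "N \<le> n" for N
    using that
  proof (induction N)
    case (Suc N)
    have "(\<Sum>j<Suc N. \<Sum>k<Suc N. L (x j \<bullet> x k)) =
       (\<Sum>j<N. \<Sum>k<N. L (x j \<bullet> x k)) + 2 * (\<Sum>j<N. L (x j \<bullet> x N)) + L (x N \<bullet> x N)"
      by (simp add: sum.distrib inner_commute)
    also have "\<dots> \<le> (N * L 1 - \<beta> * (N * (real N - 1))) + 2 * (- \<beta> * N) + L 1"
      using Suc x(2)[of N] x(1)[of N] by (simp add: norm_eq_1)
    finally show ?case by (simp add: algebra_simps)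
  qed simp
  have inner: "-1 \<le> x j \<bullet> x k" "x j \<bullet> x k \<le> 1" if "j < n" "k < n" for j k
    using Cauchy_Schwarz_ineq2[of "x j" "x k"] x(1) that by (auto simp: abs_le_iff)
  have "0 \<le> (\<Sum>j<n. \<Sum>k<n. \<phi> (geodesic_dist (x j) (x k)) * G (x j \<bullet> x k))"
    unfolding G_def by (rule positive_definite_gegenbauer_sum[OF pd n1 x(1) D]) (use DIM_positive[where 'a='a] in auto)
  also have "\<dots> = (\<Sum>j<n. \<Sum>k<n. L (x j \<bullet> x k))"
    using inner by (intro sum.cong refl) (auto simp: L_def geodesic_dist_def clamp_id)
  also have "\<dots> \<le> n * L 1 - \<beta> * (n * (real n - 1))" using S[of n] by simp
  also have "\<dots> = n * (L 1 - \<beta> * (real n - 1))" by (simp add: algebra_simps)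
  also have "\<dots> < 0"
  proof -
    have "\<bar>L 1\<bar> < \<beta> * (real n - 1)" using n \<beta>(1) by (simp add: field_simps)
    then have "L 1 - \<beta> * (real n - 1) < 0" by linarith
    then show ?thesis using n1 by (intro mult_pos_neg) auto
  qed
  finally show False by simp
qed

section \<open>Convolution squares as kernels on Euclidean space\<close>

text \<open>
  Positivity near the boundary of the ball gives the exact support radius of the convolution square and the
  linear independence of translates.
\<close>

definition positive_annulus :: "real \<Rightarrow> real \<Rightarrow> ('a::euclidean_space \<Rightarrow> real) \<Rightarrow> bool" where
  "positive_annulus s1 s q \<longleftrightarrow> 0 \<le> s1 \<and> s1 < s \<and> (\<forall>x. s1 < norm x \<longrightarrow> norm x < s \<longrightarrow> 0 < q x)"

lemma test_function_even: "test_function s q \<Longrightarrow> q (- x) = q x"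
  unfolding test_function_def radial_def by (metis norm_minus_cancel)

text \<open>
  In the closed ball of radius \<open>norm x\<close> around zero, \<open>x\<close> is the only point furthest in the direction \<open>u\<close>.
\<close>

lemma strict_inner_bound:
  fixes x y u :: "'a::real_inner"
  assumes u: "norm u = 1" "x = norm x *\<^sub>R u" and y: "norm y \<le> norm x" "y \<noteq> x"
  shows "y \<bullet> u < norm x"
proof (rule ccontr)
  assume "\<not> y \<bullet> u < norm x"
  then have ge: "norm x \<le> y \<bullet> u" by simp
  have "y \<bullet> u \<le> norm y" using norm_cauchy_schwarz[of y u] u(1) by simp
  then have eq: "y \<bullet> u = norm y * norm u" "norm y = norm x" using ge y(1) u(1) by auto
  then have "norm y *\<^sub>R u = norm u *\<^sub>R y" using norm_cauchy_schwarz_eq[of y u] by blast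
  then show False using u eq(2) y(2) by simp
qed

lemma convolution_square_inner:
  fixes q :: "'a::euclidean_space \<Rightarrow> real"
  assumes q: "test_function s q"
  shows "integrable lborel (\<lambda>z. q (x - z) * q (y - z))"
    and "convolution q q (x - y) = (LBINT z. q (x - z) * q (y - z))"
proof -
  have [measurable]: "q \<in> borel_measurable borel"
    using test_function_continuous[OF q] by (rule borel_measurable_continuous_onI)
  have eq: "(\<lambda>z. q (x - z) * q (y - z)) = (\<lambda>z. (\<lambda>w. q ((x - y) - w) * q w) (z - y))"
  proof
    fix z
    have "q (z - y) = q (y - z)" using test_function_even[OF q, of "y - z"] by simp
    then show "q (x - z) * q (y - z) = (\<lambda>w. q ((x - y) - w) * q w) (z - y)" by simp
  qed
  have "integrable lborel (\<lambda>w. q ((x - y) - w) * q w)"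
    by (rule gauss_bounded_convolution(2)[OF test_function_gauss_bounded[OF q] zero_less_one])
  then show "integrable lborel (\<lambda>z. q (x - z) * q (y - z))"
    unfolding eq by (subst integral_lborel_translation(2)) auto
  show "convolution q q (x - y) = (LBINT z. q (x - z) * q (y - z))"
    unfolding eq convolution_def by (subst integral_lborel_translation(1)) auto
qed

text \<open>
  Let \<open>x i\<close> have the largest norm among the points with nonzero coefficient, and move from it outwards by a
  little less than \<open>s\<close>.  The point reached is still within \<open>s\<close> of \<open>x i\<close> but not of any other of these points.
\<close>

lemma translates_independent:
  fixes q :: "'a::euclidean_space \<Rightarrow> real" and c :: "nat \<Rightarrow> complex"
  assumes q: "test_function s q" and pos: "positive_annulus s1 s q"
    and inj: "inj_on x {..<n}" and c: "\<exists>j<n. c j \<noteq> 0"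
  obtains z where "(\<Sum>j<n. c j * complex_of_real (q (x j - z))) \<noteq> 0"
proof -
  define J where "J = {j. j < n \<and> c j \<noteq> 0}"
  have J: "finite J" "J \<noteq> {}" using c by (auto simp: J_def)
  define r where "r = Max ((\<lambda>j. norm (x j)) ` J)"
  have "r \<in> (\<lambda>j. norm (x j)) ` J" unfolding r_def using J by (intro Max_in) auto
  then obtain i where i: "i \<in> J" "norm (x i) = r" by auto
  have max: "norm (x j) \<le> norm (x i)" if "j \<in> J" for j
    unfolding i(2) r_def using that J by (intro Max_ge) auto
  obtain u where u: "norm u = 1" "x i = norm (x i) *\<^sub>R u"
  proof (cases "x i = 0")
    case True
    then show ?thesis using that[of "SOME b. b \<in> (Basis :: 'a set)"] norm_Basis[OF SOME_Basis] by simp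
  next
    case False
    then show ?thesis using that[of "(1 / norm (x i)) *\<^sub>R x i"] by simp
  qed
  define g where "g j = norm (x i) - x j \<bullet> u" for j
  have g: "g j > 0" if "j \<in> J - {i}" for j
  proof -
    have "x j \<noteq> x i" using that i(1) inj by (auto simp: J_def inj_on_def)
    then show ?thesis using strict_inner_bound[OF u max, of j] that by (auto simp: g_def)
  qed
  \<comment> \<open>the entry one keeps the set nonempty when \<open>J = {i}\<close>\<close>
  define \<gamma> where "\<gamma> = Min (insert 1 (g ` (J - {i})))"
  have \<gamma>: "\<gamma> > 0" unfolding \<gamma>_def using J(1) g by (subst Min_gr_iff) auto
  have \<gamma>_le: "\<gamma> \<le> g j" if "j \<in> J - {i}" for j
    unfolding \<gamma>_def using that J(1) by (intro Min_le) auto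
  have s: "0 \<le> s1" "s1 < s" and annulus: "\<And>x. s1 < norm x \<Longrightarrow> norm x < s \<Longrightarrow> 0 < q x"
    using pos by (auto simp: positive_annulus_def)
  define t where "t = max ((s1 + s) / 2) (s - \<gamma>)"
  have t: "s1 < t" "t < s" "s \<le> t + \<gamma>" using s \<gamma> by (auto simp: t_def less_max_iff_disj)
  let ?z = "x i + t *\<^sub>R u"
  have "q (x i - ?z) > 0" by (rule annulus) (use t s u in auto)
  moreover have "q (x j - ?z) = 0" if "j \<in> J - {i}" for j
  proof -
    have "(?z - x j) \<bullet> u = (norm (x i) - x j \<bullet> u) + t"
    proof -
      have uu: "u \<bullet> u = 1" using u(1) by (simp add: norm_eq_1)
      have "x i \<bullet> u = norm (x i)" by (subst u(2)) (simp add: uu)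
      then show ?thesis by (simp add: inner_diff_left inner_add_left uu)
    qed
    then have "s \<le> (?z - x j) \<bullet> u" using \<gamma>_le[OF that] t(3) by (simp add: g_def)
    also have "\<dots> \<le> norm (?z - x j)" using norm_cauchy_schwarz[of "?z - x j" u] u(1) by simp
    finally show ?thesis using q by (simp add: test_function_def norm_minus_commute)
  qed
  moreover have "(\<Sum>j<n. c j * complex_of_real (q (x j - ?z))) = (\<Sum>j\<in>{i}. c j * complex_of_real (q (x j - ?z)))"
    using i(1) calculation(2) by (intro sum.mono_neutral_right) (auto simp: J_def)
  moreover have "c i \<noteq> 0" using i(1) by (simp add: J_def)
  ultimately show ?thesis by (intro that[of ?z]) simp
qed

text \<open>
  The quadratic form is the integral of the squared modulus of \<open>\<Sum>j<n. c j * q (x j - z)\<close> over \<open>z\<close>.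
\<close>

lemma strictly_positive_definite_convolution_square:
  fixes q :: "'a::euclidean_space \<Rightarrow> real"
  assumes q: "test_function s q" and pos: "positive_annulus s1 s q"
  shows "strictly_positive_definite_on UNIV (\<lambda>x y. convolution q q (x - y))"
  unfolding strictly_positive_definite_on_def
proof (intro allI impI)
  fix n :: nat and x :: "nat \<Rightarrow> 'a" and c :: "nat \<Rightarrow> complex"
  assume inj: "inj_on x {..<n}" and c: "\<exists>j<n. c j \<noteq> 0"
  define F where "F z = (\<Sum>j<n. c j * complex_of_real (q (x j - z)))" for z
  note int = convolution_square_inner[OF q]
  have eq: "(\<Sum>j<n. \<Sum>k<n. c j * cnj (c k) * complex_of_real (q (x j - z) * q (x k - z))) = complex_of_real ((cmod (F z))\<^sup>2)" for z
    unfolding F_def complex_norm_square by (simp add: sum_product mult_ac)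
  have intc: "integrable lborel (\<lambda>z. c j * cnj (c k) * complex_of_real (q (x j - z) * q (x k - z)))" for j k
    using int(1)[of "x j" "x k"] by (intro integrable_mult_right integrable_of_real)
  have "kernel_form (\<lambda>x y. convolution q q (x - y)) n x c =
     (\<Sum>j<n. \<Sum>k<n. LBINT z. c j * cnj (c k) * complex_of_real (q (x j - z) * q (x k - z)))"
    unfolding kernel_form_def int(2) by (simp flip: integral_complex_of_real)
  also have "\<dots> = (LBINT z. (\<Sum>j<n. \<Sum>k<n. c j * cnj (c k) * complex_of_real (q (x j - z) * q (x k - z))))"
    by (simp only: Bochner_Integration.integral_sum Bochner_Integration.integrable_sum intc)
  also have "\<dots> = complex_of_real (LBINT z. (cmod (F z))\<^sup>2)"
    unfolding eq by (rule integral_complex_of_real)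
  finally have form: "kernel_form (\<lambda>x y. convolution q q (x - y)) n x c = complex_of_real (LBINT z. (cmod (F z))\<^sup>2)" .
  have "integrable lborel (\<lambda>z. \<Sum>j<n. \<Sum>k<n. c j * cnj (c k) * complex_of_real (q (x j - z) * q (x k - z)))"
    by (intro Bochner_Integration.integrable_sum intc)
  then have iF: "integrable lborel (\<lambda>z. (cmod (F z))\<^sup>2)"
    unfolding eq by (simp only: complex_of_real_integrable_eq)
  obtain z where z: "F z \<noteq> 0" unfolding F_def by (rule translates_independent[OF q pos inj c])
  have "(LBINT z. (cmod (F z))\<^sup>2) > 0"
  proof (rule integral_pos)
    show "continuous_on UNIV (\<lambda>z. (cmod (F z))\<^sup>2)"
      unfolding F_def by (intro continuous_intros continuous_on_compose2[OF test_function_continuous[OF q]]) auto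
    show "(cmod (F z))\<^sup>2 > 0" using z by simp
  qed (use iF in auto)
  then show "0 < kernel_form (\<lambda>x y. convolution q q (x - y)) n x c"
    unfolding form by (simp add: less_complex_def)
qed

lemma convolution_square_eq_0:
  assumes q: "test_function s q" and x: "2 * s \<le> norm x"
  shows "convolution q q x = 0"
proof -
  have "q (x - y) * q y = 0" for y
  proof (rule ccontr)
    assume "q (x - y) * q y \<noteq> 0"
    then have "norm (x - y) < s" "norm y < s" using q unfolding test_function_def by (metis mult_eq_0_iff not_le)+
    moreover have "norm x \<le> norm (x - y) + norm y" using norm_triangle_ineq[of "x - y" y] by simp
    ultimately show False using x by linarith
  qed
  then have "(\<lambda>y. q (x - y) * q y) = (\<lambda>y. 0)" by (intro ext)
  then show ?thesis by (simp only: convolution_def integral_zero)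
qed

text \<open>
  At this distance both arguments \<open>x - y\<close> and \<open>y\<close> lie in the annulus on which \<open>q\<close> is positive, unless one of
  them lies outside the support, and the midpoint \<open>y = x / 2\<close> makes the integral strictly positive.
\<close>

lemma convolution_square_pos:
  assumes q: "test_function s q" and pos: "positive_annulus s1 s q" and x: "s1 + s < norm x" "norm x < 2 * s"
  shows "convolution q q x > 0"
  unfolding convolution_def
proof (rule integral_pos)
  have annulus: "\<And>x. s1 < norm x \<Longrightarrow> norm x < s \<Longrightarrow> 0 < q x"
    using pos by (auto simp: positive_annulus_def)
  have s: "s1 < s" using pos by (simp add: positive_annulus_def)
  note cont = test_function_continuous[OF q]
  show "continuous_on UNIV (\<lambda>y. q (x - y) * q y)"
    by (intro continuous_intros cont continuous_on_compose2[OF cont]) auto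
  show "integrable lborel (\<lambda>y. q (x - y) * q y)"
    by (rule gauss_bounded_convolution(2)[OF test_function_gauss_bounded[OF q] zero_less_one])
  show "0 \<le> q (x - y) * q y" for y
  proof (cases "norm (x - y) < s \<and> norm y < s")
    case True
    have "norm x \<le> norm (x - y) + norm y" using norm_triangle_ineq[of "x - y" y] by simp
    with True x(1) have "s1 < norm (x - y)" "s1 < norm y" by auto
    with True annulus show ?thesis by (intro mult_nonneg_nonneg) (auto intro: less_imp_le)
  next
    case False
    then have "q (x - y) = 0 \<or> q y = 0" using q by (auto simp: test_function_def not_less)
    then show ?thesis by auto
  qed
  show "0 < q (x - (1/2) *\<^sub>R x) * q ((1/2) *\<^sub>R x)"
  proof -
    have "x - (1/2) *\<^sub>R x = (1/2) *\<^sub>R x" by (simp add: algebra_simps scaleR_2[symmetric])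
    moreover have "0 < q ((1/2) *\<^sub>R x)" using x s by (intro annulus) auto
    ultimately show ?thesis by simp
  qed
qed

lemma C_c_infinity_bounded:
  fixes f :: "'a::euclidean_space \<Rightarrow> real"
  assumes "\<And>k. C_k k f" "\<And>x. s < norm x \<Longrightarrow> f x = 0"
  shows "C_c_infinity f"
proof -
  have "support_on UNIV f \<subseteq> cball 0 s" using assms(2) by (force simp: support_on_def)
  then have "bounded (support_on UNIV f)" by (rule bounded_subset[OF bounded_cball])
  then have "compact (supp f)" unfolding supp_def by (simp add: compact_closure)
  with assms(1) show ?thesis by (simp add: C_c_infinity_def)
qed

lemma test_function_C_c_infinity: "test_function s q \<Longrightarrow> C_c_infinity q"
  by (rule C_c_infinity_bounded[of _ s]) (auto simp: test_function_def)

lemma C_c_infinity_convolution_square: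
  fixes q :: "'a::euclidean_space \<Rightarrow> real"
  assumes q: "test_function s q"
  shows "C_c_infinity (convolution q q)"
proof (rule C_c_infinity_bounded)
  obtain a where a: "cball 0 s \<subseteq> cbox (- a) (a :: 'a)"
    using bounded_subset_cbox_symmetric[OF bounded_cball] by blast
  have "q y = 0" if "y \<notin> cbox (- a) a" for y
    using q a that by (force simp: test_function_def)
  then show "C_k k (convolution q q)" for k
    using C_k_convolution[of k q q "- a" a] q test_function_continuous[OF q] by (simp add: test_function_def)
  show "2 * s < norm x \<Longrightarrow> convolution q q x = 0" for x
    using convolution_square_eq_0[OF q, of x] by simp
qed

lemma radial_convolution_square:
  assumes "test_function s q"
  shows "radial (convolution q q)"
  using assms test_function_continuous[OF assms]
  by (intro radial_convolution) (auto simp: test_function_def intro: borel_measurable_continuous_onI)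

lemma convolution_square_profile:
  assumes q: "test_function s q" and e: "norm e = 1"
  shows "convolution q q z = convolution q q (norm z *\<^sub>R e)"
  by (rule radial_convolution_square[OF q, unfolded radial_def, rule_format]) (simp add: e)

lemma support_radius_convolution_square:
  fixes e :: "'a::euclidean_space"
  assumes q: "test_function s q" and pos: "positive_annulus s1 s q" and e: "norm e = 1"
  shows "has_support_radius (\<lambda>r. convolution q q (r *\<^sub>R e)) (2 * s)"
proof -
  let ?S = "support_on {0..} (\<lambda>r. convolution q q (r *\<^sub>R e))"
  have s: "0 \<le> s1" "s1 < s" using pos by (auto simp: positive_annulus_def)
  have "?S \<subseteq> {..2 * s}"
  proof
    fix r assume r: "r \<in> ?S"
    show "r \<in> {..2 * s}"
    proof (rule ccontr)
      assume "r \<notin> {..2 * s}"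
      then have "convolution q q (r *\<^sub>R e) = 0"
        using e s by (intro convolution_square_eq_0[OF q]) auto
      with r show False by (simp add: support_on_def)
    qed
  qed
  then have "closure ?S \<subseteq> {..2 * s}" by (intro closure_minimal) auto
  moreover have "{s1 + s<..<2 * s} \<subseteq> ?S"
  proof
    fix r assume r: "r \<in> {s1 + s<..<2 * s}"
    then have "convolution q q (r *\<^sub>R e) > 0"
      using e s by (intro convolution_square_pos[OF q pos]) auto
    with r s show "r \<in> ?S" by (simp add: support_on_def)
  qed
  then have "closure {s1 + s<..<2 * s} \<subseteq> closure ?S" by (rule closure_mono)
  moreover have "closure {s1 + s<..<2 * s} = {s1 + s..2 * s}" using s by (intro closure_greaterThanLessThan) simp
  ultimately show ?thesis using s unfolding has_support_radius_def by auto
qed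

section \<open>Construction of the counterexample\<close>

text \<open>
  Take a countable dense set.  The sum can vanish at one of its points in the ball for a single value of
  \<open>\<delta>\<close> only, so all but countably many \<open>\<delta>\<close> make it nonzero on a dense subset.
\<close>

lemma supp_generic_perturbation:
  fixes q p :: "'a::euclidean_space \<Rightarrow> real"
  assumes s: "s > 0" and q: "test_function s q" and p: "test_function s p" "\<And>x. norm x < s \<Longrightarrow> p x \<noteq> 0"
    and d: "\<delta>0 > 0"
  obtains \<delta> where "0 < \<delta>" "\<delta> < \<delta>0" "supp (\<lambda>x. q x + \<delta> * p x) = cball 0 s"
proof -
  obtain Q :: "'a set" where Q: "countable Q" "\<And>X. open X \<Longrightarrow> X \<noteq> {} \<Longrightarrow> \<exists>d\<in>Q. d \<in> X"
    by (rule countable_dense_setE) blast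
  define X where "X = {0<..<\<delta>0} - (\<lambda>x. - q x / p x) ` Q"
  have "uncountable X" unfolding X_def
    using d Q(1) by (intro uncountable_minus_countable) (auto simp: uncountable_open_interval)
  then have "X \<noteq> {}" by auto
  then obtain \<delta> where "\<delta> \<in> X" by blast
  then have \<delta>: "0 < \<delta>" "\<delta> < \<delta>0" "\<delta> \<notin> (\<lambda>x. - q x / p x) ` Q" by (simp_all add: X_def)
  let ?f = "\<lambda>x. q x + \<delta> * p x"
  have "test_function s ?f" by (intro test_function_add test_function_cmult q p)
  then have out: "?f x = 0" if "s \<le> norm x" for x using that by (simp add: test_function_def)
  have "support_on UNIV ?f \<subseteq> cball 0 s"
    using out by (force simp: support_on_def)
  then have "supp ?f \<subseteq> cball 0 s" unfolding supp_def by (intro closure_minimal) auto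
  moreover have "ball 0 s \<subseteq> supp ?f"
  proof
    fix x :: 'a assume x: "x \<in> ball 0 s"
    show "x \<in> supp ?f" unfolding supp_def closure_approachable
    proof (intro allI impI)
      fix \<epsilon> :: real assume "\<epsilon> > 0"
      then have "open (ball 0 s \<inter> ball x \<epsilon>)" "x \<in> ball 0 s \<inter> ball x \<epsilon>" using x by auto
      then obtain y where y: "y \<in> Q" "y \<in> ball 0 s" "y \<in> ball x \<epsilon>" using Q(2) by blast
      have "?f y \<noteq> 0"
      proof
        assume "?f y = 0"
        then have "\<delta> = - q y / p y" using p(2)[of y] y(2) by (simp add: field_simps)
        with \<delta>(3) y(1) show False by blast
      qed
      then show "\<exists>y\<in>support_on UNIV ?f. dist y x < \<epsilon>"
        using y(3) by (auto simp: support_on_def dist_commute)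
    qed
  qed
  then have "closure (ball 0 s) \<subseteq> supp ?f" unfolding supp_def by (intro closure_minimal) auto
  then have "cball 0 s \<subseteq> supp ?f" using s by simp
  ultimately show ?thesis using that \<delta>(1,2) by blast
qed

text \<open>
  Polar coordinates; the hypothesis on \<open>s\<close> makes the profile vanish beyond \<open>pi\<close>, where the Gegenbauer
  integral ends.
\<close>

lemma gegenbauer_coeff_convolution_square:
  fixes e :: "'a::euclidean_space"
  assumes q: "test_function s q" and s: "2 * s \<le> pi" and e: "norm e = 1" and d: "DIM('a) \<ge> 2"
  shows "(LBINT z. convolution q q z * gegenbauer_kernel DIM('a) (norm z)) =
    radial_density TYPE('a) * gegenbauer_coeff 2 DIM('a) (\<lambda>r. convolution q q (r *\<^sub>R e))"
proof -
  let ?d = "DIM('a)" and ?\<phi> = "\<lambda>r. convolution q q (r *\<^sub>R e)"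
  note rad = convolution_square_profile[OF q e]
  have "continuous_on UNIV (convolution q q)"
    using C_c_infinity_convolution_square[OF q] by (auto simp: C_c_infinity_def intro: C_k_continuous)
  then have "continuous_on UNIV ?\<phi>" by (rule continuous_on_compose2) (auto intro!: continuous_intros)
  then have [measurable]: "?\<phi> \<in> borel_measurable borel" by (rule borel_measurable_continuous_onI)
  have [measurable]: "gegenbauer_kernel ?d \<in> borel_measurable borel"
    unfolding gegenbauer_kernel_def[abs_def] gegenbauer_2 sinc_def[abs_def] by measurable
  have "(LBINT z. convolution q q z * gegenbauer_kernel ?d (norm z)) =
      (LBINT z. ?\<phi> (norm (z::'a)) * gegenbauer_kernel ?d (norm z))"
    by (intro Bochner_Integration.integral_cong refl arg_cong2[where f="(*)"] rad)
  also have "\<dots> = radial_density TYPE('a) * (LBINT r:{0..}. (?\<phi> r * gegenbauer_kernel ?d r) * r ^ (?d - 1))"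
    by (rule integrable_radial_iff(2)[of "\<lambda>r. ?\<phi> r * gegenbauer_kernel ?d r"]) measurable
  also have "(LBINT r:{0..}. (?\<phi> r * gegenbauer_kernel ?d r) * r ^ (?d - 1)) = gegenbauer_coeff 2 ?d ?\<phi>"
    unfolding gegenbauer_coeff_def set_lebesgue_integral_def
  proof (intro Bochner_Integration.integral_cong refl)
    fix r :: real
    have w: "(?\<phi> r * gegenbauer_kernel ?d r) * r ^ (?d - 1) = ?\<phi> r * gegenbauer_weight ?d r"
      using gegenbauer_kernel_weight[OF d, of r] by (simp add: mult.assoc)
    have "?\<phi> r = 0" if "r > pi"
      using that e s pi_gt_zero by (intro convolution_square_eq_0[OF q]) auto
    then show "indicat_real {0..} r *\<^sub>R ((?\<phi> r * gegenbauer_kernel ?d r) * r ^ (?d - 1)) =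
      indicat_real {0..pi} r *\<^sub>R (?\<phi> r * gegenbauer 2 ((real ?d - 1) / 2) (cos r) * sin r ^ (?d - 1))"
      unfolding w by (auto simp: indicator_def gegenbauer_weight_def)
  qed
  finally show ?thesis .
qed

text \<open>
  The convolution square of a Gaussian is again a Gaussian, with half the exponent.
\<close>

lemma gaussian_kernel_negative:
  assumes d: "even DIM('a::euclidean_space)" "DIM('a) \<ge> 2"
  obtains b where "b > 0"
    "(LBINT z. convolution (gaussian b :: 'a \<Rightarrow> real) (gaussian b) z * gegenbauer_kernel DIM('a) (norm z)) < 0"
proof -
  let ?d = "DIM('a)"
  obtain a where a: "a > 0" "(LBINT r:{0..}. gegenbauer_weight ?d r * exp (- a * r\<^sup>2)) < 0"
    using gaussian_gegenbauer_negative[OF d] by blast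
  define b where "b = 2 * a"
  have b: "b > 0" using a by (simp add: b_def)
  define C where "C = (LBINT y. gaussian (2 * b) (y::'a))"
  have C: "C > 0" unfolding C_def
    by (rule integral_pos[where x=0])
      (use b integrable_gaussian[of "2 * b", where 'a='a] in \<open>auto simp: gaussian_def[abs_def] intro!: continuous_intros\<close>)
  have [measurable]: "gegenbauer_kernel ?d \<in> borel_measurable borel"
    unfolding gegenbauer_kernel_def[abs_def] gegenbauer_2 sinc_def[abs_def] by measurable
  have "(LBINT z. convolution (gaussian b :: 'a \<Rightarrow> real) (gaussian b) z * gegenbauer_kernel ?d (norm z)) =
     C * (LBINT z. exp (- a * (norm (z::'a))\<^sup>2) * gegenbauer_kernel ?d (norm z))"
    unfolding convolution_gaussian[OF b] C_def[symmetric] by (simp add: gaussian_def b_def mult.assoc)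
  also have "(LBINT z. exp (- a * (norm (z::'a))\<^sup>2) * gegenbauer_kernel ?d (norm z)) =
     radial_density TYPE('a) * (LBINT r:{0..}. (exp (- a * r\<^sup>2) * gegenbauer_kernel ?d r) * r ^ (?d - 1))"
    by (rule integrable_radial_iff(2)[of "\<lambda>r. exp (- a * r\<^sup>2) * gegenbauer_kernel ?d r"]) measurable
  also have "(\<lambda>r. (exp (- a * r\<^sup>2) * gegenbauer_kernel ?d r) * r ^ (?d - 1)) = (\<lambda>r. gegenbauer_weight ?d r * exp (- a * r\<^sup>2))"
    using gegenbauer_kernel_weight[OF d(2)] by (simp add: mult_ac fun_eq_iff)
  also have "C * (radial_density TYPE('a) * (LBINT r:{0..}. gegenbauer_weight ?d r * exp (- a * r\<^sup>2))) < 0"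
    using C a(2) radial_density_pos[where 'a='a] by (intro mult_pos_neg)
  finally show ?thesis using that b by blast
qed

text \<open>
  The test function with negative form is taken in the ball of radius \<open>R / 4\<close> so that on the outer half of
  the ball of radius \<open>R / 2\<close> only the positive bump contributes.
\<close>

lemma convolution_square_negative_gegenbauer:
  fixes e :: "'a::euclidean_space"
  assumes d: "even DIM('a)" and R: "0 < R" "R \<le> pi" and e: "norm e = 1"
  obtains q s1 where "test_function (R / 2) (q :: 'a \<Rightarrow> real)" "positive_annulus s1 (R / 2) q" "supp q = cball 0 (R / 2)"
    "gegenbauer_coeff 2 DIM('a) (\<lambda>r. convolution q q (r *\<^sub>R e)) < 0"
proof -
  have d2: "DIM('a) \<ge> 2"
    using d DIM_positive[where 'a='a] by presburger
  let ?W = "gegenbauer_kernel DIM('a)"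
  obtain b where b: "b > 0" "(LBINT z. convolution (gaussian b :: 'a \<Rightarrow> real) (gaussian b) z * ?W (norm z)) < 0"
    using gaussian_kernel_negative[OF d d2] .
  have R4: "R / 4 > 0" "R / 2 > 0" using R by auto
  obtain q0 :: "'a \<Rightarrow> real" where q0: "test_function (R / 4) q0"
    "\<And>p t. test_function t p \<Longrightarrow> \<exists>\<delta>0>0. \<forall>\<delta>. 0 < \<delta> \<longrightarrow> \<delta> < \<delta>0 \<longrightarrow>
      (LBINT z. convolution (\<lambda>x. q0 x + \<delta> * p x) (\<lambda>x. q0 x + \<delta> * p x) z * ?W (norm z)) < 0"
    by (rule negative_test_function[OF e even_entire_gegenbauer_kernel b(1) R4(1) b(2)]) blast
  let ?p = "bump (R / 2) :: 'a \<Rightarrow> real"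
  have p: "test_function (R / 2) ?p" by (rule test_function_bump[OF R4(2)])
  obtain \<delta>0 where \<delta>0: "\<delta>0 > 0" "\<And>\<delta>. 0 < \<delta> \<Longrightarrow> \<delta> < \<delta>0 \<Longrightarrow>
      (LBINT z. convolution (\<lambda>x. q0 x + \<delta> * ?p x) (\<lambda>x. q0 x + \<delta> * ?p x) z * ?W (norm z)) < 0"
    using q0(2)[OF p] by blast
  have q0': "test_function (R / 2) q0" by (rule test_function_mono[OF q0(1)]) (use R in simp)
  have pnz: "?p x \<noteq> 0" if "norm x < R / 2" for x using bump_pos_iff[OF R4(2), of x] that by simp
  obtain \<delta> where \<delta>: "0 < \<delta>" "\<delta> < \<delta>0" "supp (\<lambda>x. q0 x + \<delta> * ?p x) = cball 0 (R / 2)"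
    using supp_generic_perturbation[OF R4(2) q0' p pnz \<delta>0(1)] by blast
  let ?q = "\<lambda>x. q0 x + \<delta> * ?p x"
  have q: "test_function (R / 2) ?q" by (intro test_function_add test_function_cmult q0' p)
  have "positive_annulus (R / 4) (R / 2) ?q"
    unfolding positive_annulus_def
  proof (intro conjI allI impI)
    fix x :: 'a assume x: "R / 4 < norm x" "norm x < R / 2"
    then have "q0 x = 0" using q0(1) by (simp add: test_function_def)
    moreover have "?p x > 0" using x bump_pos_iff[OF R4(2), of x] by simp
    ultimately show "0 < q0 x + \<delta> * ?p x" using \<delta>(1) by simp
  qed (use R in auto)
  moreover have "gegenbauer_coeff 2 DIM('a) (\<lambda>r. convolution ?q ?q (r *\<^sub>R e)) < 0"
  proof -
    have "radial_density TYPE('a) * gegenbauer_coeff 2 DIM('a) (\<lambda>r. convolution ?q ?q (r *\<^sub>R e)) < 0"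
      using gegenbauer_coeff_convolution_square[OF q _ e d2] \<delta>0(2)[OF \<delta>(1,2)] R(2) by simp
    then show ?thesis using radial_density_pos[where 'a='a] by (simp add: mult_less_0_iff)
  qed
  ultimately show ?thesis using that[OF q _ \<delta>(3)] by blast
qed

section \<open>The theorem\<close>

(* R^d is real^'d and R^(d+1) is real^'e; e1 is the index of the first coordinate of R^d. *)
theorem theorem1p1:
  fixes m :: nat and R :: real and e1 :: "'d::finite"
  assumes "m \<ge> 1"
    and "CARD('d) = 2 * m"
    and "CARD('e::finite) = CARD('d) + 1"
    and "0 < R" and "R \<le> pi"
  shows "\<exists>\<phi> :: real \<Rightarrow> real.
      C_c_infinity (\<lambda>x :: real^'d. \<phi> (norm x)) \<and>
      has_support_radius \<phi> R \<and>
      strictly_positive_definite_on (UNIV :: (real^'d) set) (\<lambda>x y. \<phi> (norm (x - y))) \<and>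
      \<not> positive_definite_on (sphere 0 1 :: (real^'e) set) (\<lambda>x y. \<phi> (geodesic_dist x y)) \<and>
      (\<exists>q :: real^'d \<Rightarrow> real.
         C_c_infinity q \<and> radial q \<and> (\<exists>x. q x \<noteq> 0) \<and> supp q = cball 0 (R / 2) \<and>
         (\<forall>r\<ge>0. \<phi> r = convolution q q (r *\<^sub>R axis e1 1))) \<and>
      gegenbauer_coeff 2 (2 * m) \<phi> < 0"
proof -
  let ?e = "axis e1 1 :: real^'d"
  have e: "norm ?e = 1" by simp
  have dim: "DIM(real^'d) = 2 * m" "DIM(real^'e) = DIM(real^'d) + 1"
    using assms(2,3) by simp_all
  have ev: "even DIM(real^'d)" unfolding dim(1) by simp
  obtain q :: "real^'d \<Rightarrow> real" and s1 where q: "test_function (R / 2) q" "positive_annulus s1 (R / 2) q"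
    "supp q = cball 0 (R / 2)" and neg: "gegenbauer_coeff 2 DIM(real^'d) (\<lambda>r. convolution q q (r *\<^sub>R ?e)) < 0"
    by (rule convolution_square_negative_gegenbauer[OF ev assms(4,5) e]) (rule that)
  let ?\<phi> = "\<lambda>r. convolution q q (r *\<^sub>R ?e)"
  note rad = convolution_square_profile[OF q(1) e]
  have rad': "(\<lambda>z. ?\<phi> (norm z)) = convolution q q" by (rule ext) (rule rad[symmetric])
  have smooth: "C_c_infinity (convolution q q)" by (rule C_c_infinity_convolution_square[OF q(1)])
  then have "continuous_on UNIV (convolution q q)" by (auto simp: C_c_infinity_def intro: C_k_continuous)
  then have cont: "continuous_on {0..pi} ?\<phi>"
    by (rule continuous_on_compose2) (auto intro!: continuous_intros)
  have "0 < q ((1 / 2 * (s1 + R / 2)) *\<^sub>R ?e)"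
    using q(2) e by (simp add: positive_annulus_def)
  then have nz: "\<exists>x. q x \<noteq> 0" by (metis less_irrefl)
  show ?thesis
  proof (intro exI[of _ ?\<phi>] conjI)
    show "C_c_infinity (\<lambda>x :: real^'d. ?\<phi> (norm x))" unfolding rad' by (rule smooth)
    show "has_support_radius ?\<phi> R"
      using support_radius_convolution_square[OF q(1,2) e] by simp
    show "strictly_positive_definite_on (UNIV :: (real^'d) set) (\<lambda>x y. ?\<phi> (norm (x - y)))"
      unfolding rad[symmetric] by (rule strictly_positive_definite_convolution_square[OF q(1,2)])
    show "\<not> positive_definite_on (sphere 0 1 :: (real^'e) set) (\<lambda>x y. ?\<phi> (geodesic_dist x y))"
      by (rule not_positive_definite_on_sphere[OF cont dim(2) neg])
    show "\<exists>q' :: real^'d \<Rightarrow> real. C_c_infinity q' \<and> radial q' \<and> (\<exists>x. q' x \<noteq> 0) \<and> supp q' = cball 0 (R / 2) \<and>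
         (\<forall>r\<ge>0. ?\<phi> r = convolution q' q' (r *\<^sub>R axis e1 1))"
      using test_function_C_c_infinity[OF q(1)] q(1,3) nz by (intro exI[of _ q]) (auto simp: test_function_def)
    show "gegenbauer_coeff 2 (2 * m) ?\<phi> < 0" using neg unfolding dim(1) .
  qed
qed

end
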